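(* The monoid ${\cal RM}^{n+o(n)}/\!\equiv_{\sf poly}$ is isomorphic to ${\cal RM}^{\sf P}/\!\equiv_{\sf poly}$ $(={\cal M}^{\sf P}_{\sf poly})$.
   Context: Let $A=\{0,1\}$, $A^*$ the set of all finite words over $A$, $|x|$ the length of $x$. "Function" means partial function; ${\sf Dom}(f)$ is the domain of $f$. For words $v,w$: $v \parallel_{\sf pref} w$ means that one of $v,w$ is a prefix of the other. A prefix code is a set $P\subset A^*$ in which no two distinct elements are prefix-comparable. A right ideal is a set $R\subseteq A^*$ with $RA^*=R$; every right ideal $R$ equals $PA^*$ for a unique prefix code $P$. A right-ideal morphism is a partial function $h:A^*\to A^*$ such that ${\sf Dom}(h)$ is a right ideal and $h(xw)=h(x)\,w$ for all $x\in{\sf Dom}(h)$, $w\in A^*$. ${\sf domC}(h)$ is the prefix code that generates ${\sf Dom}(h)$ as a right ideal. ${\cal RM}^{\sf P}$ is the monoid (under composition) of all right-ideal morphisms $f$ of $A^*$ that are computable by deterministic Turing machines in polynomial time and are polynomially balanced (there is a polynomial $p$ with $|f(x)|\le p(|x|)$ and $|x|\le p(|f(x)|)$ for all $x\in{\sf Dom}(f)$). For $L_1,L_2\subseteq A^*$: $L_1\equiv_{\sf end}L_2$ iff $L_1A^*$ and $L_2A^*$ intersect (i.e., meet in a nonempty set) the same right ideals of $A^*$. For prefix codes $P_1,P_2$: $P_1\equiv_{\sf poly}P_2$ iff $P_1\equiv_{\sf end}P_2$ and there is a polynomial $\tau$ with non-negative integer coefficients such that for all $x_1\in P_1$, $x_2\in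 P_2$ with $x_1\parallel_{\sf pref}x_2$: $|x_1|\le\tau(|x_2|)$ and $|x_2|\le\tau(|x_1|)$. For right-ideal morphisms: $f\equiv_{\sf poly}g$ iff ${\sf domC}(f)\equiv_{\sf poly}{\sf domC}(g)$ and $f,g$ agree on ${\sf Dom}(f)\cap{\sf Dom}(g)$. This is a congruence on ${\cal RM}^{\sf P}$ (hence on its submonoids). A total function $t:{\mathbb N}\to{\mathbb N}$ is said to be $n+o(n)$ iff there is a total function $\epsilon:{\mathbb N}\to{\mathbb R}_{\ge0}$ with $\lim_{n\to\infty}\epsilon(n)=0$ and $t(n)\le n+\epsilon(n)\cdot n$ for all $n$. An ${\cal RM}^{\sf P}$-machine is a deterministic multi-tape Turing machine $M$ with a read-only input-tape and a write-only output-tape, such that the input-tape head and the output-tape head never move left. It has an accept state; when $M$ halts, the content of the output-tape is a valid output iff $M$ is in the accept state (otherwise the output is undefined). Let $f_M$ be the input-output function of $M$. It is assumed that for every $x\in{\sf Dom}(f_M)$ and $z\in A^*$, in the computation of $M$ on input $xz$ the input-tape head does not start reading $z$ until $f_M(x)$ has been written on the output-tape (to read a letter means to make a transition whose input-tape letter is this letter). ${\cal RM}^{n+o(n)}$ is the set of all $f\in{\cal RM}^{\sf P}$ that can be computed by an ${\cal RM}^{\sf P}$-machine whose input-output balance and time-complexity are $n+o(n)$; i.e., for some function $t$ that is $n+o(n)$ and all $x\in{\sf Dom}(f)$: $|f(x)|\le t(|x|)$, $|x|\le t(|f(x)|)$, and the running time on $x$ is $\le t(|x|)$. The time bound is only assumed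 on inputs $x\in{\sf Dom}(f)$. This set is a submonoid of ${\cal RM}^{\sf P}$. *)

theory Defs
  imports
    Complex_Main
    "HOL-Library.Sublist"
    "HOL-Computational_Algebra.Polynomial"
    "HOL-Algebra.Group"
begin

section \<open>Right ideals, prefix codes and right-ideal morphisms of \<open>{0,1}\<^sup>*\<close>\<close>

type_synonym word = "bool list"

definition gen_ideal :: "word set \<Rightarrow> word set" where
  "gen_ideal L = {x @ w | x w. x \<in> L}"

definition right_ideal :: "word set \<Rightarrow> bool" where
  "right_ideal R \<longleftrightarrow> gen_ideal R = R"

definition pref_comparable :: "word \<Rightarrow> word \<Rightarrow> bool" where
  "pref_comparable v w \<longleftrightarrow> prefix v w \<or> prefix w v"

definition prefix_code :: "word set \<Rightarrow> bool" where
  "prefix_code P \<longleftrightarrow> (\<forall>v\<in>P. \<forall>w\<in>P. v \<noteq> w \<longrightarrow> \<not> pref_comparable v w)"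

definition right_ideal_morphism :: "(word \<rightharpoonup> word) \<Rightarrow> bool" where
  "right_ideal_morphism h \<longleftrightarrow>
     right_ideal (dom h) \<and> (\<forall>x y w. h x = Some y \<longrightarrow> h (x @ w) = Some (y @ w))"

definition domC :: "(word \<rightharpoonup> word) \<Rightarrow> word set" where
  "domC h = (THE P. prefix_code P \<and> gen_ideal P = dom h)"


section \<open>The equivalences\<close>

definition end_equiv :: "word set \<Rightarrow> word set \<Rightarrow> bool" where
  "end_equiv L1 L2 \<longleftrightarrow>
     (\<forall>R. right_ideal R \<longrightarrow> (gen_ideal L1 \<inter> R \<noteq> {} \<longleftrightarrow> gen_ideal L2 \<inter> R \<noteq> {}))"

definition poly_equiv_code :: "word set \<Rightarrow> word set \<Rightarrow> bool" where
  "poly_equiv_code P1 P2 \<longleftrightarrow>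
     end_equiv P1 P2 \<and>
     (\<exists>\<tau> :: nat poly. \<forall>x1\<in>P1. \<forall>x2\<in>P2. pref_comparable x1 x2 \<longrightarrow>
        length x1 \<le> poly \<tau> (length x2) \<and> length x2 \<le> poly \<tau> (length x1))"

definition poly_equiv :: "(word \<rightharpoonup> word) \<Rightarrow> (word \<rightharpoonup> word) \<Rightarrow> bool" where
  "poly_equiv f g \<longleftrightarrow>
     poly_equiv_code (domC f) (domC g) \<and> (\<forall>x \<in> dom f \<inter> dom g. f x = g x)"


section \<open>Deterministic multi-tape Turing machines\<close>

text \<open>
  States and work-tape symbols are natural numbers, with \<open>0\<close> the blank work-tape symbol; finiteness
  of the machine is the finiteness of the domain of its transition function (see \<open>tm_wf\<close>).
  A transition is determined by the state, the input symbol under the input head (\<open>None\<close> is the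
  blank) and the symbols under the work heads; it yields the next state, the move of the read-only
  input head, the letter (if any) written on the output tape, and a written symbol and a move for
  every work tape. Writing a letter advances the output head by one cell, so that the output tape is
  the list of the letters written so far.

  The machine halts when no transition applies. In particular the accept state may have outgoing
  transitions, and the identity can be computed in exactly \<open>n\<close> steps (with none for the empty
  word).
\<close>

datatype move = Left | Stay | Right

fun shift :: "move \<Rightarrow> int" where
  "shift Left = -1"
| "shift Stay = 0"
| "shift Right = 1"

record tm =
  num_tapes :: nat
  start :: nat
  accept :: nat
  delta :: "nat \<times> bool option \<times> nat list \<rightharpoonup> nat \<times> move \<times> bool option \<times> (nat \<times> move) list"

definition tm_wf :: "tm \<Rightarrow> bool" where
  "tm_wf M \<longleftrightarrow>
     finite (dom (delta M)) \<and>
     (\<forall>q a ss q' d b acts. delta M (q, a, ss) = Some (q', d, b, acts) \<longrightarrow>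
        length ss = num_tapes M \<and> length acts = num_tapes M)"

text \<open>A work tape is two-way infinite and is given by its content and its head position.\<close>

type_synonym work_tape = "(int \<Rightarrow> nat) \<times> int"

record config =
  state :: nat
  in_pos :: int
  work :: "work_tape list"
  out :: word

definition in_symbol :: "word \<Rightarrow> int \<Rightarrow> bool option" where
  "in_symbol w i = (if 0 \<le> i \<and> i < int (length w) then Some (w ! nat i) else None)"

fun scanned :: "work_tape \<Rightarrow> nat" where
  "scanned (T, i) = T i"

fun act :: "work_tape \<Rightarrow> nat \<times> move \<Rightarrow> work_tape" where
  "act (T, i) (s, d) = (T(i := s), i + shift d)"

definition transition ::
  "tm \<Rightarrow> word \<Rightarrow> config \<Rightarrow> (nat \<times> move \<times> bool option \<times> (nat \<times> move) list) option" where
  "transition M w c = delta M (state c, in_symbol w (in_pos c), map scanned (work c))"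

definition halted :: "tm \<Rightarrow> word \<Rightarrow> config \<Rightarrow> bool" where
  "halted M w c \<longleftrightarrow> transition M w c = None"

definition step :: "tm \<Rightarrow> word \<Rightarrow> config \<Rightarrow> config" where
  "step M w c =
     (case transition M w c of
        None \<Rightarrow> c
      | Some (q, d, b, acts) \<Rightarrow>
          \<lparr> state = q,
            in_pos = in_pos c + shift d,
            work = map2 act (work c) acts,
            out = out c @ (case b of None \<Rightarrow> [] | Some a \<Rightarrow> [a]) \<rparr>)"

definition init_config :: "tm \<Rightarrow> config" where
  "init_config M =
     \<lparr> state = start M, in_pos = 0, work = replicate (num_tapes M) (\<lambda>_. 0, 0), out = [] \<rparr>"

definition run :: "tm \<Rightarrow> word \<Rightarrow> nat \<Rightarrow> config" where
  "run M w n = (step M w ^^ n) (init_config M)"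

definition halts :: "tm \<Rightarrow> word \<Rightarrow> bool" where
  "halts M w \<longleftrightarrow> (\<exists>n. halted M w (run M w n))"

definition run_time :: "tm \<Rightarrow> word \<Rightarrow> nat" where
  "run_time M w = (LEAST n. halted M w (run M w n))"

definition tm_fun :: "tm \<Rightarrow> word \<rightharpoonup> word" where
  "tm_fun M w =
     (if halts M w \<and> state (run M w (run_time M w)) = accept M
      then Some (out (run M w (run_time M w))) else None)"


section \<open>The monoid \<open>RM\<^sup>P\<close>\<close>

definition poly_time_computable :: "(word \<rightharpoonup> word) \<Rightarrow> bool" where
  "poly_time_computable f \<longleftrightarrow>
     (\<exists>M. tm_wf M \<and> tm_fun M = f \<and>
        (\<exists>p :: nat poly. \<forall>x. halts M x \<and> run_time M x \<le> poly p (length x)))"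

definition poly_balanced :: "(word \<rightharpoonup> word) \<Rightarrow> bool" where
  "poly_balanced f \<longleftrightarrow>
     (\<exists>p :: nat poly. \<forall>x y. f x = Some y \<longrightarrow>
        length y \<le> poly p (length x) \<and> length x \<le> poly p (length y))"

definition RM_P :: "(word \<rightharpoonup> word) set" where
  "RM_P = {f. right_ideal_morphism f \<and> poly_time_computable f \<and> poly_balanced f}"


section \<open>The monoid \<open>RM\<^sup>n\<^sup>+\<^sup>o\<^sup>(\<^sup>n\<^sup>)\<close>\<close>

definition n_plus_o :: "(nat \<Rightarrow> nat) \<Rightarrow> bool" where
  "n_plus_o t \<longleftrightarrow>
     (\<exists>\<epsilon> :: nat \<Rightarrow> real. (\<forall>n. \<epsilon> n \<ge> 0) \<and> \<epsilon> \<longlonglongrightarrow> 0 \<and>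
        (\<forall>n. real (t n) \<le> real n + \<epsilon> n * real n))"

text \<open>
  The last conjunct says that, on input \<open>x @ z\<close> with \<open>x\<close> in the domain, any transition that is made
  while the input head is on a letter of \<open>z\<close> starts with the image of \<open>x\<close> already on the output
  tape.
\<close>

definition RM_machine :: "tm \<Rightarrow> bool" where
  "RM_machine M \<longleftrightarrow>
     tm_wf M \<and>
     (\<forall>k q d b acts. delta M k = Some (q, d, b, acts) \<longrightarrow> d \<noteq> Left) \<and>
     (\<forall>x y z n. tm_fun M x = Some y \<longrightarrow>
        \<not> halted M (x @ z) (run M (x @ z) n) \<longrightarrow>
        int (length x) \<le> in_pos (run M (x @ z) n) \<longrightarrow>
        in_pos (run M (x @ z) n) < int (length (x @ z)) \<longrightarrow>
        prefix y (out (run M (x @ z) n)))"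

definition RM_no :: "(word \<rightharpoonup> word) set" where
  "RM_no = {f \<in> RM_P. \<exists>M t. RM_machine M \<and> tm_fun M = f \<and> n_plus_o t \<and>
     (\<forall>x y. f x = Some y \<longrightarrow>
        length y \<le> t (length x) \<and> length x \<le> t (length y) \<and> run_time M x \<le> t (length x))}"


section \<open>Quotient monoids\<close>

definition fun_monoid :: "(word \<rightharpoonup> word) set \<Rightarrow> (word \<rightharpoonup> word) monoid" where
  "fun_monoid S = \<lparr> carrier = S, mult = (\<circ>\<^sub>m), one = Some \<rparr>"

definition poly_equiv_on :: "(word \<rightharpoonup> word) set \<Rightarrow> ((word \<rightharpoonup> word) \<times> (word \<rightharpoonup> word)) set" where
  "poly_equiv_on S = {(f, g). f \<in> S \<and> g \<in> S \<and> poly_equiv f g}"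

text \<open>Intended for a congruence \<open>r\<close>; the union then consists of a single class.\<close>

definition quotient_monoid :: "('a, 'b) monoid_scheme \<Rightarrow> ('a \<times> 'a) set \<Rightarrow> 'a set monoid" where
  "quotient_monoid G r =
     \<lparr> carrier = carrier G // r,
       mult = (\<lambda>X Y. \<Union>x\<in>X. \<Union>y\<in>Y. r `` {x \<otimes>\<^bsub>G\<^esub> y}),
       one = r `` {\<one>\<^bsub>G\<^esub>} \<rparr>"

definition RM_P_mod_poly :: "(word \<rightharpoonup> word) set monoid" where
  "RM_P_mod_poly = quotient_monoid (fun_monoid RM_P) (poly_equiv_on RM_P)"

definition RM_no_mod_poly :: "(word \<rightharpoonup> word) set monoid" where
  "RM_no_mod_poly = quotient_monoid (fun_monoid RM_no) (poly_equiv_on RM_no)"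

end

theory Submission
  imports Defs "HOL-Library.Countable"
begin

text \<open>
  The isomorphism sends the class of \<open>f\<close> in \<open>RM_no\<close> to the class of \<open>f\<close> in \<open>RM_P\<close>. It is well defined
  and injective because both quotients use the same relation. Two things have to be shown: every class
  of \<open>RM_P\<close> is hit, and products are respected.

  \<^bold>\<open>Every class is hit\<close> (\<open>padded_equivalent\<close>). The relation allows a domain to be shrunk as long as every
  word of the old domain can still be extended into the new one, by polynomially many letters. Let \<open>F\<close> be
  computed in polynomial time by \<open>M\<close>. The padded morphism agrees with \<open>F\<close> on the words \<open>x @ z\<close>
  with \<open>x\<close> in the prefix code of \<open>F\<close> and \<open>z\<close> long, and is undefined elsewhere. A one-way machine
  computes it as follows: it stores the input letter by letter, simulates \<open>M\<close> on every prefix until \<open>M\<close> accepts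
  one, namely \<open>x\<close>, writes \<open>F x\<close>, and from then on copies one letter per step. If finding
  and processing \<open>x\<close> took \<open>m\<close> steps, the machine insists on \<open>(m + 1)\<^sup>2\<close> copied letters before it accepts.
  Hence \<open>m \<le> sqrt n\<close> on accepted inputs of length \<open>n\<close>, and the time and the length of the output are at
  most \<open>n + sqrt n\<close>. As \<open>m\<close> depends on \<open>x\<close> only, and polynomially on its length, the padded
  morphism is equivalent to \<open>F\<close>.

  \<^bold>\<open>Products\<close>. The product of two classes is read off from any pair of representatives whose composite
  lies in the monoid again (\<open>quotient_mult\<close>, which rests on the congruence property \<open>poly_equiv_comp\<close>).
  Padded morphisms are such representatives (\<open>fast_comp_in_RM_no\<close>): their machines halt on every input in
  polynomial time, and so does the machine that runs the two in lockstep, feeding each output letter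
  of the first at once into the second. Lockstep is what keeps the time at \<open>n + o(n)\<close>; running the machines
  one after the other would take about \<open>2n\<close> steps. The composite therefore lies in both
  monoids, and it represents the product in both quotients.
\<close>

section \<open>Right ideals and their minimal words\<close>

lemma right_ideal_iff: "right_ideal R \<longleftrightarrow> (\<forall>x\<in>R. \<forall>w. x @ w \<in> R)"
proof
  assume "right_ideal R"
  then show "\<forall>x\<in>R. \<forall>w. x @ w \<in> R"
    unfolding right_ideal_def gen_ideal_def by blast
next
  assume R: "\<forall>x\<in>R. \<forall>w. x @ w \<in> R"
  have "x \<in> gen_ideal R" if "x \<in> R" for x
    using that unfolding gen_ideal_def by (intro CollectI exI[of _ x] exI[of _ "[]"]) auto
  then show "right_ideal R"
    using R unfolding right_ideal_def gen_ideal_def by blast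
qed

lemma gen_ideal_iff: "u \<in> gen_ideal L \<longleftrightarrow> (\<exists>x\<in>L. prefix x u)"
  unfolding gen_ideal_def prefix_def by auto

lemma right_ideal_gen_ideal: "right_ideal (gen_ideal L)"
  unfolding right_ideal_iff by (meson gen_ideal_iff prefix_prefix)

text \<open>
  For a right ideal \<open>R\<close> this is the prefix code that generates it, so \<open>domC h\<close> can be computed as
  \<open>min_words (dom h)\<close>.
\<close>

definition min_words :: "word set \<Rightarrow> word set" where
  "min_words R = {x \<in> R. \<forall>y. strict_prefix y x \<longrightarrow> y \<notin> R}"

lemma min_words_prefix:
  assumes "u \<in> R"
  obtains x where "x \<in> min_words R" "prefix x u"
proof -
  define n where "n = (LEAST n. take n u \<in> R)"
  have "take (length u) u \<in> R" using assms by simp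
  then have n: "take n u \<in> R" unfolding n_def by (rule LeastI)
  have "take n u \<in> min_words R"
    unfolding min_words_def
  proof (intro CollectI conjI allI impI n)
    fix y assume y: "strict_prefix y (take n u)"
    then have "y = take (length y) u"
      by (metis append_eq_conv_conj prefix_def prefix_order.less_imp_le take_is_prefix prefix_order.trans)
    moreover have "length y < n"
      using prefix_length_less[OF y] by simp
    ultimately show "y \<notin> R"
      using not_less_Least[of "length y" "\<lambda>n. take n u \<in> R"] unfolding n_def[symmetric] by metis
  qed
  then show ?thesis using that take_is_prefix by blast
qed

lemma gen_ideal_min_words:
  assumes "right_ideal R"
  shows "gen_ideal (min_words R) = R"
proof
  show "gen_ideal (min_words R) \<subseteq> R"
    using assms unfolding gen_ideal_def min_words_def right_ideal_iff by auto
  show "R \<subseteq> gen_ideal (min_words R)"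
    using min_words_prefix gen_ideal_iff by blast
qed

lemma prefix_code_min_words: "prefix_code (min_words R)"
  unfolding prefix_code_def pref_comparable_def min_words_def
  by (metis (no_types, lifting) mem_Collect_eq prefix_order.order_iff_strict)

lemma min_words_comparable:
  "x \<in> min_words R \<Longrightarrow> y \<in> min_words R \<Longrightarrow> pref_comparable x y \<Longrightarrow> x = y"
  using prefix_code_min_words[of R] unfolding prefix_code_def by blast

lemma prefix_code_generator_unique:
  assumes P: "prefix_code P" and R: "gen_ideal P = R"
  shows "P = min_words R"
proof -
  have PR: "P \<subseteq> R" using R gen_ideal_iff by auto
  have "x \<in> min_words R" if x: "x \<in> P" for x
    unfolding min_words_def
  proof (intro CollectI conjI allI impI)
    show "x \<in> R" using PR x by auto
    fix y assume y: "strict_prefix y x"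
    show "y \<notin> R"
    proof
      assume "y \<in> R"
      then obtain p where p: "p \<in> P" "prefix p y" using R gen_ideal_iff by auto
      then have "strict_prefix p x" using y prefix_order.le_less_trans by blast
      then show False using P p x unfolding prefix_code_def pref_comparable_def
        by (metis prefix_order.less_le)
    qed
  qed
  moreover have "x \<in> P" if x: "x \<in> min_words R" for x
  proof -
    have "x \<in> R" using x unfolding min_words_def by auto
    then obtain p where p: "p \<in> P" "prefix p x" using R gen_ideal_iff by auto
    then have "p \<in> R" using PR by auto
    then have "p = x" using x p unfolding min_words_def
      by (metis (no_types, lifting) mem_Collect_eq prefix_order.order_iff_strict)
    then show ?thesis using p by simp
  qed
  ultimately show ?thesis by blast
qed

lemma domC_eq:
  assumes "right_ideal_morphism h"
  shows "domC h = min_words (dom h)"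
proof -
  have "right_ideal (dom h)" using assms unfolding right_ideal_morphism_def by simp
  then have "gen_ideal (min_words (dom h)) = dom h" by (rule gen_ideal_min_words)
  then show ?thesis
    unfolding domC_def
    using prefix_code_min_words prefix_code_generator_unique by (intro the_equality) auto
qed

lemma rim_append:
  "right_ideal_morphism h \<Longrightarrow> h x = Some y \<Longrightarrow> h (x @ w) = Some (y @ w)"
  unfolding right_ideal_morphism_def by blast

lemma rim_dom_append: "right_ideal_morphism h \<Longrightarrow> x \<in> dom h \<Longrightarrow> x @ w \<in> dom h"
  using rim_append by blast

lemma rimI:
  assumes "\<And>x y w. h x = Some y \<Longrightarrow> h (x @ w) = Some (y @ w)"
  shows "right_ideal_morphism h"
  using assms unfolding right_ideal_morphism_def right_ideal_iff dom_def by blast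

lemma rim_comp:
  assumes "right_ideal_morphism f" "right_ideal_morphism g"
  shows "right_ideal_morphism (f \<circ>\<^sub>m g)"
  by (rule rimI) (auto simp: map_comp_Some_iff intro: rim_append[OF assms(1)] rim_append[OF assms(2)])

section \<open>Polynomial equivalence is a congruence\<close>

lemma nat_poly_mono:
  fixes p :: "nat poly"
  shows "m \<le> n \<Longrightarrow> poly p m \<le> poly p n"
  by (induction p) (auto intro!: add_mono mult_mono)

lemma end_equiv_iff:
  assumes "right_ideal D1" "right_ideal D2" "gen_ideal P1 = D1" "gen_ideal P2 = D2"
  shows "end_equiv P1 P2 \<longleftrightarrow> (\<forall>x\<in>D1. \<exists>w. x @ w \<in> D2) \<and> (\<forall>x\<in>D2. \<exists>w. x @ w \<in> D1)"
proof
  have meet: "\<exists>w. x @ w \<in> D" if "gen_ideal {x} \<inter> D \<noteq> {}" for x D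
    using that unfolding gen_ideal_def by auto
  have self: "x \<in> gen_ideal {x}" for x by (simp add: gen_ideal_iff)
  assume e: "end_equiv P1 P2"
  then have "D1 \<inter> gen_ideal {x} \<noteq> {} \<longleftrightarrow> D2 \<inter> gen_ideal {x} \<noteq> {}" for x
    using assms right_ideal_gen_ideal unfolding end_equiv_def by simp
  then show "(\<forall>x\<in>D1. \<exists>w. x @ w \<in> D2) \<and> (\<forall>x\<in>D2. \<exists>w. x @ w \<in> D1)"
    using meet self by (metis disjoint_iff inf_commute)
next
  assume "(\<forall>x\<in>D1. \<exists>w. x @ w \<in> D2) \<and> (\<forall>x\<in>D2. \<exists>w. x @ w \<in> D1)"
  then show "end_equiv P1 P2"
    using assms unfolding end_equiv_def right_ideal_iff by blast
qed

text \<open>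
  For right-ideal morphisms \<open>poly_equiv\<close> amounts to two one-sided conditions, each required in both
  directions, and agreement on the common domain. Transitivity and the congruence property are proved for
  each one-sided condition separately.
\<close>

definition cofinal_in :: "(word \<rightharpoonup> word) \<Rightarrow> (word \<rightharpoonup> word) \<Rightarrow> bool" where
  "cofinal_in f g \<longleftrightarrow> (\<forall>x\<in>dom f. \<exists>w. x @ w \<in> dom g)"

definition poly_bounded :: "(word \<rightharpoonup> word) \<Rightarrow> (word \<rightharpoonup> word) \<Rightarrow> bool" where
  "poly_bounded f g \<longleftrightarrow>
     (\<exists>\<tau> :: nat poly. \<forall>x\<in>min_words (dom f). \<forall>y\<in>min_words (dom g).
        pref_comparable x y \<longrightarrow> length y \<le> poly \<tau> (length x))"

lemma pref_comparable_sym: "pref_comparable x y = pref_comparable y x"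
  unfolding pref_comparable_def by auto

lemma poly_equiv_iff:
  assumes f: "right_ideal_morphism f" and g: "right_ideal_morphism g"
  shows "poly_equiv f g \<longleftrightarrow> cofinal_in f g \<and> cofinal_in g f \<and> poly_bounded f g \<and> poly_bounded g f \<and>
           (\<forall>x \<in> dom f \<inter> dom g. f x = g x)"
proof -
  have R: "right_ideal (dom f)" "right_ideal (dom g)"
    using f g unfolding right_ideal_morphism_def by auto
  have e: "end_equiv (domC f) (domC g) \<longleftrightarrow> cofinal_in f g \<and> cofinal_in g f"
    using end_equiv_iff[OF R gen_ideal_min_words[OF R(1)] gen_ideal_min_words[OF R(2)]]
    unfolding domC_eq[OF f] domC_eq[OF g] cofinal_in_def .
  have "(\<exists>\<tau> :: nat poly. \<forall>x1\<in>domC f. \<forall>x2\<in>domC g. pref_comparable x1 x2 \<longrightarrow>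
        length x1 \<le> poly \<tau> (length x2) \<and> length x2 \<le> poly \<tau> (length x1))
      \<longleftrightarrow> poly_bounded f g \<and> poly_bounded g f" (is "?L \<longleftrightarrow> ?R")
  proof
    assume ?L then show ?R
      unfolding domC_eq[OF f] domC_eq[OF g] poly_bounded_def
      using pref_comparable_sym by blast
  next
    assume ?R
    then obtain s t :: "nat poly"
      where s: "\<And>x y. x\<in>min_words (dom f) \<Longrightarrow> y\<in>min_words (dom g) \<Longrightarrow>
        pref_comparable x y \<Longrightarrow> length y \<le> poly s (length x)"
      and t: "\<And>x y. x\<in>min_words (dom f) \<Longrightarrow> y\<in>min_words (dom g) \<Longrightarrow>
        pref_comparable x y \<Longrightarrow> length x \<le> poly t (length y)"
      unfolding poly_bounded_def using pref_comparable_sym by meson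
    have "length x1 \<le> poly (s+t) (length x2) \<and> length x2 \<le> poly (s+t) (length x1)"
      if "x1\<in>min_words (dom f)" "x2\<in>min_words (dom g)" "pref_comparable x1 x2" for x1 x2
      using s[OF that] t[OF that] by (simp add: trans_le_add1 trans_le_add2)
    then show ?L unfolding domC_eq[OF f] domC_eq[OF g] by blast
  qed
  then show ?thesis unfolding poly_equiv_def poly_equiv_code_def e by blast
qed

lemma poly_bounded_refl: "poly_bounded f f"
  unfolding poly_bounded_def using min_words_comparable by (intro exI[of _ "[:0,1:]"]) fastforce

lemma poly_equiv_refl: "right_ideal_morphism f \<Longrightarrow> poly_equiv f f"
  unfolding poly_equiv_iff cofinal_in_def using poly_bounded_refl
  by (metis append_Nil2)

lemma poly_equiv_sym:
  "right_ideal_morphism f \<Longrightarrow> right_ideal_morphism g \<Longrightarrow> poly_equiv f g \<Longrightarrow> poly_equiv g f"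
  unfolding poly_equiv_iff by auto

lemma comparable_of_common_extension:
  "prefix x u \<Longrightarrow> prefix y u \<Longrightarrow> pref_comparable x y"
  unfolding pref_comparable_def using prefix_same_cases by blast

text \<open>
  Comparable minimal words \<open>x\<close> of \<open>dom f\<close> and \<open>z\<close> of \<open>dom h\<close> have the longer of the two as common extension.
  Extended further into \<open>dom g\<close>, it lies above a minimal word of \<open>dom g\<close>, which is then comparable with
  both, and the two bounds can be chained.
\<close>

lemma poly_bounded_trans:
  assumes f: "right_ideal_morphism f" and h: "right_ideal_morphism h"
    and c: "cofinal_in f g" "cofinal_in h g" and b: "poly_bounded f g" "poly_bounded g h"
  shows "poly_bounded f h"
proof -
  from b obtain s t :: "nat poly"
    where s: "\<And>x y. x\<in>min_words (dom f) \<Longrightarrow> y\<in>min_words (dom g) \<Longrightarrow>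
        pref_comparable x y \<Longrightarrow> length y \<le> poly s (length x)"
      and t: "\<And>x y. x\<in>min_words (dom g) \<Longrightarrow> y\<in>min_words (dom h) \<Longrightarrow>
        pref_comparable x y \<Longrightarrow> length y \<le> poly t (length x)"
    unfolding poly_bounded_def by meson
  have "length z \<le> poly (pcompose t s) (length x)"
    if x: "x\<in>min_words (dom f)" and z: "z\<in>min_words (dom h)" and xz: "pref_comparable x z" for x z
  proof -
    define m where "m = (if prefix x z then z else x)"
    have m: "prefix x m" "prefix z m"
      using xz unfolding m_def pref_comparable_def by auto
    have "\<exists>w. m @ w \<in> dom g"
      using x z c unfolding m_def cofinal_in_def min_words_def by auto
    then obtain w y where y: "y \<in> min_words (dom g)" "prefix y (m @ w)"
      using min_words_prefix by metis
    have "prefix x (m @ w)" "prefix z (m @ w)" using m by auto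
    then have cmp: "pref_comparable x y" "pref_comparable y z"
      using y comparable_of_common_extension by auto
    have "length z \<le> poly t (length y)" using t[OF y(1) z cmp(2)] .
    also have "\<dots> \<le> poly t (poly s (length x))"
      using s[OF x y(1) cmp(1)] nat_poly_mono by blast
    finally show ?thesis by (simp add: poly_pcompose)
  qed
  then show ?thesis unfolding poly_bounded_def by blast
qed

lemma cofinal_trans:
  assumes "cofinal_in f g" "cofinal_in g h"
  shows "cofinal_in f h"
  using assms unfolding cofinal_in_def by (metis append.assoc)

lemma poly_equiv_trans:
  assumes f: "right_ideal_morphism f" and g: "right_ideal_morphism g" and h: "right_ideal_morphism h"
    and fg: "poly_equiv f g" and gh: "poly_equiv g h"
  shows "poly_equiv f h"
proof -
  note fg' = fg[unfolded poly_equiv_iff[OF f g]] and gh' = gh[unfolded poly_equiv_iff[OF g h]]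
  have "f u = h u" if "u \<in> dom f \<inter> dom h" for u
  proof -
    obtain a c where a: "f u = Some a" and c: "h u = Some c" using \<open>u \<in> dom f \<inter> dom h\<close> by auto
    obtain w where w: "u @ w \<in> dom g" using fg' \<open>u \<in> dom f \<inter> dom h\<close> unfolding cofinal_in_def by blast
    have 1: "f (u @ w) = Some (a @ w)" and 2: "h (u @ w) = Some (c @ w)"
      using rim_append[OF f a] rim_append[OF h c] by auto
    have "f (u @ w) = g (u @ w)" using fg' w 1 by blast
    moreover have "g (u @ w) = h (u @ w)" using gh' w 2 by blast
    ultimately show ?thesis using 1 2 a c by simp
  qed
  then show ?thesis
    unfolding poly_equiv_iff[OF f h]
    using fg' gh' poly_bounded_trans[OF f h] poly_bounded_trans[OF h f] cofinal_trans by blast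
qed

lemma cofinal_comp:
  assumes f: "right_ideal_morphism f" and g: "right_ideal_morphism g" and g': "right_ideal_morphism g'"
    and ff: "cofinal_in f f'" and gg: "cofinal_in g g'" and agr: "\<forall>x \<in> dom g \<inter> dom g'. g x = g' x"
  shows "cofinal_in (f \<circ>\<^sub>m g) (f' \<circ>\<^sub>m g')"
  unfolding cofinal_in_def
proof
  fix x assume "x \<in> dom (f \<circ>\<^sub>m g)"
  then obtain y z where y: "g x = Some y" and z: "f y = Some z" by (auto simp: map_comp_Some_iff)
  obtain w where w: "x @ w \<in> dom g'" using gg y unfolding cofinal_in_def by blast
  have gw: "g (x @ w) = Some (y @ w)" by (rule rim_append[OF g y])
  then have gw': "g' (x @ w) = Some (y @ w)" using agr w by (metis IntI domI)
  have "y @ w \<in> dom f" using rim_append[OF f z] by blast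
  then obtain v where v: "y @ w @ v \<in> dom f'"
    using ff unfolding cofinal_in_def by (metis append.assoc)
  have "g' (x @ w @ v) = Some (y @ w @ v)" using rim_append[OF g' gw', of v] by simp
  then have "x @ (w @ v) \<in> dom (f' \<circ>\<^sub>m g')" using v by (auto simp: map_comp_Some_iff)
  then show "\<exists>w. x @ w \<in> dom (f' \<circ>\<^sub>m g')" by blast
qed

text \<open>
  Let \<open>u'\<close> be the longer of two comparable minimal words. Either \<open>u'\<close> is already minimal in \<open>dom g'\<close>, and the
  bound between \<open>g\<close> and \<open>g'\<close> applies, or its image is minimal in \<open>dom f'\<close>. In the second case the image is bounded by
  the relation between \<open>f\<close> and \<open>f'\<close> and by the balance of \<open>g\<close>, and \<open>u'\<close> itself by the balance of \<open>g'\<close>.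
\<close>

lemma poly_bounded_comp:
  assumes f: "right_ideal_morphism f" and g: "right_ideal_morphism g"
    and f': "right_ideal_morphism f'" and g': "right_ideal_morphism g'"
    and ff: "poly_bounded f f'" and gg: "poly_bounded g g'"
    and agr: "\<forall>x \<in> dom g \<inter> dom g'. g x = g' x"
    and bal: "poly_balanced g" and bal': "poly_balanced g'"
  shows "poly_bounded (f \<circ>\<^sub>m g) (f' \<circ>\<^sub>m g')"
proof -
  obtain s where s: "\<And>x y. x\<in>min_words (dom f) \<Longrightarrow> y\<in>min_words (dom f') \<Longrightarrow>
        pref_comparable x y \<Longrightarrow> length y \<le> poly s (length x)"
    using ff unfolding poly_bounded_def by meson
  obtain t where t: "\<And>x y. x\<in>min_words (dom g) \<Longrightarrow> y\<in>min_words (dom g') \<Longrightarrow>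
        pref_comparable x y \<Longrightarrow> length y \<le> poly t (length x)"
    using gg unfolding poly_bounded_def by meson
  obtain p where p: "\<And>x y. g x = Some y \<Longrightarrow> length y \<le> poly p (length x)"
    using bal unfolding poly_balanced_def by blast
  obtain q where q: "\<And>x y. g' x = Some y \<Longrightarrow> length x \<le> poly q (length y)"
    using bal' unfolding poly_balanced_def by blast
  let ?b = "[:0,1:] + t + pcompose q (pcompose s p)"
  have "length u' \<le> poly ?b (length u)"
    if u: "u \<in> min_words (dom (f \<circ>\<^sub>m g))" and u': "u' \<in> min_words (dom (f' \<circ>\<^sub>m g'))"
      and cmp: "pref_comparable u u'" for u u'
  proof (cases "prefix u' u")
    case True
    then show ?thesis using prefix_length_le by fastforce
  next
    case False
    then have uu': "prefix u u'" using cmp unfolding pref_comparable_def by blast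
    then obtain e where e: "u' = u @ e" unfolding prefix_def by blast
    obtain y where y: "g u = Some y" "y \<in> dom f"
      using u unfolding min_words_def by (fastforce simp: map_comp_Some_iff)
    obtain y' where y': "g' u' = Some y'" "y' \<in> dom f'"
      using u' unfolding min_words_def by (fastforce simp: map_comp_Some_iff)
    obtain x where x: "x \<in> min_words (dom g)" "prefix x u"
      using y(1) min_words_prefix by (metis domI)
    obtain x' where x': "x' \<in> min_words (dom g')" "prefix x' u'"
      using y'(1) min_words_prefix by (metis domI)
    show ?thesis
    proof (cases "x' = u'")
      case True
      have "pref_comparable x x'"
        using comparable_of_common_extension x(2) x'(2) uu' prefix_order.trans by blast
      then have "length u' \<le> poly t (length x)" using t x x' True by blast
      also have "\<dots> \<le> poly t (length u)" using x(2) prefix_length_le nat_poly_mono by blast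
      finally show ?thesis by simp
    next
      case False
      then obtain v where v: "u' = x' @ v" "v \<noteq> []" using x'(2) unfolding prefix_def by auto
      obtain a where a: "g' x' = Some a" using x'(1) unfolding min_words_def by auto
      have y'a: "y' = a @ v" using rim_append[OF g' a, of v] y'(1) v(1) by simp
      \<comment> \<open>Since \<open>u'\<close> is minimal and longer than the minimal word \<open>x'\<close> of \<open>dom g'\<close> below it,
        shortening its tail \<open>v\<close> leaves \<open>dom f'\<close>, so the image of \<open>u'\<close> is itself minimal.\<close>
      have y'min: "y' \<in> min_words (dom f')"
        unfolding min_words_def
      proof (intro CollectI conjI allI impI y'(2))
        fix b assume b: "strict_prefix b y'"
        have "prefix b (a @ butlast v)"
        proof -
          have "y' = (a @ butlast v) @ [last v]" using y'a v(2) by simp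
          then show ?thesis using b by (metis prefix_order.less_le prefix_snoc)
        qed
        moreover have "a @ butlast v \<notin> dom f'"
        proof
          assume "a @ butlast v \<in> dom f'"
          moreover have "g' (x' @ butlast v) = Some (a @ butlast v)" by (rule rim_append[OF g' a])
          ultimately have "x' @ butlast v \<in> dom (f' \<circ>\<^sub>m g')" by (auto simp: map_comp_Some_iff)
          moreover have "strict_prefix (x' @ butlast v) u'"
            unfolding v(1) using v(2)
            by (metis append_butlast_last_id same_append_eq append_assoc not_Cons_self2
                prefix_def prefix_order.less_le append_self_conv)
          ultimately show False using u' unfolding min_words_def by blast
        qed
        ultimately show "b \<notin> dom f'" using rim_dom_append[OF f', of b] unfolding prefix_def by metis
      qed
      obtain z where z: "z \<in> min_words (dom f)" "prefix z y" using y(2) min_words_prefix by metis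
      have "g u' = Some (y @ e)" using rim_append[OF g y(1)] e by simp
      then have "y' = y @ e" using agr y'(1) by (metis IntI domI option.inject)
      then have "pref_comparable z y'" using z(2) unfolding pref_comparable_def by simp
      then have "length y' \<le> poly s (length z)" using s z(1) y'min by blast
      also have "\<dots> \<le> poly s (length y)" using z(2) prefix_length_le nat_poly_mono by blast
      also have "\<dots> \<le> poly s (poly p (length u))" using p[OF y(1)] nat_poly_mono by blast
      finally have "poly q (length y') \<le> poly q (poly s (poly p (length u)))"
        using nat_poly_mono by blast
      then show ?thesis using q[OF y'(1)] by (simp add: poly_pcompose)
    qed
  qed
  then show ?thesis unfolding poly_bounded_def by blast
qed

lemma poly_equiv_comp:
  assumes rim: "right_ideal_morphism f" "right_ideal_morphism f'"
      "right_ideal_morphism g" "right_ideal_morphism g'"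
    and bal: "poly_balanced g" "poly_balanced g'"
    and ff: "poly_equiv f f'" and gg: "poly_equiv g g'"
  shows "poly_equiv (f \<circ>\<^sub>m g) (f' \<circ>\<^sub>m g')"
proof -
  note F = ff[unfolded poly_equiv_iff[OF rim(1,2)]] and G = gg[unfolded poly_equiv_iff[OF rim(3,4)]]
  have agr: "\<forall>x \<in> dom g \<inter> dom g'. g x = g' x" and agr': "\<forall>x \<in> dom g' \<inter> dom g. g' x = g x"
    using G by auto
  have "(f \<circ>\<^sub>m g) x = (f' \<circ>\<^sub>m g') x" if "x \<in> dom (f \<circ>\<^sub>m g) \<inter> dom (f' \<circ>\<^sub>m g')" for x
  proof -
    from that obtain y y' z z' where *: "g x = Some y" "g' x = Some y'" "f y = Some z" "f' y' = Some z'"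
      by (auto simp: map_comp_Some_iff)
    have "y = y'" using * agr by (metis IntI domI option.inject)
    moreover have "f y = f' y" using * F \<open>y = y'\<close> by blast
    ultimately show ?thesis using * by (simp add: map_comp_def)
  qed
  then show ?thesis
    unfolding poly_equiv_iff[OF rim_comp[OF rim(1,3)] rim_comp[OF rim(2,4)]]
    using F G cofinal_comp[OF rim(1,3,4) _ _ agr] cofinal_comp[OF rim(2,4,3) _ _ agr']
      poly_bounded_comp[OF rim(1,3,2,4) _ _ agr bal(1,2)]
      poly_bounded_comp[OF rim(2,4,1,3) _ _ agr' bal(2,1)]
    by blast
qed

section \<open>Runs of Turing machines\<close>

lemma run_0: "run M w 0 = init_config M"
  by (simp add: run_def)

lemma run_Suc: "run M w (Suc n) = step M w (run M w n)"
  by (simp add: run_def)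

lemma step_halted: "halted M w c \<Longrightarrow> step M w c = c"
  by (simp add: halted_def step_def)

lemma run_halted_add: "halted M w (run M w n) \<Longrightarrow> run M w (n + k) = run M w n"
  by (induction k) (auto simp: run_Suc step_halted)

lemma run_halted_le: "halted M w (run M w n) \<Longrightarrow> n \<le> m \<Longrightarrow> run M w m = run M w n"
  using run_halted_add[of M w n "m - n"] by simp

lemma not_halted_mono: "\<not> halted M w (run M w n) \<Longrightarrow> m \<le> n \<Longrightarrow> \<not> halted M w (run M w m)"
  using run_halted_le by metis

lemma halted_run_time: "halts M w \<Longrightarrow> halted M w (run M w (run_time M w))"
  unfolding halts_def run_time_def by (rule LeastI_ex)

lemma run_time_le: "halted M w (run M w n) \<Longrightarrow> run_time M w \<le> n"
  unfolding run_time_def by (rule Least_le)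

lemma haltsI: "halted M w (run M w n) \<Longrightarrow> halts M w"
  unfolding halts_def by blast

lemma not_halted_before_run_time: "n < run_time M w \<Longrightarrow> \<not> halted M w (run M w n)"
  unfolding run_time_def using not_less_Least by blast

lemma run_eq_final:
  "halted M w (run M w n) \<Longrightarrow> run M w (run_time M w) = run M w n"
  using run_halted_le[of M w "run_time M w" n] halted_run_time haltsI run_time_le by metis

lemma tm_fun_halted:
  assumes "halted M w (run M w n)"
  shows "tm_fun M w = (if state (run M w n) = accept M then Some (out (run M w n)) else None)"
  using run_eq_final[OF assms] haltsI[OF assms] unfolding tm_fun_def by simp

lemma step_Some:
  assumes "transition M w c = Some (q, d, b, acts)"
  shows "state (step M w c) = q" "in_pos (step M w c) = in_pos c + shift d"
    "work (step M w c) = map2 act (work c) acts"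
    "out (step M w c) = out c @ (case b of None \<Rightarrow> [] | Some a \<Rightarrow> [a])"
  using assms by (auto simp: step_def)

lemma transition_Some_length:
  assumes "tm_wf M" "transition M w c = Some (q, d, b, acts)"
  shows "length acts = num_tapes M" "length (work c) = num_tapes M"
  using assms unfolding tm_wf_def transition_def by (metis length_map)+

lemma length_work_run:
  assumes "tm_wf M"
  shows "length (work (run M w n)) = num_tapes M"
proof (induction n)
  case 0
  then show ?case by (simp add: run_0 init_config_def)
next
  case (Suc n)
  then show ?case
  proof (cases "transition M w (run M w n)")
    case None
    then show ?thesis using Suc by (simp add: run_Suc step_def)
  next
    case (Some a)
    then obtain q d b acts where "transition M w (run M w n) = Some (q, d, b, acts)" by (metis prod_cases4)
    then show ?thesis using Suc step_Some(3) transition_Some_length[OF assms] by (simp add: run_Suc)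
  qed
qed

lemma out_step_prefix: "prefix (out c) (out (step M w c))"
  unfolding step_def by (auto split: option.split)

lemma out_run_prefix: "m \<le> n \<Longrightarrow> prefix (out (run M w m)) (out (run M w n))"
proof (induction n)
  case 0
  then show ?case by simp
next
  case (Suc n)
  show ?case
  proof (cases "m = Suc n")
    case False
    then have "prefix (out (run M w m)) (out (run M w n))" using Suc by simp
    then show ?thesis unfolding run_Suc using out_step_prefix prefix_order.trans by blast
  qed simp
qed

lemma out_run_length: "length (out (run M w n)) \<le> n"
proof (induction n)
  case 0
  then show ?case by (simp add: run_0 init_config_def)
next
  case (Suc n)
  have "length (out (step M w c)) \<le> Suc (length (out c))" for c
    unfolding step_def by (auto split: option.split)
  then show ?case using Suc unfolding run_Suc by (meson Suc_le_mono le_trans)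
qed

definition no_left :: "tm \<Rightarrow> bool" where
  "no_left M \<longleftrightarrow> (\<forall>k q d b acts. delta M k = Some (q, d, b, acts) \<longrightarrow> d \<noteq> Left)"

lemma in_pos_step_mono: "no_left M \<Longrightarrow> in_pos c \<le> in_pos (step M w c)"
proof (cases "transition M w c")
  case (Some r)
  then obtain q d b acts where r: "transition M w c = Some (q, d, b, acts)" by (metis prod_cases4)
  moreover assume "no_left M"
  ultimately have "d \<noteq> Left" unfolding no_left_def transition_def by blast
  then have "0 \<le> shift d" by (cases d) auto
  then show ?thesis using step_Some(2)[OF r] by simp
qed (simp add: step_def)

lemma in_pos_run_mono:
  assumes "no_left M" and "m \<le> n"
  shows "in_pos (run M w m) \<le> in_pos (run M w n)"
  using assms(2)
proof (induction n)
  case 0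
  then show ?case by simp
next
  case (Suc n)
  show ?case
  proof (cases "m = Suc n")
    case False
    then have "in_pos (run M w m) \<le> in_pos (run M w n)" using Suc by simp
    also have "\<dots> \<le> in_pos (run M w (Suc n))"
      unfolding run_Suc by (rule in_pos_step_mono[OF assms(1)])
    finally show ?thesis .
  qed simp
qed

lemma in_symbol_append: "i < int (length u) \<Longrightarrow> in_symbol (u @ z) i = in_symbol u i"
  unfolding in_symbol_def by (auto simp: nth_append)

lemma run_append_input:
  assumes M: "no_left M" and "in_pos (run M u n) < int (length u)"
  shows "run M (u @ z) n = run M u n"
  using assms(2)
proof (induction n)
  case 0
  then show ?case by (simp add: run_0)
next
  case (Suc n)
  have "in_pos (run M u n) < int (length u)"
    using in_pos_run_mono[OF M, of n "Suc n" u] Suc.prems by simp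
  then show ?case
    using Suc.IH by (simp add: run_Suc step_def transition_def in_symbol_append)
qed

text \<open>
  A one-way machine for a right-ideal morphism cannot accept before it has passed the whole input:
  otherwise a longer input would be accepted with the same output.
\<close>

lemma accepted_input_passed:
  assumes M: "no_left M" and rim: "right_ideal_morphism (tm_fun M)"
    and h: "halted M u (run M u n)" and f: "tm_fun M u = Some y"
  shows "int (length u) \<le> in_pos (run M u n)"
proof (rule ccontr)
  assume "\<not> ?thesis"
  then have lt: "in_pos (run M u n) < int (length u)" by simp
  note e = run_append_input[OF M lt, of "[True]"]
  have "halted M (u @ [True]) (run M (u @ [True]) n)"
    using h lt unfolding e by (simp add: halted_def transition_def in_symbol_append)
  from tm_fun_halted[OF this] tm_fun_halted[OF h] have "tm_fun M (u @ [True]) = Some y"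
    using f unfolding e by simp
  then show False using rim_append[OF rim f, of "[True]"] by simp
qed


section \<open>Machines from finite-state programs\<close>

text \<open>
  A program has states of an arbitrary countable type, and it may be given by rules that apply to
  all tape symbols. It becomes a machine once its states and its symbols are confined to finite
  sets that the rules preserve.
\<close>

type_synonym 's prog =
  "'s \<Rightarrow> bool option \<Rightarrow> nat list \<Rightarrow> ('s \<times> move \<times> bool option \<times> (nat \<times> move) list) option"

type_synonym 's pconf = "'s \<times> int \<times> work_tape list \<times> word"

fun pnext :: "'s prog \<Rightarrow> word \<Rightarrow> 's pconf \<Rightarrow> 's pconf option" where
  "pnext tr w (q, i, ws, y) =
     map_option (\<lambda>(q', d, b, acts). (q', i + shift d, map2 act ws acts,
        y @ (case b of None \<Rightarrow> [] | Some a \<Rightarrow> [a])))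
       (tr q (in_symbol w i) (map scanned ws))"

text \<open>
  Only genuine transitions count as steps here, whereas \<open>run\<close> stays put once the machine has halted. So \<open>preach\<close> with
  \<open>n\<close> steps says in particular that the program does not halt earlier.
\<close>

primrec preach :: "'s prog \<Rightarrow> word \<Rightarrow> nat \<Rightarrow> 's pconf \<Rightarrow> 's pconf \<Rightarrow> bool" where
  "preach tr w 0 c c' \<longleftrightarrow> c' = c"
| "preach tr w (Suc n) c c' \<longleftrightarrow> (\<exists>c1. pnext tr w c = Some c1 \<and> preach tr w n c1 c')"

lemma preach_trans: "preach tr w m c c1 \<Longrightarrow> preach tr w n c1 c2 \<Longrightarrow> preach tr w (m + n) c c2"
  by (induction m arbitrary: c) auto

lemma preach_split: "preach tr w (m + n) c c2 \<Longrightarrow> \<exists>c1. preach tr w m c c1 \<and> preach tr w n c1 c2"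
  by (induction m arbitrary: c) auto

lemma preach_step: "pnext tr w c = Some c' \<Longrightarrow> preach tr w (Suc 0) c c'"
  by (simp del: split_paired_Ex)

lemma preach_snoc: "preach tr w n c c1 \<Longrightarrow> pnext tr w c1 = Some c2 \<Longrightarrow> preach tr w (Suc n) c c2"
  using preach_trans[OF _ preach_step, of tr w n c c1 c2] by simp

definition compile :: "('s::countable) prog \<Rightarrow> 's set \<Rightarrow> nat \<Rightarrow> nat \<Rightarrow> 's \<Rightarrow> 's \<Rightarrow> tm" where
  "compile tr Q G K s0 sa =
     \<lparr> num_tapes = K, start = to_nat s0, accept = to_nat sa,
       delta = (\<lambda>(q, a, ss).
         if q \<in> to_nat ` Q \<and> set ss \<subseteq> {..<G} \<and> length ss = K
         then map_option (\<lambda>(q', d, b, acts). (to_nat q', d, b, acts)) (tr (from_nat q) a ss)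
         else None) \<rparr>"

locale program =
  fixes tr :: "('s::countable) prog" and Q :: "'s set" and G K :: nat and s0 sa :: 's
  assumes finite_Q: "finite Q" and s0: "s0 \<in> Q" and G_pos: "0 < G"
    and closed: "\<And>q a ss q' d b acts.
      q \<in> Q \<Longrightarrow> set ss \<subseteq> {..<G} \<Longrightarrow> length ss = K \<Longrightarrow> tr q a ss = Some (q', d, b, acts) \<Longrightarrow>
      q' \<in> Q \<and> length acts = K \<and> fst ` set acts \<subseteq> {..<G}"
begin

abbreviation "machine \<equiv> compile tr Q G K s0 sa"

abbreviation pinit :: "'s pconf" where
  "pinit \<equiv> (s0, 0, replicate K (\<lambda>_. 0, 0), [])"

fun enc :: "'s pconf \<Rightarrow> config" where
  "enc (q, i, ws, y) = \<lparr> state = to_nat q, in_pos = i, work = ws, out = y \<rparr>"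

definition confined :: "work_tape \<Rightarrow> bool" where
  "confined t \<longleftrightarrow> range (fst t) \<subseteq> {..<G}"

fun ok :: "'s pconf \<Rightarrow> bool" where
  "ok (q, i, ws, y) \<longleftrightarrow> q \<in> Q \<and> length ws = K \<and> (\<forall>t\<in>set ws. confined t)"

lemma tm_wf_machine: "tm_wf machine"
proof -
  have "dom (delta machine) \<subseteq> to_nat ` Q \<times> UNIV \<times> {ss. set ss \<subseteq> {..<G} \<and> length ss = K}"
    unfolding compile_def by (auto split: if_splits)
  moreover have "finite \<dots>"
    using finite_Q by (intro finite_cartesian_product finite_lists_length_eq) auto
  ultimately have "finite (dom (delta machine))" by (rule finite_subset)
  moreover have "length ss = num_tapes machine \<and> length acts = num_tapes machine"
    if "delta machine (q, a, ss) = Some (q', d, b, acts)" for q a ss q' d b acts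
  proof -
    from that obtain r r' where "r \<in> Q" "set ss \<subseteq> {..<G}" "length ss = K" "tr r a ss = Some (r', d, b, acts)"
      unfolding compile_def by (auto split: if_splits)
    then show ?thesis using closed[of r ss a r' d b acts] unfolding compile_def by auto
  qed
  ultimately show ?thesis unfolding tm_wf_def by blast
qed

lemma no_left_machine:
  assumes "\<And>q a ss q' d b acts. tr q a ss = Some (q', d, b, acts) \<Longrightarrow> d \<noteq> Left"
  shows "no_left machine"
proof -
  have "d \<noteq> Left" if "delta machine (q, a, ss) = Some (q', d, b, acts)" for q a ss q' d b acts
  proof -
    from that obtain r r' where "tr r a ss = Some (r', d, b, acts)"
      unfolding compile_def by (auto split: if_splits)
    then show ?thesis by (rule assms)
  qed
  then show ?thesis unfolding no_left_def by (metis prod_cases3)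
qed

lemma ok_init: "ok pinit"
  using s0 G_pos by (auto simp: confined_def)

lemma enc_init: "enc pinit = init_config machine"
  by (simp add: init_config_def compile_def)

lemma scanned_confined: "confined t \<Longrightarrow> scanned t < G"
  by (cases t) (auto simp: confined_def)

lemma transition_enc:
  assumes "ok (q, i, ws, y)"
  shows "transition machine w (enc (q, i, ws, y)) =
    map_option (\<lambda>(q', d, b, acts). (to_nat q', d, b, acts)) (tr q (in_symbol w i) (map scanned ws))"
  using assms scanned_confined by (auto simp: transition_def compile_def)

lemma halted_enc:
  assumes "ok c"
  shows "halted machine w (enc c) \<longleftrightarrow> pnext tr w c = None"
  using assms by (cases c) (simp add: halted_def transition_enc del: enc.simps ok.simps)

lemma act_confined: "confined t \<Longrightarrow> fst a < G \<Longrightarrow> confined (act t a)"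
  by (cases t; cases a) (auto simp: confined_def)

lemma step_enc:
  assumes ok: "ok c" and n: "pnext tr w c = Some c'"
  shows "step machine w (enc c) = enc c' \<and> ok c'"
proof -
  obtain q i ws y where c: "c = (q, i, ws, y)" by (metis prod_cases4)
  obtain q' d b acts where t: "tr q (in_symbol w i) (map scanned ws) = Some (q', d, b, acts)"
    and c': "c' = (q', i + shift d, map2 act ws acts, y @ (case b of None \<Rightarrow> [] | Some a \<Rightarrow> [a]))"
    using n unfolding c by auto
  have "set (map scanned ws) \<subseteq> {..<G}" "length (map scanned ws) = K" "q \<in> Q"
    using ok scanned_confined unfolding c by auto
  from closed[OF this(3,1,2) t]
  have cl: "q' \<in> Q" "length acts = K" "fst ` set acts \<subseteq> {..<G}" by auto
  have "confined (act t a)" if "(t, a) \<in> set (zip ws acts)" for t a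
    using act_confined[of t a] ok cl(3) set_zip_leftD[OF that] set_zip_rightD[OF that]
    unfolding c by auto
  then have "\<forall>t\<in>set (map2 act ws acts). confined t" by auto
  then have "ok c'" using cl ok unfolding c c' by simp
  moreover have "step machine w (enc c) = enc c'"
    using transition_enc[OF ok[unfolded c], of w] t unfolding c c' by (simp add: step_def)
  ultimately show ?thesis by simp
qed

lemma run_preach:
  assumes "preach tr w n pinit c"
  shows "run machine w n = enc c \<and> ok c"
  using assms
proof (induction n arbitrary: c)
  case 0
  then show ?case using ok_init enc_init by (simp add: run_0 del: enc.simps ok.simps)
next
  case (Suc n)
  then obtain c1 where "preach tr w n pinit c1" "pnext tr w c1 = Some c"
    using preach_split[of tr w n 1 pinit c] by auto
  then show ?case using Suc.IH step_enc unfolding run_Suc by metis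
qed

lemma preach_of_not_halted:
  assumes "\<not> halted machine w (run machine w n)"
  obtains c c' where "preach tr w n pinit c" "pnext tr w c = Some c'"
proof -
  have "\<exists>c. preach tr w n pinit c" using assms
  proof (induction n)
    case 0
    then show ?case by simp
  next
    case (Suc n)
    then have nh: "\<not> halted machine w (run machine w n)" using not_halted_mono by (metis le_Suc_eq order.refl)
    then obtain c where c: "preach tr w n pinit c" using Suc.IH by blast
    then have "pnext tr w c \<noteq> None" using nh run_preach halted_enc by metis
    then show ?case using preach_snoc[OF c] by blast
  qed
  then obtain c where c: "preach tr w n pinit c" by blast
  then have "pnext tr w c \<noteq> None" using assms run_preach halted_enc by metis
  then show ?thesis using that c by blast
qed

lemma halted_preach:
  assumes "preach tr w n pinit c" "pnext tr w c = None"
  shows "halted machine w (run machine w n)"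
  using run_preach[OF assms(1)] halted_enc assms(2) by metis

lemma halts_preach:
  assumes "halts machine w"
  obtains c where "preach tr w (run_time machine w) pinit c" "pnext tr w c = None"
proof -
  let ?n = "run_time machine w"
  have "\<exists>c. preach tr w ?n pinit c"
  proof (cases ?n)
    case (Suc m)
    then have "m < ?n" by simp
    from preach_of_not_halted[OF not_halted_before_run_time[OF this]] obtain c c'
      where "preach tr w m pinit c" "pnext tr w c = Some c'" .
    then show ?thesis using preach_snoc Suc by metis
  qed simp
  then obtain c where c: "preach tr w ?n pinit c" by blast
  have "pnext tr w c = None"
    using halted_run_time[OF assms] run_preach[OF c] halted_enc by metis
  then show ?thesis using that c by blast
qed

lemma tm_fun_preach:
  assumes "preach tr w n pinit (q, i, ws, y)" "pnext tr w (q, i, ws, y) = None"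
  shows "tm_fun machine w = (if q = sa then Some y else None)"
  using tm_fun_halted[OF halted_preach[OF assms]] run_preach[OF assms(1)]
  by (simp add: compile_def)

end

text \<open>
  The bound also covers the numbers that code the arguments of the transition function, because a machine that simulates \<open>M\<close>
  will use them as tape symbols of its log.
\<close>

definition tm_bound :: "tm \<Rightarrow> nat \<Rightarrow> bool" where
  "tm_bound M B \<longleftrightarrow> 0 < B \<and> start M < B \<and> accept M < B \<and>
    (\<forall>q a ss q' d b acts. delta M (q, a, ss) = Some (q', d, b, acts) \<longrightarrow>
       q < B \<and> q' < B \<and> to_nat (q, a, ss) < B \<and> set ss \<subseteq> {..<B} \<and> fst ` set acts \<subseteq> {..<B})"

lemma tm_bound_exists:
  assumes "tm_wf M"
  obtains B where "tm_bound M B"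
proof -
  have fin: "finite (dom (delta M))" using assms unfolding tm_wf_def by simp
  let ?N = "\<lambda>k. case (k, the (delta M k)) of ((q, a, ss), (q', d, b, acts)) \<Rightarrow>
     {q, q', to_nat (q, a, ss)} \<union> set ss \<union> fst ` set acts"
  define S where "S = {start M, accept M} \<union> (\<Union>k\<in>dom (delta M). ?N k)"
  have "finite S" unfolding S_def using fin by (auto split: prod.split)
  then have lt: "s < Suc (Max S)" if "s \<in> S" for s using that by (simp add: less_Suc_eq_le)
  have "tm_bound M (Suc (Max S))"
    unfolding tm_bound_def
  proof (intro conjI allI impI)
    show "start M < Suc (Max S)" "accept M < Suc (Max S)" using lt unfolding S_def by auto
    fix q a ss q' d b acts
    assume "delta M (q, a, ss) = Some (q', d, b, acts)"
    then have "{q, q', to_nat (q, a, ss)} \<union> set ss \<union> fst ` set acts \<subseteq> S"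
      unfolding S_def by (force simp: dom_def)
    then show "q < Suc (Max S)" "q' < Suc (Max S)" "to_nat (q, a, ss) < Suc (Max S)"
      "set ss \<subseteq> {..<Suc (Max S)}" "fst ` set acts \<subseteq> {..<Suc (Max S)}"
      using lt by auto
  qed simp
  then show ?thesis by (rule that)
qed

section \<open>The padding machine\<close>

text \<open>
  The states are the phases of the machine that pads the morphism computed by a machine \<open>M\<close>. It has an input buffer, a
  log, two clocks, and the work tapes of \<open>M\<close>.

  \<^item> \<open>Sim commit q\<close> performs one step of \<open>M\<close> on the buffered prefix and pushes the arguments of the transition onto
    the log. Output is written only if \<open>commit\<close> holds.
  \<^item> \<open>Undo ok\<close> and \<open>Unwrite ok\<close> pop the log and run \<open>M\<close> backwards, which restores the blank tapes exactly; the flag says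
    whether \<open>M\<close> has accepted. If so, \<open>M\<close> is simulated a second time with \<open>commit\<close> set, so no tape is needed that holds
    tentative output.
  \<^item> \<open>Scan\<close> and \<open>Rewind\<close> go to the end of the buffer, append one more letter of the input, and return.
  \<^item> \<open>Pad r\<close> copies input letters to the output while the head of the first clock sweeps over its marks, to the right if \<open>r\<close> holds.
    Each turn moves the head of the second clock by one mark.
  \<^item> \<open>Copy\<close> is the accepting state, in which the rest of the input is copied.

  Every step before the padding phase adds one mark to both clocks. The last of these steps writes its mark without
  moving on, so that both heads start the padding phase on the last mark.
\<close>

datatype pad_state = Sim bool nat | Undo bool | Unwrite bool | Scan | Rewind | Pad bool | Copy

instance pad_state :: countable by countable_datatype

fun code :: "bool option \<Rightarrow> nat" where
  "code None = 0" | "code (Some False) = 1" | "code (Some True) = 2"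

definition decode :: "nat \<Rightarrow> bool option" where
  "decode s = (if s = 1 then Some False else if s = 2 then Some True else None)"

lemma decode_code: "decode (code a) = a"
  by (cases a rule: code.cases) (auto simp: decode_def)

lemma code_eq_0_iff: "code a = 0 \<longleftrightarrow> a = None"
  by (cases a rule: code.cases) auto

fun opp :: "move \<Rightarrow> move" where
  "opp Left = Right" | "opp Stay = Stay" | "opp Right = Left"

lemma shift_opp: "shift (opp d) = - shift d"
  by (cases d) auto

abbreviation keep :: "nat list \<Rightarrow> (nat \<times> move) list" where
  "keep ss \<equiv> map (\<lambda>s. (s, Stay)) ss"

abbreviation tick :: "nat \<times> move" where
  "tick \<equiv> (1, Right)"

fun pad_prog :: "tm \<Rightarrow> pad_state prog" where
  "pad_prog M q a (s # l # c1 # c2 # ss) =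
    (case q of
       Sim commit q \<Rightarrow>
         (case delta M (q, decode s, ss) of
            Some (q', d, b, acts) \<Rightarrow>
              Some (Sim commit q', Stay, if commit then b else None,
                (s, d) # (Suc (to_nat (q, decode s, ss)), Right) # tick # tick # acts)
          | None \<Rightarrow>
              if commit
              then Some (Pad False, Stay, None, (s, Stay) # (l, Stay) # (1, Stay) # (1, Stay) # keep ss)
              else Some (Undo (q = accept M), Stay, None,
                (s, Stay) # (l, Left) # tick # tick # keep ss))
     | Undo ok \<Rightarrow>
         if l = 0
         then Some (if ok then Sim True (start M) else Scan, Stay, None,
           (s, Stay) # (l, Right) # tick # tick # keep ss)
         else (case delta M (from_nat (l - 1)) of
            Some (q', d, b, acts) \<Rightarrow>
              Some (Unwrite ok, Stay, None,
                (s, opp d) # (l, Stay) # tick # tick # map2 (\<lambda>s (_, d). (s, opp d)) ss acts)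
          | None \<Rightarrow> None)
     | Unwrite ok \<Rightarrow>
         (case from_nat (l - 1) of (q', a', ss') \<Rightarrow>
            if delta M (q', a', ss') = None then None
            else Some (Undo ok, Stay, None, (s, Stay) # (0, Left) # tick # tick # keep ss'))
     | Scan \<Rightarrow>
         if s \<noteq> 0 then Some (Scan, Stay, None, (s, Right) # (l, Stay) # tick # tick # keep ss)
         else (case a of
            Some x \<Rightarrow> Some (Rewind, Right, None, (code a, Left) # (l, Stay) # tick # tick # keep ss)
          | None \<Rightarrow> None)
     | Rewind \<Rightarrow>
         if s \<noteq> 0 then Some (Rewind, Stay, None, (s, Left) # (l, Stay) # tick # tick # keep ss)
         else Some (Sim False (start M), Stay, None, (s, Right) # (l, Stay) # tick # tick # keep ss)
     | Pad r \<Rightarrow>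
         (case a of
            Some x \<Rightarrow>
              if c1 \<noteq> 0
              then Some (Pad r, Right, Some x, (s, Stay) # (l, Stay) #
                (c1, if r then Right else Left) # (c2, Stay) # keep ss)
              else if c2 \<noteq> 0
              then Some (Pad (\<not> r), Right, Some x, (s, Stay) # (l, Stay) #
                (c1, if r then Left else Right) # (c2, Left) # keep ss)
              else Some (Copy, Right, Some x, keep (s # l # c1 # c2 # ss))
          | None \<Rightarrow> None)
     | Copy \<Rightarrow>
         (case a of
            Some x \<Rightarrow> Some (Copy, Right, Some x, keep (s # l # c1 # c2 # ss))
          | None \<Rightarrow> None))"
| "pad_prog M q a _ = None"

lemma pad_prog_no_left:
  assumes "pad_prog M q a ss = Some (q', d, b, acts)"
  shows "d \<noteq> Left"
  using assms
  by (cases "(M, q, a, ss)" rule: pad_prog.cases)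
    (auto split: pad_state.splits option.splits if_splits prod.splits)

definition pad_states :: "nat \<Rightarrow> pad_state set" where
  "pad_states B = {Scan, Rewind, Copy} \<union> (\<Union>f. {Undo f, Unwrite f, Pad f} \<union> Sim f ` {..<B})"

lemma finite_pad_states: "finite (pad_states B)"
  unfolding pad_states_def by simp

lemma pad_states_iff:
  "Sim f q \<in> pad_states B \<longleftrightarrow> q < B" "Undo f \<in> pad_states B" "Unwrite f \<in> pad_states B"
  "Pad f \<in> pad_states B" "Scan \<in> pad_states B" "Rewind \<in> pad_states B" "Copy \<in> pad_states B"
  unfolding pad_states_def by auto

lemma keep_symbols: "fst ` set (keep ss) = set ss"
  by (simp add: image_image)

lemma unmove_symbols: "fst ` set (map2 (\<lambda>s (_, d). (s, opp d)) ss acts) \<subseteq> set ss"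
  by (auto dest: set_zip_leftD)

text \<open>
  The symbol bound leaves room for the buffer codes up to \<open>2\<close> and for the log entries, which exceed the codes of
  arguments by one because zero is the blank.
\<close>

lemma pad_program:
  assumes wf: "tm_wf M" and B: "tm_bound M B"
  shows "program (pad_prog M) (pad_states B) (B + 3) (4 + num_tapes M) (Sim False (start M))"
proof
  show "finite (pad_states B)" by (rule finite_pad_states)
  show "Sim False (start M) \<in> pad_states B" using B by (simp add: pad_states_iff tm_bound_def)
  show "0 < B + 3" by simp
  fix q a ss q' d b acts
  assume q: "q \<in> pad_states B" and ss: "set ss \<subseteq> {..<B + 3}" "length ss = 4 + num_tapes M"
    and t: "pad_prog M q a ss = Some (q', d, b, acts)"
  have bd: "r < B" "r' < B" "to_nat (r, e, us) < B" "set us \<subseteq> {..<B + 3}" "fst ` set as \<subseteq> {..<B + 3}"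
     "length us = num_tapes M" "length as = num_tapes M"
    if "delta M (r, e, us) = Some (r', f, g, as)" for r e us r' f g as
  proof -
    have "r < B \<and> r' < B \<and> to_nat (r, e, us) < B \<and> set us \<subseteq> {..<B} \<and> fst ` set as \<subseteq> {..<B}"
      using B that unfolding tm_bound_def by blast
    then show "r < B" "r' < B" "to_nat (r, e, us) < B" "set us \<subseteq> {..<B + 3}"
      "fst ` set as \<subseteq> {..<B + 3}" by (auto simp: subset_iff trans_less_add1)
    show "length us = num_tapes M" "length as = num_tapes M"
      using wf that unfolding tm_wf_def by blast+
  qed
  have st: "start M < B" using B unfolding tm_bound_def by simp
  obtain s l c1 c2 us where e: "ss = s # l # c1 # c2 # us"
    using t by (cases "(M, q, a, ss)" rule: pad_prog.cases) auto
  have us: "s < B + 3" "l < B + 3" "c1 < B + 3" "c2 < B + 3" "set us \<subseteq> {..<B + 3}"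
      "length us = num_tapes M"
    using ss unfolding e by auto
  have cd: "code a < B + 3" by (cases a rule: code.cases) auto
  have um: "fst ` set (map2 (\<lambda>s (_, d). (s, opp d)) us as) \<subseteq> {..<B + 3}" for as
    using unmove_symbols[of us as] us(5) by blast
  show "q' \<in> pad_states B \<and> length acts = 4 + num_tapes M \<and> fst ` set acts \<subseteq> {..<B + 3}"
  proof (cases q)
    case (Sim f r)
    show ?thesis
    proof (cases "delta M (r, decode s, us)")
      case None
      then show ?thesis using t us unfolding e Sim
        by (auto simp: pad_states_iff image_image split: if_splits)
    next
      case (Some k)
      then obtain r' g h as where k: "delta M (r, decode s, us) = Some (r', g, h, as)" by (metis prod_cases4)
      have "u < B + 3" if "(u, d) \<in> set as" for u d using bd(5)[OF k] that by force
      then show ?thesis using t us bd(1-4,6,7)[OF k] k unfolding e Sim by (auto simp: pad_states_iff)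
    qed
  next
    case (Undo f)
    show ?thesis
    proof (cases "l = 0")
      case True
      then show ?thesis using t us st unfolding e Undo by (auto simp: pad_states_iff image_image)
    next
      case False
      obtain r x vs where k: "(from_nat (l - Suc 0) :: nat \<times> bool option \<times> nat list) = (r, x, vs)" by (metis prod_cases3)
      obtain r' g h as where k': "delta M (r, x, vs) = Some (r', g, h, as)"
        using t False unfolding e Undo by (auto split: option.splits simp: k)
      have "u < B + 3" if "(u, d) \<in> set (map2 (\<lambda>s (_, d). (s, opp d)) us as)" for u d
        using um[of as] that by force
      then show ?thesis using t us bd[OF k'] False unfolding e Undo
        by (auto simp: pad_states_iff k k' simp del: set_map)
    qed
  next
    case (Unwrite f)
    obtain r x vs where k: "(from_nat (l - Suc 0) :: nat \<times> bool option \<times> nat list) = (r, x, vs)" by (metis prod_cases3)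
    obtain r' g h as where k': "delta M (r, x, vs) = Some (r', g, h, as)"
      using t unfolding e Unwrite by (auto split: if_splits simp: k)
    show ?thesis using t us bd[OF k'] unfolding e Unwrite by (auto simp: pad_states_iff image_image k k')
  next
    case Scan
    then show ?thesis using t us cd unfolding e
      by (auto simp: pad_states_iff image_image split: if_splits option.splits)
  next
    case Rewind
    then show ?thesis using t us st unfolding e
      by (auto simp: pad_states_iff image_image split: if_splits)
  next
    case (Pad f)
    then show ?thesis using t us unfolding e
      by (auto simp: pad_states_iff image_image split: if_splits option.splits)
  next
    case Copy
    then show ?thesis using t us unfolding e
      by (auto simp: pad_states_iff image_image split: if_splits option.splits)
  qed
qed

definition buf_tape :: "word \<Rightarrow> int \<Rightarrow> work_tape" where
  "buf_tape v p = (\<lambda>i. code (in_symbol v i), p)"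

type_synonym key = "nat \<times> bool option \<times> nat list"

definition log_tape :: "key list \<Rightarrow> int \<Rightarrow> work_tape" where
  "log_tape ks p =
     (\<lambda>i. if 0 \<le> i \<and> i < int (length ks) then Suc (to_nat (ks ! nat i)) else 0, p)"

definition clock_tape :: "nat \<Rightarrow> int \<Rightarrow> work_tape" where
  "clock_tape m p = (\<lambda>i. if 0 \<le> i \<and> i < int m then 1 else 0, p)"

lemma act_keep: "map2 act ws (keep (map scanned ws)) = ws"
  by (induction ws) (auto simp del: act.simps scanned.simps, metis act.simps add.right_neutral fun_upd_triv scanned.simps shift.simps(2) surj_pair)

text \<open>
  A step writes before it moves, so undoing it takes two steps: first move the heads back, keeping what is under them,
  then write the old symbols.
\<close>

lemma map2_act_undo:
  assumes "length ws = length acts"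
  shows "map2 act (map2 act (map2 act ws acts)
      (map2 (\<lambda>s (_, d). (s, opp d)) (map scanned (map2 act ws acts)) acts)) (keep (map scanned ws)) = ws"
  using assms by (induction ws acts rule: list_induct2) (auto simp: shift_opp)

lemma buf_tape_simps:
  "scanned (buf_tape v p) = code (in_symbol v p)"
  "act (buf_tape v p) (code (in_symbol v p), d) = buf_tape v (p + shift d)"
  by (auto simp: buf_tape_def)

lemma buf_tape_snoc:
  "act (buf_tape v (int (length v))) (code (Some x), d) = buf_tape (v @ [x]) (int (length v) + shift d)"
  by (auto simp: buf_tape_def in_symbol_def nth_append fun_eq_iff)

lemma log_tape_scanned:
  "scanned (log_tape ks (- 1)) = 0"
  "scanned (log_tape (ks @ [k]) (int (length ks))) = Suc (to_nat k)"
  by (auto simp: log_tape_def)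

lemma log_tape_push:
  "act (log_tape ks (int (length ks))) (Suc (to_nat k), d) =
     log_tape (ks @ [k]) (int (length ks) + shift d)"
  by (auto simp: log_tape_def nth_append fun_eq_iff)

lemma log_tape_pop:
  "act (log_tape (ks @ [k]) (int (length ks))) (0, d) = log_tape ks (int (length ks) + shift d)"
  by (auto simp: log_tape_def nth_append fun_eq_iff)

lemma log_tape_keep: "act (log_tape ks p) (scanned (log_tape ks p), d) = log_tape ks (p + shift d)"
  by (auto simp: log_tape_def)

lemma clock_tape_tick:
  "act (clock_tape m (int m)) (1, d) = clock_tape (Suc m) (int m + shift d)"
  by (auto simp: clock_tape_def)

lemma clock_tape_scanned: "scanned (clock_tape m p) = (if 0 \<le> p \<and> p < int m then 1 else 0)"
  by (simp add: clock_tape_def)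

lemma clock_tape_keep: "act (clock_tape m p) (scanned (clock_tape m p), d) = clock_tape m (p + shift d)"
  by (auto simp: clock_tape_def)

section \<open>The computation of the padding machine\<close>

definition sim_key :: "tm \<Rightarrow> word \<Rightarrow> nat \<Rightarrow> key" where
  "sim_key M v j =
     (state (run M v j), in_symbol v (in_pos (run M v j)), map scanned (work (run M v j)))"

text \<open>
  The log determines how to undo the simulation, and its length is the number of steps simulated.
\<close>

definition sim_log :: "tm \<Rightarrow> word \<Rightarrow> nat \<Rightarrow> key list" where
  "sim_log M v j = map (sim_key M v) [0..<j]"

definition search_conf ::
  "pad_state \<Rightarrow> word \<Rightarrow> int \<Rightarrow> key list \<Rightarrow> int \<Rightarrow> nat \<Rightarrow> work_tape list \<Rightarrow> word \<Rightarrow> pad_state pconf" where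
  "search_conf q v p ks lp \<tau> ws y =
     (q, int (length v),
      buf_tape v p # log_tape ks lp # clock_tape \<tau> (int \<tau>) # clock_tape \<tau> (int \<tau>) # ws, y)"

abbreviation blank_tapes :: "tm \<Rightarrow> work_tape list" where
  "blank_tapes M \<equiv> replicate (num_tapes M) (\<lambda>_. 0, 0)"

lemma sim_log_Suc: "sim_log M v (Suc j) = sim_log M v j @ [sim_key M v j]"
  by (simp add: sim_log_def)

lemma length_sim_log: "length (sim_log M v j) = j"
  by (simp add: sim_log_def)

lemma init_simps:
  "state (init_config M) = start M" "in_pos (init_config M) = 0"
  "work (init_config M) = blank_tapes M" "out (init_config M) = []"
  by (simp_all add: init_config_def)

lemma transition_sim_key:
  "transition M v (run M v j) = delta M (sim_key M v j)"
  by (simp add: transition_def sim_key_def)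

lemma clock_tape_ticks:
  "act (clock_tape m (int m)) (Suc 0, Right) = clock_tape (Suc m) (1 + int m)"
  "act (clock_tape m (int m)) (Suc 0, Stay) = clock_tape (Suc m) (int m)"
  using clock_tape_tick[of m Right] clock_tape_tick[of m Stay] by (simp_all add: add.commute)

lemma act_keep_map: "map2 act ws (map ((\<lambda>s. (s, Stay)) \<circ> scanned) ws) = ws"
  using act_keep[of ws] by simp

lemmas tape_simps = buf_tape_simps(1) decode_code code_eq_0_iff clock_tape_ticks act_keep_map
  buf_tape_simps(2) log_tape_keep act_keep shift_opp

declare act.simps [simp del] scanned.simps [simp del]

definition sim_conf :: "tm \<Rightarrow> bool \<Rightarrow> word \<Rightarrow> nat \<Rightarrow> nat \<Rightarrow> pad_state pconf" where
  "sim_conf M commit v \<tau> j = search_conf (Sim commit (state (run M v j))) v (in_pos (run M v j))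
     (sim_log M v j) (int j) \<tau> (work (run M v j)) (if commit then out (run M v j) else [])"

lemma sim_step:
  assumes "\<not> halted M v (run M v j)"
  shows "pnext (pad_prog M) w (sim_conf M commit v \<tau> j) = Some (sim_conf M commit v (Suc \<tau>) (Suc j))"
proof -
  obtain q d b acts where t: "transition M v (run M v j) = Some (q, d, b, acts)"
    using assms unfolding halted_def by (metis not_None_eq prod_cases4)
  have push: "act (log_tape (sim_log M v j) (int j)) (Suc (to_nat (sim_key M v j)), Right) =
      log_tape (sim_log M v (Suc j)) (1 + int j)"
    using log_tape_push[of "sim_log M v j" "sim_key M v j" Right]
    by (simp add: length_sim_log sim_log_Suc add.commute)
  show ?thesis
    using t[unfolded transition_sim_key, unfolded sim_key_def] step_Some[OF t]
      push[unfolded sim_key_def]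
    unfolding sim_conf_def search_conf_def
    by (simp add: run_Suc tape_simps)
qed

lemma sim_reach:
  assumes "\<And>i. i < n \<Longrightarrow> \<not> halted M v (run M v i)"
  shows "preach (pad_prog M) w n (sim_conf M commit v \<tau> 0) (sim_conf M commit v (\<tau> + n) n)"
  using assms
proof (induction n)
  case 0
  then show ?case by (simp add: sim_conf_def)
next
  case (Suc n)
  then show ?case
    using preach_snoc[OF Suc.IH sim_step[of M v n w commit "\<tau> + n"]] by simp
qed

definition undo_conf :: "tm \<Rightarrow> bool \<Rightarrow> word \<Rightarrow> nat \<Rightarrow> nat \<Rightarrow> pad_state pconf" where
  "undo_conf M ok v \<tau> j = search_conf (Undo ok) v (in_pos (run M v j))
     (sim_log M v j) (int j - 1) \<tau> (work (run M v j)) []"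

lemma sim_halt:
  assumes "halted M v (run M v j)"
  shows "pnext (pad_prog M) w (sim_conf M False v \<tau> j) =
    Some (undo_conf M (state (run M v j) = accept M) v (Suc \<tau>) j)"
  using assms unfolding halted_def transition_sim_key sim_conf_def undo_conf_def search_conf_def
  by (simp add: tape_simps sim_key_def)

lemma undo_step:
  assumes wf: "tm_wf M" and nh: "\<not> halted M v (run M v j)"
  shows "preach (pad_prog M) w 2 (undo_conf M ok v \<tau> (Suc j)) (undo_conf M ok v (\<tau> + 2) j)"
proof -
  obtain q d b acts where t: "transition M v (run M v j) = Some (q, d, b, acts)"
    using nh unfolding halted_def by (metis not_None_eq prod_cases4)
  let ?ws = "work (run M v j)" and ?k = "sim_key M v j" and ?L = "sim_log M v j"
  have len: "length ?ws = length acts" using transition_Some_length[OF wf t] by simp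
  note t' = t[unfolded transition_sim_key]
  define ws' where "ws' = map2 act ?ws acts"
  define ws'' where "ws'' = map2 act ws' (map2 (\<lambda>s (_, d). (s, opp d)) (map scanned ws') acts)"
  define c where "c = search_conf (Unwrite ok) v (in_pos (run M v j)) (?L @ [?k]) (int j) (Suc \<tau>) ws'' []"
  have log: "scanned (log_tape (?L @ [?k]) (int j)) = Suc (to_nat ?k)"
    using log_tape_scanned(2)[of ?L ?k] by (simp add: length_sim_log)
  have logk: "act (log_tape (?L @ [?k]) (int j)) (Suc (to_nat ?k), Stay) = log_tape (?L @ [?k]) (int j)"
    using log_tape_keep[of "?L @ [?k]" "int j" Stay] log by simp
  have pop: "act (log_tape (?L @ [?k]) (int j)) (0, Left) = log_tape ?L (int j - 1)"
    using log_tape_pop[of ?L ?k Left] by (simp add: length_sim_log)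
  have tick2: "act (clock_tape (Suc \<tau>) (1 + int \<tau>)) (Suc 0, Right) = clock_tape (Suc (Suc \<tau>)) (2 + int \<tau>)"
    using clock_tape_ticks(1)[of "Suc \<tau>"] by simp
  have "pnext (pad_prog M) w (undo_conf M ok v \<tau> (Suc j)) = Some c"
    using step_Some[OF t] t' unfolding undo_conf_def search_conf_def c_def
    by (simp add: run_Suc sim_log_Suc log logk tape_simps ws'_def[symmetric] ws''_def[symmetric])
  moreover have "map2 act ws'' (keep (map scanned ?ws)) = ?ws"
    unfolding ws''_def ws'_def by (rule map2_act_undo[OF len])
  then have "pnext (pad_prog M) w c = Some (undo_conf M ok v (\<tau> + 2) j)"
    using t' unfolding undo_conf_def search_conf_def c_def
    by (simp add: log[unfolded sim_key_def] pop[unfolded sim_key_def] tape_simps tick2 sim_key_def)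
  ultimately show ?thesis by (simp add: numeral_2_eq_2 del: split_paired_Ex)
qed

text \<open>
  After the undo phase all tapes are as they were before the simulation. The simulation of the next prefix can thus
  start from blank tapes.
\<close>

lemma undo_reach:
  assumes wf: "tm_wf M" and "\<And>i. i < n \<Longrightarrow> \<not> halted M v (run M v i)"
  shows "preach (pad_prog M) w (2 * n) (undo_conf M ok v \<tau> n) (undo_conf M ok v (\<tau> + 2 * n) 0)"
  using assms(2)
proof (induction n arbitrary: \<tau>)
  case 0
  then show ?case by simp
next
  case (Suc n)
  have "preach (pad_prog M) w (2 + 2 * n) (undo_conf M ok v \<tau> (Suc n)) (undo_conf M ok v (\<tau> + 2 + 2 * n) 0)"
    using preach_trans[OF undo_step[OF wf, of v n w ok \<tau>] Suc.IH[of "\<tau> + 2"]] Suc.prems by simp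
  then show ?case by simp
qed

definition scan_conf :: "tm \<Rightarrow> pad_state \<Rightarrow> word \<Rightarrow> int \<Rightarrow> nat \<Rightarrow> pad_state pconf" where
  "scan_conf M q v p \<tau> = search_conf q v p [] 0 \<tau> (blank_tapes M) []"

lemma sim_conf_0: "sim_conf M f v \<tau> 0 = scan_conf M (Sim f (start M)) v 0 \<tau>"
  by (simp add: sim_conf_def scan_conf_def run_0 init_simps sim_log_def)

lemma undo_finish:
  "pnext (pad_prog M) w (undo_conf M ok v \<tau> 0) =
     Some (scan_conf M (if ok then Sim True (start M) else Scan) v 0 (Suc \<tau>))"
proof -
  have "act (log_tape [] (- 1)) (0, Right) = log_tape [] 0"
    using log_tape_keep[of "[]" "-1" Right] by (simp add: log_tape_scanned(1))
  then show ?thesis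
    unfolding undo_conf_def scan_conf_def search_conf_def
    using act_keep[of "blank_tapes M"]
    by (simp add: tape_simps run_0 init_simps sim_log_def log_tape_scanned(1))
qed

lemma scan_step:
  assumes "p < length v"
  shows "pnext (pad_prog M) w (scan_conf M Scan v (int p) \<tau>) = Some (scan_conf M Scan v (int (Suc p)) (Suc \<tau>))"
    (is ?A)
    and "pnext (pad_prog M) w (scan_conf M Rewind v (int p) \<tau>) = Some (scan_conf M Rewind v (int p - 1) (Suc \<tau>))"
    (is ?B)
proof -
  have "in_symbol v (int p) \<noteq> None" using assms by (simp add: in_symbol_def)
  then show ?A ?B unfolding scan_conf_def search_conf_def
    using act_keep[of "blank_tapes M"] log_tape_keep[of "[]" 0 Stay]
    by (simp_all add: tape_simps algebra_simps)
qed

lemma scan_reach: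
  "n \<le> length v \<Longrightarrow>
     preach (pad_prog M) w n (scan_conf M Scan v 0 \<tau>) (scan_conf M Scan v (int n) (\<tau> + n))"
proof (induction n)
  case 0
  then show ?case by simp
next
  case (Suc n)
  then show ?case
    using preach_snoc[OF Suc.IH scan_step(1)[of n v M w "\<tau> + n"]] by simp
qed

lemma rewind_reach:
  "n \<le> length v \<Longrightarrow>
     preach (pad_prog M) w n (scan_conf M Rewind v (int n - 1) \<tau>) (scan_conf M Rewind v (- 1) (\<tau> + n))"
proof (induction n arbitrary: \<tau>)
  case 0
  then show ?case by simp
next
  case (Suc n)
  have "preach (pad_prog M) w (Suc 0 + n) (scan_conf M Rewind v (int n) \<tau>) (scan_conf M Rewind v (- 1) (Suc \<tau> + n))"
    using preach_trans[OF preach_step[OF scan_step(2)[of n v M w \<tau>]] Suc.IH[of "Suc \<tau>"]] Suc.prems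
    by simp
  then show ?case by simp
qed

lemma append_step:
  assumes "in_symbol w (int (length v)) = Some x"
  shows "pnext (pad_prog M) w (scan_conf M Scan v (int (length v)) \<tau>) =
    Some (scan_conf M Rewind (v @ [x]) (int (length v) - 1) (Suc \<tau>))"
proof -
  have "in_symbol v (int (length v)) = None" by (simp add: in_symbol_def)
  then show ?thesis
    using assms buf_tape_snoc[of v x Left] act_keep[of "blank_tapes M"] log_tape_keep[of "[]" 0 Stay]
    unfolding scan_conf_def search_conf_def
    by (simp add: tape_simps)
qed

lemma rewind_finish:
  "pnext (pad_prog M) w (scan_conf M Rewind v (- 1) \<tau>) =
     Some (scan_conf M (Sim False (start M)) v 0 (Suc \<tau>))"
proof -
  have n: "in_symbol v (- 1) = None" by (simp add: in_symbol_def)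
  then show ?thesis
    using act_keep[of "blank_tapes M"] log_tape_keep[of "[]" 0 Stay] buf_tape_simps(2)[of v "-1" Right]
    unfolding scan_conf_def search_conf_def
    by (simp add: tape_simps)
qed

lemma scan_end:
  assumes "in_symbol w (int (length v)) = None"
  shows "pnext (pad_prog M) w (scan_conf M Scan v (int (length v)) \<tau>) = None"
proof -
  have "in_symbol v (int (length v)) = None" by (simp add: in_symbol_def)
  then show ?thesis
    using assms unfolding scan_conf_def search_conf_def by (simp add: tape_simps)
qed

text \<open>
  The two functions count steps. A stage on a rejected prefix of length \<open>n\<close> simulates \<open>r\<close> steps, undoes them in \<open>2 * r\<close>
  steps, passes over the buffer twice, and makes four steps between these phases. The last stage has a second simulation in place
  of the buffer passes. The sum is a function of the accepted prefix alone.
\<close>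

definition reject_cost :: "tm \<Rightarrow> word \<Rightarrow> nat" where
  "reject_cost M v = 3 * run_time M v + 2 * length v + 4"

definition search_time :: "tm \<Rightarrow> word \<Rightarrow> nat" where
  "search_time M x = (\<Sum>i<length x. reject_cost M (take i x)) + 4 * run_time M x + 3"

abbreviation stage_conf :: "tm \<Rightarrow> word \<Rightarrow> nat \<Rightarrow> pad_state pconf" where
  "stage_conf M v \<tau> \<equiv> scan_conf M (Sim False (start M)) v 0 \<tau>"

lemma test_reach:
  assumes wf: "tm_wf M" and h: "halts M v"
  shows "preach (pad_prog M) w (3 * run_time M v + 2) (stage_conf M v \<tau>)
    (scan_conf M (if tm_fun M v \<noteq> None then Sim True (start M) else Scan) v 0
      (\<tau> + 3 * run_time M v + 2))"
proof -
  let ?r = "run_time M v"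
  let ?ok = "state (run M v ?r) = accept M"
  note nh = not_halted_before_run_time[of _ M v] and hr = halted_run_time[OF h]
  have ok: "?ok \<longleftrightarrow> tm_fun M v \<noteq> None" using tm_fun_halted[OF hr] by simp
  have 1: "preach (pad_prog M) w ?r (stage_conf M v \<tau>) (sim_conf M False v (\<tau> + ?r) ?r)"
    using sim_reach[OF nh, of _ w False \<tau>] unfolding sim_conf_0 by simp
  have 2: "preach (pad_prog M) w (Suc ?r) (stage_conf M v \<tau>) (undo_conf M ?ok v (Suc (\<tau> + ?r)) ?r)"
    using preach_snoc[OF 1 sim_halt[OF hr]] .
  have 3: "preach (pad_prog M) w (2 * ?r) (undo_conf M ?ok v (Suc (\<tau> + ?r)) ?r)
      (undo_conf M ?ok v (Suc (\<tau> + ?r) + 2 * ?r) 0)"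
    using undo_reach[OF wf nh] by blast
  have "preach (pad_prog M) w (Suc (Suc ?r + 2 * ?r)) (stage_conf M v \<tau>)
      (scan_conf M (if ?ok then Sim True (start M) else Scan) v 0 (Suc (Suc (\<tau> + ?r) + 2 * ?r)))"
    using preach_snoc[OF preach_trans[OF 2 3] undo_finish] .
  then show ?thesis unfolding ok by (simp add: algebra_simps del: preach.simps)
qed

lemma reject_reach:
  assumes wf: "tm_wf M" and h: "halts M v" and f: "tm_fun M v = None"
    and x: "in_symbol w (int (length v)) = Some x"
  shows "preach (pad_prog M) w (reject_cost M v) (stage_conf M v \<tau>)
    (stage_conf M (v @ [x]) (\<tau> + reject_cost M v))"
proof -
  let ?t = "\<tau> + 3 * run_time M v + 2" and ?n = "length v"
  have 1: "preach (pad_prog M) w (3 * run_time M v + 2) (stage_conf M v \<tau>) (scan_conf M Scan v 0 ?t)"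
    using test_reach[OF wf h, of w \<tau>] f by simp
  note 2 = preach_trans[OF 1 scan_reach[OF order.refl]]
  note 3 = preach_snoc[OF 2 append_step[OF x]]
  have "preach (pad_prog M) w (Suc ?n) (scan_conf M Rewind (v @ [x]) (int ?n - 1) (Suc (?t + ?n)))
      (stage_conf M (v @ [x]) (Suc (Suc (?t + ?n) + ?n)))"
    using preach_snoc[OF rewind_reach[of ?n "v @ [x]" M w "Suc (?t + ?n)"] rewind_finish] by simp
  from preach_trans[OF 3 this] show ?thesis
    unfolding reject_cost_def by (simp add: algebra_simps eval_nat_numeral del: preach.simps)
qed

lemma reject_end:
  assumes wf: "tm_wf M" and h: "halts M v" and f: "tm_fun M v = None"
    and x: "in_symbol w (int (length v)) = None"
  shows "\<exists>c \<le> reject_cost M v. \<exists>\<tau>'. preach (pad_prog M) w c (stage_conf M v \<tau>)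
      (scan_conf M Scan v (int (length v)) \<tau>') \<and>
      pnext (pad_prog M) w (scan_conf M Scan v (int (length v)) \<tau>') = None"
proof -
  have 1: "preach (pad_prog M) w (3 * run_time M v + 2) (stage_conf M v \<tau>)
      (scan_conf M Scan v 0 (\<tau> + 3 * run_time M v + 2))"
    using test_reach[OF wf h, of w \<tau>] f by simp
  show ?thesis
    using preach_trans[OF 1 scan_reach[OF order.refl]] scan_end[OF x]
    by (intro exI[of _ "3 * run_time M v + 2 + length v"] conjI exI) (auto simp: reject_cost_def)
qed

text \<open>
  The number of letters still to be copied before the machine enters its accepting state, when the clocks have \<open>m\<close> marks and their
  heads are at \<open>p1\<close> and \<open>p2\<close>: those of the current sweep including the turn, and \<open>m + 1\<close> for each mark left on the second
  clock.
\<close>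

definition pad_rank :: "nat \<Rightarrow> bool \<Rightarrow> int \<Rightarrow> int \<Rightarrow> int" where
  "pad_rank m r p1 p2 = (if r then int m - p1 else p1 + 1) + 1 + (int m + 1) * (p2 + 1)"

definition pad_inv :: "nat \<Rightarrow> int \<Rightarrow> pad_state \<Rightarrow> work_tape list \<Rightarrow> bool" where
  "pad_inv m k q ts \<longleftrightarrow>
     (\<exists>b l p1 p2 ws. ts = b # l # clock_tape m p1 # clock_tape m p2 # ws \<and>
       ((\<exists>r. q = Pad r \<and> k = pad_rank m r p1 p2 \<and> -1 \<le> p2 \<and> p2 < int m \<and>
           (if r then 0 \<le> p1 \<and> p1 \<le> int m else -1 \<le> p1 \<and> p1 < int m)) \<or>
        (q = Copy \<and> k \<le> 0)))"

lemma pad_inv_PadI: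
  assumes "k = pad_rank m r p1 p2" "-1 \<le> p2" "p2 < int m"
    "if r then 0 \<le> p1 \<and> p1 \<le> int m else -1 \<le> p1 \<and> p1 < int m"
  shows "pad_inv m k (Pad r) (b # l # clock_tape m p1 # clock_tape m p2 # ws)"
  using assms unfolding pad_inv_def by blast

lemma act_keep_1: "act t (scanned t, Stay) = t"
  using act_keep[of "[t]"] by simp

text \<open>
  Each copied letter lowers the rank by exactly one, also at the turns.
\<close>

lemma pad_step:
  assumes m: "0 < m" and inv: "pad_inv m k q ts" and x: "in_symbol w i = Some x"
  shows "\<exists>q' ts'. pnext (pad_prog M) w (q, i, ts, y) = Some (q', i + 1, ts', y @ [x]) \<and>
    pad_inv m (k - 1) q' ts'"
proof -
  obtain b l p1 p2 ws where ts: "ts = b # l # clock_tape m p1 # clock_tape m p2 # ws"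
    and alt: "(\<exists>r. q = Pad r \<and> k = pad_rank m r p1 p2 \<and> -1 \<le> p2 \<and> p2 < int m \<and>
           (if r then 0 \<le> p1 \<and> p1 \<le> int m else -1 \<le> p1 \<and> p1 < int m)) \<or> (q = Copy \<and> k \<le> 0)"
    using inv unfolding pad_inv_def by blast
  note mv = clock_tape_keep[of m p1] clock_tape_keep[of m p2]
  note s = act_keep_1 act_keep_map mv
  from alt show ?thesis
  proof (elim disjE exE conjE)
    assume q: "q = Copy" and k: "k \<le> 0"
    have "pnext (pad_prog M) w (q, i, ts, y) = Some (Copy, i + 1, ts, y @ [x])"
      unfolding q ts using x by (simp add: s)
    moreover have "pad_inv m (k - 1) Copy ts" using k unfolding pad_inv_def ts by auto
    ultimately show ?thesis by blast
  next
    fix r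
    assume q: "q = Pad r" and k: "k = pad_rank m r p1 p2" and p2: "-1 \<le> p2" "p2 < int m"
      and p1: "if r then 0 \<le> p1 \<and> p1 \<le> int m else -1 \<le> p1 \<and> p1 < int m"
    consider (sweep) "0 \<le> p1" "p1 < int m" | (turn) "\<not> (0 \<le> p1 \<and> p1 < int m)" "0 \<le> p2"
      | (stop) "\<not> (0 \<le> p1 \<and> p1 < int m)" "p2 = -1"
      using p2 by linarith
    then show ?thesis
    proof cases
      case sweep
      let ?p1 = "p1 + (if r then 1 else -1)"
      have "scanned (clock_tape m p1) = 1" using sweep by (simp add: clock_tape_scanned)
      then have "pnext (pad_prog M) w (q, i, ts, y) =
          Some (Pad r, i + 1, b # l # clock_tape m ?p1 # clock_tape m p2 # ws, y @ [x])"
        unfolding q ts using x mv(1)[of "if r then Right else Left"] by (simp add: s)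
      moreover have "k - 1 = pad_rank m r ?p1 p2" unfolding k pad_rank_def by simp
      then have "pad_inv m (k - 1) (Pad r) (b # l # clock_tape m ?p1 # clock_tape m p2 # ws)"
        using sweep p2 p1 by (intro pad_inv_PadI) auto
      ultimately show ?thesis by blast
    next
      case turn
      let ?p1 = "p1 + (if r then -1 else 1)"
      have p1': "p1 = (if r then int m else -1)" using turn(1) p1 by (auto split: if_splits)
      have "scanned (clock_tape m p1) = 0" "scanned (clock_tape m p2) = 1"
        using turn p2 by (simp_all add: clock_tape_scanned)
      then have "pnext (pad_prog M) w (q, i, ts, y) =
          Some (Pad (\<not> r), i + 1, b # l # clock_tape m ?p1 # clock_tape m (p2 - 1) # ws, y @ [x])"
        unfolding q ts using x mv(1)[of "if r then Left else Right"] mv(2)[of Left] by (simp add: s)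
      moreover have "k - 1 = pad_rank m (\<not> r) ?p1 (p2 - 1)"
        unfolding k pad_rank_def p1' by (simp add: algebra_simps)
      then have "pad_inv m (k - 1) (Pad (\<not> r)) (b # l # clock_tape m ?p1 # clock_tape m (p2 - 1) # ws)"
        using turn p2 p1' m by (intro pad_inv_PadI) auto
      ultimately show ?thesis by blast
    next
      case stop
      have p1': "p1 = (if r then int m else -1)" using stop(1) p1 by (auto split: if_splits)
      have "scanned (clock_tape m p1) = 0" "scanned (clock_tape m p2) = 0"
        using stop by (simp_all add: clock_tape_scanned)
      then have "pnext (pad_prog M) w (q, i, ts, y) = Some (Copy, i + 1, ts, y @ [x])"
        unfolding q ts using x mv(1)[of Stay] mv(2)[of Stay] by (simp add: s)
      moreover have "k - 1 \<le> 0" unfolding k pad_rank_def p1' stop(2) by simp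
      then have "pad_inv m (k - 1) Copy ts" unfolding pad_inv_def ts by auto
      ultimately show ?thesis by blast
    qed
  qed
qed

lemma pad_end:
  assumes "pad_inv m k q ts" and "in_symbol w i = None"
  shows "pnext (pad_prog M) w (q, i, ts, y) = None"
  using assms unfolding pad_inv_def by auto

lemma pad_inv_Copy: "pad_inv m k q ts \<Longrightarrow> q = Copy \<longleftrightarrow> k \<le> 0"
  unfolding pad_inv_def pad_rank_def
  by (auto split: if_splits) (smt (verit, best) mult_nonneg_nonneg of_nat_0_le_iff)+

lemma pad_reach:
  assumes m: "0 < m" and inv: "pad_inv m k q ts" and "j \<le> length z"
  shows "\<exists>q' ts'. preach (pad_prog M) (x @ z) j (q, int (length x), ts, y)
      (q', int (length x + j), ts', y @ take j z) \<and> pad_inv m (k - int j) q' ts'"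
  using assms(3)
proof (induction j)
  case 0
  then show ?case using inv by auto
next
  case (Suc j)
  then obtain q' ts' where r: "preach (pad_prog M) (x @ z) j (q, int (length x), ts, y)
      (q', int (length x + j), ts', y @ take j z)" and i: "pad_inv m (k - int j) q' ts'" by auto
  have "in_symbol (x @ z) (int (length x + j)) = Some (z ! j)"
    using Suc.prems by (simp add: in_symbol_def nat_add_distrib)
  from pad_step[OF m i this, of M "y @ take j z"] obtain q'' ts''
    where "pnext (pad_prog M) (x @ z) (q', int (length x + j), ts', y @ take j z) =
        Some (q'', int (length x + j) + 1, ts'', (y @ take j z) @ [z ! j])"
      and i': "pad_inv m (k - int j - 1) q'' ts''" by auto
  from preach_snoc[OF r this(1)] i' show ?case
    using Suc.prems by (intro exI conjI) (auto simp: take_Suc_conv_app_nth algebra_simps)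
qed

text \<open>
  At the start of the padding phase both heads are on the last of \<open>m\<close> marks, where the rank is
  \<open>(m + 1) + (m + 1) * m = (m + 1)\<^sup>2\<close>.
\<close>

lemma accept_reach:
  assumes wf: "tm_wf M" and h: "halts M v" and f: "tm_fun M v = Some y"
    and m: "m = \<tau> + 4 * run_time M v + 3"
  shows "\<exists>ts. preach (pad_prog M) w (4 * run_time M v + 3) (stage_conf M v \<tau>)
      (Pad False, int (length v), ts, y) \<and> pad_inv m ((int m + 1)\<^sup>2) (Pad False) ts"
proof -
  let ?r = "run_time M v"
  let ?t = "\<tau> + 3 * ?r + 2"
  note nh = not_halted_before_run_time[of _ M v] and hr = halted_run_time[OF h]
  have y: "out (run M v ?r) = y" using tm_fun_halted[OF hr] f by (simp split: if_splits)
  have 1: "preach (pad_prog M) w (3 * ?r + 2) (stage_conf M v \<tau>) (sim_conf M True v ?t 0)"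
    using test_reach[OF wf h, of w \<tau>] f by (simp add: sim_conf_0)
  have 2: "preach (pad_prog M) w ?r (sim_conf M True v ?t 0) (sim_conf M True v (?t + ?r) ?r)"
    using sim_reach[OF nh] by blast
  define ts where "ts = buf_tape v (in_pos (run M v ?r)) # log_tape (sim_log M v ?r) (int ?r) #
      clock_tape m (int m - 1) # clock_tape m (int m - 1) # work (run M v ?r)"
  have "m = Suc (?t + ?r)" unfolding m by simp
  then have tk: "act (clock_tape (?t + ?r) (int (?t + ?r))) (Suc 0, Stay) = clock_tape m (int m - 1)"
    using clock_tape_ticks(2)[of "?t + ?r"] by simp
  have "pnext (pad_prog M) w (sim_conf M True v (?t + ?r) ?r) = Some (Pad False, int (length v), ts, y)"
    using hr unfolding halted_def transition_sim_key sim_conf_def search_conf_def ts_def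
    by (simp add: tape_simps tk[simplified] act_keep_1 sim_key_def y)
  from preach_snoc[OF preach_trans[OF 1 2] this]
  have "preach (pad_prog M) w (4 * ?r + 3) (stage_conf M v \<tau>) (Pad False, int (length v), ts, y)"
    by (simp add: algebra_simps eval_nat_numeral)
  moreover have "pad_rank m False (int m - 1) (int m - 1) = (int m + 1)\<^sup>2"
    unfolding pad_rank_def by (simp add: algebra_simps power2_eq_square)
  then have "pad_inv m ((int m + 1)\<^sup>2) (Pad False) ts"
    unfolding ts_def using m by (intro pad_inv_PadI) auto
  ultimately show ?thesis by blast
qed

lemma search_reach:
  assumes wf: "tm_wf M" and h: "\<And>v. halts M v"
    and "n \<le> length w" "\<And>i. i < n \<Longrightarrow> tm_fun M (take i w) = None"
  shows "preach (pad_prog M) w (\<Sum>i<n. reject_cost M (take i w)) (stage_conf M [] 0)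
    (stage_conf M (take n w) (\<Sum>i<n. reject_cost M (take i w)))"
  using assms(3,4)
proof (induction n)
  case 0
  then show ?case by simp
next
  case (Suc n)
  have "in_symbol w (int (length (take n w))) = Some (w ! n)"
    using Suc.prems(1) by (simp add: in_symbol_def)
  from preach_trans[OF Suc.IH reject_reach[OF wf h _ this]] show ?case
    using Suc.prems by (simp add: take_Suc_conv_app_nth)
qed

lemma pad_init:
  "stage_conf M [] 0 = (Sim False (start M), 0, replicate (4 + num_tapes M) (\<lambda>_. 0, 0), [])"
  by (simp add: scan_conf_def search_conf_def buf_tape_def log_tape_def clock_tape_def
      in_symbol_def fun_eq_iff eval_nat_numeral)

section \<open>Padded morphisms\<close>

definition pad_length :: "tm \<Rightarrow> word \<Rightarrow> nat" where
  "pad_length M x = (search_time M x + 1)\<^sup>2"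

lemma length_le_search_time: "length x \<le> search_time M x"
proof -
  have "length x = (\<Sum>i<length x. 1)" by simp
  also have "\<dots> \<le> (\<Sum>i<length x. reject_cost M (take i x))"
    by (rule sum_mono) (simp add: reject_cost_def)
  finally show ?thesis unfolding search_time_def by simp
qed

lemma output_le_search_time:
  assumes "tm_fun M x = Some y"
  shows "length y \<le> search_time M x"
proof -
  have "length y \<le> run_time M x"
    using assms out_run_length[of M x "run_time M x"] unfolding tm_fun_def by (auto split: if_splits)
  then show ?thesis unfolding search_time_def by simp
qed

lemma min_words_take:
  assumes "x \<in> min_words (dom f)" "i < length x"
  shows "f (take i x) = None"
proof -
  have "strict_prefix (take i x) x"
    using assms(2) by (metis length_take min.absorb4 nat_less_le prefix_order.less_le take_is_prefix)
  then show ?thesis using assms(1) unfolding min_words_def by blast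
qed

definition padding_machine :: "tm \<Rightarrow> nat \<Rightarrow> tm" where
  "padding_machine M B =
     compile (pad_prog M) (pad_states B) (B + 3) (4 + num_tapes M) (Sim False (start M)) Copy"

lemma pad_accepting_run:
  assumes wf: "tm_wf M" and h: "\<And>v. halts M v"
    and x: "x \<in> min_words (dom (tm_fun M))" and f: "tm_fun M x = Some y" and j: "j \<le> length z"
  shows "\<exists>q ts. preach (pad_prog M) (x @ z) (search_time M x + j) (stage_conf M [] 0)
      (q, int (length x + j), ts, y @ take j z) \<and> (q = Copy \<longleftrightarrow> pad_length M x \<le> j) \<and>
      (j = length z \<longrightarrow> pnext (pad_prog M) (x @ z) (q, int (length x + j), ts, y @ take j z) = None)"
proof -
  let ?s = "\<Sum>i<length x. reject_cost M (take i x)" and ?m = "search_time M x"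
  have s: "preach (pad_prog M) (x @ z) ?s (stage_conf M [] 0) (stage_conf M x ?s)"
    using search_reach[OF wf h, of "length x" "x @ z"] min_words_take[OF x] by simp
  have m: "?m = ?s + 4 * run_time M x + 3" by (simp add: search_time_def)
  obtain ts where a: "preach (pad_prog M) (x @ z) (4 * run_time M x + 3) (stage_conf M x ?s)
      (Pad False, int (length x), ts, y)" and i: "pad_inv ?m ((int ?m + 1)\<^sup>2) (Pad False) ts"
    using accept_reach[OF wf h f m] by blast
  have m0: "0 < ?m" unfolding m by simp
  obtain q ts' where r: "preach (pad_prog M) (x @ z) j (Pad False, int (length x), ts, y)
      (q, int (length x + j), ts', y @ take j z)"
    and i': "pad_inv ?m ((int ?m + 1)\<^sup>2 - int j) q ts'"
    using pad_reach[OF m0 i j] by blast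
  have "preach (pad_prog M) (x @ z) (?m + j) (stage_conf M [] 0) (q, int (length x + j), ts', y @ take j z)"
    using preach_trans[OF preach_trans[OF s a] r] unfolding m by (simp add: add.assoc del: preach.simps)
  moreover have "(int ?m + 1)\<^sup>2 = int (pad_length M x)" by (simp add: pad_length_def)
  then have "q = Copy \<longleftrightarrow> pad_length M x \<le> j" using pad_inv_Copy[OF i'] by simp
  moreover have "j = length z \<longrightarrow> pnext (pad_prog M) (x @ z) (q, int (length x + j), ts', y @ take j z) = None"
    using pad_end[OF i'] by (simp add: in_symbol_def del: pnext.simps)
  ultimately show ?thesis by blast
qed

lemma pad_rejecting_run:
  assumes wf: "tm_wf M" and h: "\<And>v. halts M v" and w: "w \<notin> dom (tm_fun M)"
    and rim: "right_ideal_morphism (tm_fun M)"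
  shows "\<exists>n q i ts y. n \<le> (\<Sum>i<Suc (length w). reject_cost M (take i w)) \<and>
      preach (pad_prog M) w n (stage_conf M [] 0) (q, i, ts, y) \<and> q \<noteq> Copy \<and>
      pnext (pad_prog M) w (q, i, ts, y) = None"
proof -
  let ?s = "\<Sum>i<length w. reject_cost M (take i w)"
  have none: "tm_fun M (take i w) = None" for i
    using rim_dom_append[OF rim, of "take i w" "drop i w"] w by auto
  have "preach (pad_prog M) w ?s (stage_conf M [] 0) (stage_conf M w ?s)"
    using search_reach[OF wf h, of "length w" w] none by simp
  moreover obtain c \<tau>' where c: "c \<le> reject_cost M w"
    and e: "preach (pad_prog M) w c (stage_conf M w ?s) (scan_conf M Scan w (int (length w)) \<tau>')"
      "pnext (pad_prog M) w (scan_conf M Scan w (int (length w)) \<tau>') = None"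
    using reject_end[OF wf h, of w w ?s] w by (auto simp: in_symbol_def)
  ultimately have r: "preach (pad_prog M) w (?s + c) (stage_conf M [] 0) (scan_conf M Scan w (int (length w)) \<tau>')"
    using preach_trans by blast
  obtain i ts y where "scan_conf M Scan w (int (length w)) \<tau>' = (Scan, i, ts, y)"
    unfolding scan_conf_def search_conf_def by blast
  then show ?thesis using r e(2) c
    by (intro exI[of _ "?s + c"] exI[of _ Scan] exI[of _ i] exI[of _ ts] exI[of _ y]) (simp del: preach.simps pnext.simps)
qed

text \<open>
  The behaviour of the padding machine on an arbitrary input. Either the input has a prefix in the prefix code
  of the given morphism, and the position and the output are known for every time after that prefix has been processed, or it has
  none and is rejected.
\<close>

lemma padding_machine:
  assumes wf: "tm_wf M" and h: "\<And>v. halts M v" and rim: "right_ideal_morphism (tm_fun M)"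
    and B: "tm_bound M B"
  defines "P \<equiv> padding_machine M B"
  shows pad_wf: "tm_wf P" and pad_no_left: "no_left P"
    and pad_accept: "\<And>x z y. x \<in> min_words (dom (tm_fun M)) \<Longrightarrow> tm_fun M x = Some y \<Longrightarrow>
      halted P (x @ z) (run P (x @ z) (search_time M x + length z)) \<and>
      tm_fun P (x @ z) = (if pad_length M x \<le> length z then Some (y @ z) else None)"
    and pad_reject: "\<And>w. w \<notin> dom (tm_fun M) \<Longrightarrow>
      (\<exists>n \<le> \<Sum>i<Suc (length w). reject_cost M (take i w). halted P w (run P w n)) \<and> tm_fun P w = None"
    and pad_position: "\<And>x z y j. x \<in> min_words (dom (tm_fun M)) \<Longrightarrow> tm_fun M x = Some y \<Longrightarrow>
      j \<le> length z \<Longrightarrow> in_pos (run P (x @ z) (search_time M x + j)) = int (length x + j) \<and>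
      out (run P (x @ z) (search_time M x + j)) = y @ take j z"
proof -
  interpret P: program "pad_prog M" "pad_states B" "B + 3" "4 + num_tapes M" "Sim False (start M)" Copy
    by (rule pad_program[OF wf B])
  have P: "P = P.machine" unfolding P_def padding_machine_def ..
  have init: "stage_conf M [] 0 = P.pinit" by (rule pad_init)
  show "tm_wf P" unfolding P by (rule P.tm_wf_machine)
  show "no_left P" unfolding P by (rule P.no_left_machine) (rule pad_prog_no_left)
  show "halted P (x @ z) (run P (x @ z) (search_time M x + length z)) \<and>
      tm_fun P (x @ z) = (if pad_length M x \<le> length z then Some (y @ z) else None)"
    if x: "x \<in> min_words (dom (tm_fun M))" and f: "tm_fun M x = Some y" for x z y
  proof -
    obtain q ts where q: "preach (pad_prog M) (x @ z) (search_time M x + length z) P.pinit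
        (q, int (length x + length z), ts, y @ z)" "q = Copy \<longleftrightarrow> pad_length M x \<le> length z"
      "pnext (pad_prog M) (x @ z) (q, int (length x + length z), ts, y @ z) = None"
      using pad_accepting_run[OF wf h x f order.refl] unfolding init by (metis take_all order.refl)
    show ?thesis unfolding P
      using P.halted_preach[OF q(1,3)] P.tm_fun_preach[OF q(1,3)] q(2) by simp
  qed
  show "(\<exists>n \<le> \<Sum>i<Suc (length w). reject_cost M (take i w). halted P w (run P w n)) \<and> tm_fun P w = None"
    if w: "w \<notin> dom (tm_fun M)" for w
  proof -
    obtain n q i ts y where n: "n \<le> (\<Sum>i<Suc (length w). reject_cost M (take i w))"
      and q: "preach (pad_prog M) w n P.pinit (q, i, ts, y)" "pnext (pad_prog M) w (q, i, ts, y) = None"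
        "q \<noteq> Copy"
      using pad_rejecting_run[OF wf h w rim] unfolding init by blast
    show ?thesis unfolding P
      using P.halted_preach[OF q(1,2)] P.tm_fun_preach[OF q(1,2)] q(3) n by auto
  qed
  show "in_pos (run P (x @ z) (search_time M x + j)) = int (length x + j) \<and>
      out (run P (x @ z) (search_time M x + j)) = y @ take j z"
    if x: "x \<in> min_words (dom (tm_fun M))" and f: "tm_fun M x = Some y" and j: "j \<le> length z" for x z y j
  proof -
    obtain q ts where "preach (pad_prog M) (x @ z) (search_time M x + j) P.pinit
        (q, int (length x + j), ts, y @ take j z)"
      using pad_accepting_run[OF wf h x f j] unfolding init by blast
    from P.run_preach[OF this] show ?thesis unfolding P by simp
  qed
qed

text \<open>
  The time bound by \<open>n + sqrt n\<close> concerns accepted inputs, and the polynomial bound all inputs. The latter places the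
  morphism, and later its composites, in \<open>RM_P\<close> without a second machine. An explicit error term avoids the
  manipulation of unspecified functions \<open>o(n)\<close> under composition.
\<close>

definition fast_machine :: "tm \<Rightarrow> bool" where
  "fast_machine M \<longleftrightarrow> RM_machine M \<and> (\<exists>p :: nat poly. \<forall>x. halts M x \<and> run_time M x \<le> poly p (length x)) \<and>
     (\<forall>x y. tm_fun M x = Some y \<longrightarrow>
        length y \<le> length x + sqrt (length x) \<and> length x \<le> length y + sqrt (length y) \<and>
        run_time M x \<le> length x + sqrt (length x))"

lemma sum_reject_cost_le:
  assumes "\<And>v. run_time M v \<le> poly p (length v)" and "n \<le> Suc (length w)"
  shows "(\<Sum>i<n. reject_cost M (take i w)) \<le> n * (3 * poly p (length w) + 2 * length w + 4)"
proof -
  have "reject_cost M (take i w) \<le> 3 * poly p (length w) + 2 * length w + 4" for i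
  proof -
    have "run_time M (take i w) \<le> poly p (length (take i w))" by (rule assms(1))
    also have "\<dots> \<le> poly p (length w)" by (rule nat_poly_mono) simp
    finally show ?thesis unfolding reject_cost_def by simp
  qed
  from sum_mono[of "{..<n}", OF this] show ?thesis by simp
qed

text \<open>
  The padded morphism \<open>g\<close> is the restriction of \<open>F\<close> to the words \<open>x @ z\<close> with \<open>x\<close> minimal in \<open>dom F\<close> and \<open>z\<close> at least as long as the
  square of \<open>search_time M x + 1\<close>. The minimal words of \<open>dom g\<close> are those with \<open>z\<close> of exactly this length, so they exceed \<open>x\<close> by a
  polynomial amount. On an accepted input the search time, and with it \<open>length x\<close> and \<open>length (F x)\<close>, is at most the square root of the
  length of the input and of the output.
\<close>

lemma padded_equivalent:
  assumes F: "F \<in> RM_P"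
  obtains P where "fast_machine P" "right_ideal_morphism (tm_fun P)" "poly_equiv F (tm_fun P)"
proof -
  have rim: "right_ideal_morphism F" using F unfolding RM_P_def by simp
  obtain M p where wf: "tm_wf M" and MF: "tm_fun M = F" and hp: "\<And>x. halts M x \<and> run_time M x \<le> poly p (length x)"
    using F unfolding RM_P_def poly_time_computable_def by blast
  obtain B where B: "tm_bound M B" using tm_bound_exists[OF wf] .
  define P where "P = padding_machine M B"
  have h: "\<And>v. halts M v" and rt: "\<And>v. run_time M v \<le> poly p (length v)" using hp by auto
  note pm = padding_machine[OF wf h _ B, unfolded MF, OF rim, folded P_def]
  let ?s = "search_time M" and ?N = "pad_length M"
  define g where "g = tm_fun P"

  have g_iff: "g u = Some v \<longleftrightarrow>
      (\<exists>x z. x \<in> min_words (dom F) \<and> u = x @ z \<and> ?N x \<le> length z \<and> F u = Some v)" for u v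
  proof
    assume guv: "g u = Some v"
    then have "u \<in> dom F" using pm(4)[of u] unfolding g_def by auto
    then obtain x where x: "x \<in> min_words (dom F)" "prefix x u" using min_words_prefix by metis
    then obtain z y where z: "u = x @ z" and y: "F x = Some y" unfolding prefix_def min_words_def by blast
    have "?N x \<le> length z" "v = y @ z"
      using pm(3)[OF x(1) y, of z] guv unfolding g_def z by (auto split: if_splits)
    then show "\<exists>x z. x \<in> min_words (dom F) \<and> u = x @ z \<and> ?N x \<le> length z \<and> F u = Some v"
      using x z rim_append[OF rim y, of z] by blast
  next
    assume "\<exists>x z. x \<in> min_words (dom F) \<and> u = x @ z \<and> ?N x \<le> length z \<and> F u = Some v"
    then obtain x z where x: "x \<in> min_words (dom F)" "u = x @ z" "?N x \<le> length z" "F u = Some v" by blast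
    then obtain y where y: "F x = Some y" unfolding min_words_def by auto
    then have "v = y @ z" using rim_append[OF rim y, of z] x by simp
    then show "g u = Some v" using pm(3)[OF x(1) y, of z] x unfolding g_def by simp
  qed
  have g_rim: "right_ideal_morphism g"
  proof (rule rimI)
    fix u v w assume "g u = Some v"
    then obtain x z where x: "x \<in> min_words (dom F)" "u = x @ z" "?N x \<le> length z" "F u = Some v"
      unfolding g_iff by blast
    then have "F (u @ w) = Some (v @ w)" using rim_append[OF rim] by blast
    then show "g (u @ w) = Some (v @ w)" unfolding g_iff using x
      by (intro exI[of _ x] exI[of _ "z @ w"]) simp
  qed

  define S where "S = [:1, 1:] * ([:4, 2:] + smult 3 p) + smult 4 p + [:3:]"
  have S: "?s x \<le> poly S (length x)" for x
  proof -
    have "(\<Sum>i<length x. reject_cost M (take i x)) \<le> length x * (3 * poly p (length x) + 2 * length x + 4)"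
      by (rule sum_reject_cost_le[OF rt]) simp
    then show ?thesis using rt[of x] unfolding S_def search_time_def by (simp add: algebra_simps)
  qed

  have halt: "\<exists>n \<le> poly (S + [:0, 1:]) (length w). halted P w (run P w n)" for w
  proof (cases "w \<in> dom F")
    case True
    then obtain x where x: "x \<in> min_words (dom F)" "prefix x w" using min_words_prefix by metis
    then obtain z y where z: "w = x @ z" and y: "F x = Some y" unfolding prefix_def min_words_def by blast
    have "?s x \<le> poly S (length w)"
      using S[of x] nat_poly_mono[of "length x" "length w" S] unfolding z by simp
    then show ?thesis using pm(3)[OF x(1) y, of z] unfolding z by (intro exI[of _ "?s x + length z"]) simp
  next
    case False
    have "(\<Sum>i<Suc (length w). reject_cost M (take i w)) \<le>
        Suc (length w) * (3 * poly p (length w) + 2 * length w + 4)"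
      by (rule sum_reject_cost_le[OF rt]) simp
    also have "\<dots> \<le> poly (S + [:0, 1:]) (length w)" unfolding S_def by (simp add: algebra_simps)
    finally have le: "(\<Sum>i<Suc (length w). reject_cost M (take i w)) \<le> poly (S + [:0, 1:]) (length w)" .
    obtain n where "n \<le> (\<Sum>i<Suc (length w). reject_cost M (take i w))" "halted P w (run P w n)"
      using pm(4)[OF False] by blast
    then show ?thesis using le by (intro exI[of _ n] conjI) linarith+
  qed

  have root: "real (?s x) \<le> sqrt k" if "?N x \<le> k" for x k
  proof -
    have "(?s x)\<^sup>2 \<le> (?s x + 1)\<^sup>2" by (rule power_mono) auto
    also have "\<dots> \<le> k" using that unfolding pad_length_def .
    finally have "(real (?s x))\<^sup>2 \<le> real k" by (metis of_nat_le_iff of_nat_power)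
    then show ?thesis by (rule real_le_rsqrt)
  qed

  have "fast_machine P"
    unfolding fast_machine_def
  proof (intro conjI allI impI)
    show "\<exists>p :: nat poly. \<forall>x. halts P x \<and> run_time P x \<le> poly p (length x)"
    proof (intro exI allI conjI)
      fix w
      obtain n where n: "n \<le> poly (S + [:0, 1:]) (length w)" "halted P w (run P w n)"
        using halt by blast
      show "halts P w" using n(2) by (rule haltsI)
      show "run_time P w \<le> poly (S + [:0, 1:]) (length w)" using run_time_le[OF n(2)] n(1) by simp
    qed
  next
    show "RM_machine P"
      unfolding RM_machine_def
    proof (intro conjI pm(1) pm(2)[unfolded no_left_def] allI impI)
      fix u v w n
      assume uv: "tm_fun P u = Some v" and nh: "\<not> halted P (u @ w) (run P (u @ w) n)"
        and ge: "int (length u) \<le> in_pos (run P (u @ w) n)"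
      obtain x z where x: "x \<in> min_words (dom F)" "u = x @ z" "?N x \<le> length z" "F u = Some v"
        using uv g_iff unfolding g_def by blast
      then obtain y where y: "F x = Some y" unfolding min_words_def by auto
      have v: "v = y @ z" using rim_append[OF rim y, of z] x by simp
      have z: "z \<noteq> []" using x(3) unfolding pad_length_def by auto
      have "n < ?s x + length (z @ w)"
        using pm(3)[OF x(1) y, of "z @ w"] nh unfolding x(2)
        by (metis append.assoc linorder_not_less run_halted_le)
      \<comment> \<open>As \<open>z\<close> is not empty, the input head is still before the end of \<open>u\<close> while the search goes on.\<close>
      moreover have "?s x \<le> n"
      proof (rule ccontr)
        assume "\<not> ?s x \<le> n"
        then have "in_pos (run P (u @ w) n) \<le> in_pos (run P (u @ w) (?s x))"
          by (intro in_pos_run_mono pm(2)) simp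
        also have "\<dots> = int (length x)" using pm(5)[OF x(1) y, of 0 "z @ w"] unfolding x(2) by simp
        finally have "int (length (x @ z)) \<le> int (length x)" using ge unfolding x(2) by linarith
        then show False using z by simp
      qed
      ultimately obtain j where n: "n = ?s x + j" and j: "j \<le> length (z @ w)"
        by (metis add_less_cancel_left le_Suc_ex less_imp_le)
      have run: "in_pos (run P (u @ w) n) = int (length x + j)" "out (run P (u @ w) n) = y @ take j (z @ w)"
        using pm(5)[OF x(1) y j] unfolding x(2) n by auto
      have "length z \<le> j" using ge run(1) unfolding x(2) by simp
      then show "prefix v (out (run P (u @ w) n))" unfolding run(2) v by simp
    qed
  next
    fix u v assume uv: "tm_fun P u = Some v"
    then obtain x z where x: "x \<in> min_words (dom F)" "u = x @ z" "?N x \<le> length z" "F u = Some v"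
      using g_iff unfolding g_def by blast
    then obtain y where y: "F x = Some y" unfolding min_words_def by auto
    have v: "v = y @ z" using rim_append[OF rim y, of z] x by simp
    have ly: "length y \<le> ?s x" using output_le_search_time[of M] MF y by blast
    have lx: "length x \<le> ?s x" by (rule length_le_search_time)
    have "?N x \<le> length u" "?N x \<le> length v" using x(2,3) v by auto
    then have ru: "real (?s x) \<le> sqrt (length u)" and rv: "real (?s x) \<le> sqrt (length v)"
      using root by blast+
    have "run_time P u \<le> ?s x + length z" using pm(3)[OF x(1) y, of z] run_time_le unfolding x(2) by blast
    then show "real (run_time P u) \<le> length u + sqrt (length u)" using ru unfolding x(2) by simp
    show "real (length v) \<le> length u + sqrt (length u)" using ly ru unfolding v x(2) by simp
    show "real (length u) \<le> length v + sqrt (length v)" using lx rv unfolding v x(2) by simp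
  qed

  moreover have "poly_equiv F g"
    unfolding poly_equiv_iff[OF rim g_rim]
  proof (intro conjI ballI)
    have gF: "dom g \<subseteq> dom F" using g_iff by blast
    show "cofinal_in g F" unfolding cofinal_in_def using gF by (metis append_Nil2 subsetD)
    show "cofinal_in F g"
      unfolding cofinal_in_def
    proof
      fix u assume u: "u \<in> dom F"
      then obtain x z where x: "x \<in> min_words (dom F)" "u = x @ z" using min_words_prefix unfolding prefix_def by metis
      let ?w = "replicate (?N x) True"
      obtain v where "F (u @ ?w) = Some v" using rim_dom_append[OF rim u] by blast
      then have "g (u @ ?w) = Some v" unfolding g_iff using x
        by (intro exI[of _ x] exI[of _ "z @ ?w"]) simp
      then have "u @ ?w \<in> dom g" by blast
      then show "\<exists>w. u @ w \<in> dom g" by blast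
    qed
    show "F u = g u" if "u \<in> dom F \<inter> dom g" for u
    proof -
      obtain v where v: "g u = Some v" using \<open>u \<in> dom F \<inter> dom g\<close> by blast
      then have "F u = Some v" unfolding g_iff by blast
      then show ?thesis using v by simp
    qed
    have min_g: "\<exists>z. u = x @ z \<and> length z = ?N x"
      if x: "x \<in> min_words (dom F)" and u: "u \<in> min_words (dom g)" and c: "pref_comparable x u" for x u
    proof -
      obtain v where "g u = Some v" using u unfolding min_words_def by blast
      then obtain x' z where x': "x' \<in> min_words (dom F)" "u = x' @ z" "?N x' \<le> length z"
        unfolding g_iff by blast
      have "pref_comparable x x'"
        using c x'(2) comparable_of_common_extension[of x u x'] unfolding pref_comparable_def
        by (metis prefixI prefix_order.trans)
      then have xx: "x = x'" using min_words_comparable x x'(1) by blast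
      have "length z \<le> ?N x"
      proof (rule ccontr)
        assume lt: "\<not> length z \<le> ?N x"
        let ?u = "x @ take (?N x) z"
        obtain v where "F ?u = Some v" using x rim_dom_append[OF rim] unfolding min_words_def by blast
        then have "g ?u = Some v" unfolding g_iff using x lt
          by (intro exI[of _ x] exI[of _ "take (?N x) z"]) simp
        then have "?u \<in> dom g" by blast
        moreover have "strict_prefix ?u u" unfolding x'(2) xx[symmetric] using lt
          by (metis le_refl length_take min.absorb4 not_le prefix_order.less_le same_prefix_prefix same_append_eq take_is_prefix)
        ultimately show False using u unfolding min_words_def by blast
      qed
      then show ?thesis using x' xx by auto
    qed
    let ?T = "[:0, 1:] + (S + [:1:])\<^sup>2"
    have "length u \<le> poly ?T (length x)"
      if xu: "x \<in> min_words (dom F)" "u \<in> min_words (dom g)" "pref_comparable x u" for x u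
    proof -
      obtain z where z: "u = x @ z" "length z = ?N x" using min_g[OF xu] by blast
      have "?N x \<le> (poly S (length x) + 1)\<^sup>2" unfolding pad_length_def using S[of x] by (intro power_mono) auto
      then show ?thesis using z by (simp)
    qed
    then show "poly_bounded F g" unfolding poly_bounded_def by blast
    have "length x \<le> poly [:0, 1:] (length u)"
      if "u \<in> min_words (dom g)" "x \<in> min_words (dom F)" "pref_comparable u x" for x u
      using min_g[of x u] that pref_comparable_sym by fastforce
    then show "poly_bounded g F" unfolding poly_bounded_def by blast
  qed
  ultimately show ?thesis using that[of P] g_rim unfolding g_def by blast
qed

section \<open>Composition of one-way machines\<close>

text \<open>
  The composition machine runs \<open>M2\<close> on the input and \<open>M1\<close> on the output of \<open>M2\<close>. It never stores more than one letter in
  between: \<open>M2\<close> moves only while \<open>M1\<close> waits for a letter, and the letter that \<open>M2\<close> writes is handed to \<open>M1\<close> in the same step.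
  State \<open>Hold l adv\<close> means that \<open>M1\<close> has not yet moved past the letter \<open>l\<close>.

  The flag \<open>adv\<close> records a pending move of the input head. If the head were allowed to move when \<open>M2\<close> writes \<open>l\<close>, it could stand
  on a letter behind \<open>x\<close> while \<open>M1\<close> is still producing the image of \<open>x\<close>, contrary to the reading condition of
  \<open>RM_machine\<close>. So this move is delayed until \<open>M1\<close> moves past \<open>l\<close>.
\<close>

datatype feed = Wait | Hold bool bool

instance feed :: countable by countable_datatype

lemma finite_feed: "finite (UNIV :: feed set)"
proof -
  have "(UNIV :: feed set) \<subseteq> insert Wait ((\<lambda>(l, d). Hold l d) ` UNIV)"
    using feed.exhaust by (auto simp: image_iff)
  then show ?thesis by (rule finite_subset) simp
qed

definition forward :: "bool \<Rightarrow> move" where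
  "forward adv = (if adv then Right else Stay)"

type_synonym comp_state = "nat \<times> nat \<times> feed"

fun pass_on :: "nat \<Rightarrow> bool \<Rightarrow> bool \<Rightarrow> (nat \<times> move) list \<Rightarrow>
    nat \<times> move \<times> bool option \<times> (nat \<times> move) list \<Rightarrow>
    comp_state \<times> move \<times> bool option \<times> (nat \<times> move) list" where
  "pass_on q2 l adv acts2 (q1, d1, b1, acts1) =
    (if d1 = Right then ((q1, q2, Wait), forward adv, b1, acts2 @ acts1)
     else ((q1, q2, Hold l adv), Stay, b1, acts2 @ acts1))"

text \<open>
  When \<open>M2\<close> has halted in its accept state, \<open>M1\<close> is at the end of its input and sees blanks. If \<open>M1\<close> halts on a letter at the very moment
  it is written, the machine still changes to state \<open>Hold\<close>, where it then halts: stopping in state \<open>Wait\<close> could be taken for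
  acceptance.
\<close>

fun comp_step :: "tm \<Rightarrow> tm \<Rightarrow> comp_state \<Rightarrow> bool option \<Rightarrow> nat list \<Rightarrow> nat list \<Rightarrow>
    (comp_state \<times> move \<times> bool option \<times> (nat \<times> move) list) option" where
  "comp_step M1 M2 (q1, q2, Wait) a ss2 ss1 =
    (case delta M2 (q2, a, ss2) of
       None \<Rightarrow>
         if q2 = accept M2
         then map_option (\<lambda>(q1', d1, b1, acts1). ((q1', q2, Wait), Stay, b1, keep ss2 @ acts1))
           (delta M1 (q1, None, ss1))
         else None
     | Some (q2', d2, b, acts2) \<Rightarrow>
         (case b of
            None \<Rightarrow> Some ((q1, q2', Wait), d2, None, acts2 @ keep ss1)
          | Some l \<Rightarrow>
              (case delta M1 (q1, Some l, ss1) of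
                 None \<Rightarrow> Some ((q1, q2', Hold l (d2 = Right)), Stay, None, acts2 @ keep ss1)
               | Some r \<Rightarrow> Some (pass_on q2' l (d2 = Right) acts2 r))))"
| "comp_step M1 M2 (q1, q2, Hold l adv) a ss2 ss1 =
    map_option (pass_on q2 l adv (keep ss2)) (delta M1 (q1, Some l, ss1))"

definition comp_prog :: "tm \<Rightarrow> tm \<Rightarrow> comp_state prog" where
  "comp_prog M1 M2 s a ss = comp_step M1 M2 s a (take (num_tapes M2) ss) (drop (num_tapes M2) ss)"

lemma comp_program:
  assumes wf: "tm_wf M1" "tm_wf M2" and B: "tm_bound M1 B" "tm_bound M2 B"
  shows "program (comp_prog M1 M2) ({..<B} \<times> {..<B} \<times> UNIV) B (num_tapes M2 + num_tapes M1)
    (start M1, start M2, Wait)"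
proof
  show "finite ({..<B} \<times> {..<B} \<times> (UNIV :: feed set))" using finite_feed by simp
  show "(start M1, start M2, Wait) \<in> {..<B} \<times> {..<B} \<times> UNIV" "0 < B"
    using B by (auto simp: tm_bound_def)
  fix s a ss s' d b acts
  assume s: "s \<in> {..<B} \<times> {..<B} \<times> (UNIV :: feed set)" and ss: "set ss \<subseteq> {..<B}"
    "length ss = num_tapes M2 + num_tapes M1" and t: "comp_prog M1 M2 s a ss = Some (s', d, b, acts)"
  have bd: "q' < B \<and> length as = num_tapes M \<and> fst ` set as \<subseteq> {..<B}"
    if "delta M (q, e, us) = Some (q', f, g, as)" "tm_wf M" "tm_bound M B" for M q e us q' f g as
    using that unfolding tm_wf_def tm_bound_def by blast
  note bd1 = bd[OF _ wf(1) B(1)] and bd2 = bd[OF _ wf(2) B(2)]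
  define ss1 ss2 where "ss1 = drop (num_tapes M2) ss" and "ss2 = take (num_tapes M2) ss"
  have l: "length ss1 = num_tapes M1" "length ss2 = num_tapes M2"
    using ss(2) unfolding ss1_def ss2_def by auto
  have sy: "fst ` set (keep ss1) \<subseteq> {..<B}" "fst ` set (keep ss2) \<subseteq> {..<B}"
    using ss(1) set_drop_subset[of "num_tapes M2" ss] set_take_subset[of "num_tapes M2" ss]
    unfolding ss1_def ss2_def keep_symbols by blast+
  obtain q1 q2 h where sh: "s = (q1, q2, h)" by (metis prod_cases3)
  have q: "q1 < B" "q2 < B" using s sh by auto
  note t' = t[unfolded comp_prog_def, folded ss1_def ss2_def, unfolded sh]
  have app: "length (as @ cs) = num_tapes M2 + num_tapes M1 \<and> fst ` set (as @ cs) \<subseteq> {..<B}"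
    if "length as = num_tapes M2" "length cs = num_tapes M1" "fst ` set as \<subseteq> {..<B}" "fst ` set cs \<subseteq> {..<B}"
    for as cs :: "(nat \<times> move) list"
    using that by auto
  have pass: "p \<in> {..<B} \<times> {..<B} \<times> UNIV \<and> length cs = num_tapes M2 + num_tapes M1 \<and> fst ` set cs \<subseteq> {..<B}"
    if "pass_on r2 l d2 as r = (p, e, f, cs)" "delta M1 (q1, Some l, ss1) = Some r" "r2 < B"
      "length as = num_tapes M2" "fst ` set as \<subseteq> {..<B}" for r2 l d2 as r p e f cs
  proof -
    obtain q' g h' as' where r: "r = (q', g, h', as')" by (metis prod_cases4)
    have "length (as @ as') = num_tapes M2 + num_tapes M1 \<and> fst ` set (as @ as') \<subseteq> {..<B}"
      using bd1[OF that(2)[unfolded r]] app[OF that(4) _ that(5)] by blast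
    moreover have "cs = as @ as'" "p \<in> {..<B} \<times> {..<B} \<times> UNIV"
      using that(1,3) bd1[OF that(2)[unfolded r]] unfolding r by (auto split: if_splits)
    ultimately show ?thesis by simp
  qed
  show "s' \<in> {..<B} \<times> {..<B} \<times> UNIV \<and> length acts = num_tapes M2 + num_tapes M1 \<and> fst ` set acts \<subseteq> {..<B}"
  proof (cases h)
    case (Hold l' d2)
    then obtain r where r: "delta M1 (q1, Some l', ss1) = Some r" "pass_on q2 l' d2 (keep ss2) r = (s', d, b, acts)"
      using t' by auto
    show ?thesis using pass[OF r(2,1) q(2) _ sy(2)] l by simp
  next
    case Wait
    show ?thesis
    proof (cases "delta M2 (q2, a, ss2)")
      case None
      then obtain q1' d1 b1 acts1 where r: "delta M1 (q1, None, ss1) = Some (q1', d1, b1, acts1)"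
        "s' = (q1', q2, Wait)" "acts = keep ss2 @ acts1"
        using t' Wait by (auto split: if_splits)
      show ?thesis using bd1[OF r(1)] app[of "keep ss2" acts1] q l sy unfolding r(2,3) by auto
    next
      case (Some k)
      then obtain q2' d2 b2 acts2 where k: "delta M2 (q2, a, ss2) = Some (q2', d2, b2, acts2)" by (metis prod_cases4)
      show ?thesis
      proof (cases b2)
        case None
        then have "s' = (q1, q2', Wait)" "acts = acts2 @ keep ss1" using t' Wait k by auto
        then show ?thesis using bd2[OF k] app[of acts2 "keep ss1"] q l sy by auto
      next
        case (Some l')
        show ?thesis
        proof (cases "delta M1 (q1, Some l', ss1)")
          case None
          then have "s' = (q1, q2', Hold l' (d2 = Right))" "acts = acts2 @ keep ss1" using t' Wait k Some by auto
          then show ?thesis using bd2[OF k] app[of acts2 "keep ss1"] q l sy by auto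
        next
          case r: (Some r)
          then have "pass_on q2' l' (d2 = Right) acts2 r = (s', d, b, acts)" using t' Wait k Some by auto
          from pass[OF this r] show ?thesis using bd2[OF k] by auto
        qed
      qed
    qed
  qed
qed

lemma comp_no_left:
  assumes M2: "no_left M2" and t: "comp_prog M1 M2 s a ss = Some (s', d, b, acts)"
  shows "d \<noteq> Left"
proof -
  have n: "d2 \<noteq> Left" if "delta M2 k = Some (q, d2, e, as)" for k q d2 e as
    using M2 that unfolding no_left_def by blast
  have p: "pass_on r2 l adv as r \<noteq> (s', Left, b, acts)" for r2 l adv as r
    by (cases r) (auto split: if_splits simp: forward_def)
  obtain q1 q2 h where s: "s = (q1, q2, h)" by (metis prod_cases3)
  show ?thesis
  proof (cases h)
    case (Hold l adv)
    then obtain r where "pass_on q2 l adv (keep (take (num_tapes M2) ss)) r = (s', d, b, acts)"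
      using t unfolding comp_prog_def s by auto
    then show ?thesis using p by metis
  next
    case Wait
    then show ?thesis using t n p unfolding comp_prog_def s
      by (auto simp del: pass_on.simps split: option.splits if_splits)
  qed
qed

text \<open>
  The inputs that \<open>M1\<close> may turn out to be running on: all extensions of the output of \<open>M2\<close> so far, or just this output once \<open>M2\<close> is
  known to have halted. The run of \<open>M1\<close> must be the same on all of them. This is used both for the final output of \<open>M2\<close> and for
  hypothetical continuations of the present output.
\<close>

definition streams :: "tm \<Rightarrow> word \<Rightarrow> nat \<Rightarrow> feed \<Rightarrow> word set" where
  "streams M2 x n2 h =
     (if h = Wait \<and> halted M2 x (run M2 x n2) then {out (run M2 x n2)}
      else {Y. prefix (out (run M2 x n2)) Y})"

definition stream_run :: "tm \<Rightarrow> word set \<Rightarrow> nat \<Rightarrow> config \<Rightarrow> bool" where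
  "stream_run M1 S n1 c1 \<longleftrightarrow>
     (\<forall>Y\<in>S. run M1 Y n1 = c1 \<and> (\<forall>k<n1. \<not> halted M1 Y (run M1 Y k)))"

text \<open>
  The last condition of each case is the reason for the time bound. With \<open>n1\<close> and \<open>n2\<close> the numbers of steps made by \<open>M1\<close> and \<open>M2\<close>, every
  letter passed on saves one step, since it is written by \<open>M2\<close> and first read by \<open>M1\<close> in the same step. The exception is a letter on which
  \<open>M1\<close> halts at once.
\<close>

definition feed_inv ::
  "tm \<Rightarrow> tm \<Rightarrow> word \<Rightarrow> nat \<Rightarrow> int \<Rightarrow> nat \<Rightarrow> nat \<Rightarrow> config \<Rightarrow> feed \<Rightarrow> bool" where
  "feed_inv M1 M2 x n i n1 n2 c1 h =
    (let c2 = run M2 x n2 in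
     case h of
       Wait \<Rightarrow> i = in_pos c2 \<and> int (length (out c2)) \<le> in_pos c1 \<and>
         (\<not> halted M2 x c2 \<longrightarrow> in_pos c1 = int (length (out c2))) \<and>
         n + length (out c2) = n2 + n1
     | Hold l adv \<Rightarrow> \<exists>m. n2 = Suc m \<and> i = in_pos (run M2 x m) \<and>
         out c2 = out (run M2 x m) @ [l] \<and> in_pos c2 = i + shift (forward adv) \<and>
         in_pos c1 = int (length (out (run M2 x m))) \<and>
         (n + length (out c2) = n2 + n1 \<or>
          delta M1 (state c1, Some l, map scanned (work c1)) = None \<and> n + length (out c2) = n2 + n1 + 1))"

definition comp_inv :: "tm \<Rightarrow> tm \<Rightarrow> word \<Rightarrow> nat \<Rightarrow> comp_state pconf \<Rightarrow> nat \<Rightarrow> nat \<Rightarrow> config \<Rightarrow> feed \<Rightarrow> bool" where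
  "comp_inv M1 M2 x n c n1 n2 c1 h \<longleftrightarrow>
     (\<exists>i. c = ((state c1, state (run M2 x n2), h), i, work (run M2 x n2) @ work c1, out c1) \<and>
       (\<forall>k<n2. \<not> halted M2 x (run M2 x k)) \<and>
       stream_run M1 (streams M2 x n2 h) n1 c1 \<and>
       feed_inv M1 M2 x n i n1 n2 c1 h)"

lemma stream_runI_step:
  assumes r: "stream_run M1 S n1 c1" and sub: "S' \<subseteq> S"
    and a: "\<And>Y. Y \<in> S' \<Longrightarrow> in_symbol Y (in_pos c1) = a"
    and d: "delta M1 (state c1, a, map scanned (work c1)) = Some (q, d, b, acts)"
  shows "stream_run M1 S' (Suc n1)
    \<lparr>state = q, in_pos = in_pos c1 + shift d, work = map2 act (work c1) acts,
     out = out c1 @ (case b of None \<Rightarrow> [] | Some a \<Rightarrow> [a])\<rparr>"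
  unfolding stream_run_def
proof (intro ballI conjI allI impI)
  fix Y assume Y: "Y \<in> S'"
  then have e: "run M1 Y n1 = c1" and nh: "\<And>k. k < n1 \<Longrightarrow> \<not> halted M1 Y (run M1 Y k)"
    using r sub unfolding stream_run_def by auto
  have t: "transition M1 Y c1 = Some (q, d, b, acts)" using a[OF Y] d by (simp add: transition_def)
  show "run M1 Y (Suc n1) = \<lparr>state = q, in_pos = in_pos c1 + shift d, work = map2 act (work c1) acts,
     out = out c1 @ (case b of None \<Rightarrow> [] | Some a \<Rightarrow> [a])\<rparr>"
    unfolding run_Suc e step_def t by simp
  fix k assume "k < Suc n1"
  then show "\<not> halted M1 Y (run M1 Y k)"
    using nh e t by (cases "k = n1") (auto simp: halted_def)
qed

lemma stream_run_subset: "stream_run M1 S n1 c1 \<Longrightarrow> S' \<subseteq> S \<Longrightarrow> stream_run M1 S' n1 c1"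
  unfolding stream_run_def by blast

lemma in_symbol_past_end: "int (length Y) \<le> i \<Longrightarrow> in_symbol Y i = None"
  by (simp add: in_symbol_def)

lemma in_symbol_prefix_snoc: "prefix (u @ [l]) Y \<Longrightarrow> in_symbol Y (int (length u)) = Some l"
  by (auto simp: prefix_def in_symbol_def nth_append)

lemma comp_inv_init: "comp_inv M1 M2 x 0 ((start M1, start M2, Wait), 0, replicate (num_tapes M2 + num_tapes M1) (\<lambda>_. 0, 0), [])
    0 0 (init_config M1) Wait"
  unfolding comp_inv_def feed_inv_def stream_run_def
  by (simp add: run_0 init_simps replicate_add)

lemma forward_eq: "d \<noteq> Left \<Longrightarrow> forward (d = Right) = d"
  by (cases d) (auto simp: forward_def)

lemma streams_after_output:
  assumes "out (run M2 x (Suc n2)) = out (run M2 x n2) @ w" and "\<not> halted M2 x (run M2 x n2)"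
  shows "streams M2 x (Suc n2) h \<subseteq> streams M2 x n2 h'"
  using assms unfolding streams_def by (auto dest: append_prefixD)

lemma comp_inv_step:
  assumes wf2: "tm_wf M2" and nl1: "no_left M1" and nl2: "no_left M2"
    and inv: "comp_inv M1 M2 x n c n1 n2 c1 h" and stp: "pnext (comp_prog M1 M2) x c = Some c'"
  shows "\<exists>n1' n2' c1' h'. comp_inv M1 M2 x (Suc n) c' n1' n2' c1' h'"
proof -
  define c2 where "c2 = run M2 x n2"
  obtain i where c: "c = ((state c1, state c2, h), i, work c2 @ work c1, out c1)"
    and nh: "\<And>k. k < n2 \<Longrightarrow> \<not> halted M2 x (run M2 x k)"
    and sr: "stream_run M1 (streams M2 x n2 h) n1 c1"
    and fi: "feed_inv M1 M2 x n i n1 n2 c1 h"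
    using inv unfolding comp_inv_def c2_def by blast
  have lw2: "length (work c2) = num_tapes M2" unfolding c2_def by (rule length_work_run[OF wf2])
  let ?ss1 = "map scanned (work c1)" and ?ss2 = "map scanned (work c2)"
  obtain s d b acts where t: "comp_step M1 M2 (state c1, state c2, h) (in_symbol x i) ?ss2 ?ss1 = Some (s, d, b, acts)"
    and c': "c' = (s, i + shift d, map2 act (work c2 @ work c1) acts, out c1 @ (case b of None \<Rightarrow> [] | Some a \<Rightarrow> [a]))"
    using stp lw2 unfolding c by (auto simp: comp_prog_def)
  have d1: "d \<noteq> Left" if "delta M1 k = Some (q, d, b, as)" for k q d b as
    using nl1 that unfolding no_left_def by blast
  let ?c1 = "\<lambda>q d1 b1 acts1. \<lparr>state = q, in_pos = in_pos c1 + shift d1, work = map2 act (work c1) acts1,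
     out = out c1 @ (case b1 of None \<Rightarrow> [] | Some a \<Rightarrow> [a])\<rparr>"
  show ?thesis
  proof (cases h)
    case (Hold l adv)
    obtain q1 d1 b1 acts1 where r: "delta M1 (state c1, Some l, ?ss1) = Some (q1, d1, b1, acts1)"
      and p: "pass_on (state c2) l adv (keep ?ss2) (q1, d1, b1, acts1) = (s, d, b, acts)"
      using t unfolding Hold by auto
    obtain m where m: "n2 = Suc m" "i = in_pos (run M2 x m)" "out c2 = out (run M2 x m) @ [l]"
      "in_pos c2 = i + shift (forward adv)" "in_pos c1 = int (length (out (run M2 x m)))"
      "n + length (out c2) = n2 + n1"
      using fi r unfolding Hold feed_inv_def c2_def[symmetric] by (auto simp: Let_def)
    have sub: "streams M2 x n2 h' \<subseteq> streams M2 x n2 h" for h'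
      unfolding streams_def Hold by auto
    have sym: "in_symbol Y (in_pos c1) = Some l" if "Y \<in> streams M2 x n2 h'" for Y h'
    proof -
      have "prefix (out c2) Y" using that unfolding streams_def c2_def by (auto split: if_splits)
      then show ?thesis using in_symbol_prefix_snoc unfolding m(3,5) by blast
    qed
    have run': "stream_run M1 (streams M2 x n2 h') (Suc n1) (?c1 q1 d1 b1 acts1)" for h'
      by (rule stream_runI_step[OF sr sub sym r])
    have tapes: "map2 act (work c2 @ work c1) (keep ?ss2 @ acts1) = work c2 @ map2 act (work c1) acts1"
      using act_keep[of "work c2"] by simp
    show ?thesis
    proof (cases "d1 = Right")
      case True
      have "comp_inv M1 M2 x (Suc n) c' (Suc n1) n2 (?c1 q1 d1 b1 acts1) Wait"
        unfolding comp_inv_def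
        using p True tapes m nh run'[of Wait] unfolding c' c2_def[symmetric] feed_inv_def
        by (auto simp: Let_def)
      then show ?thesis by blast
    next
      case False
      then have "d1 = Stay" using d1[OF r] by (cases d1) auto
      then have "comp_inv M1 M2 x (Suc n) c' (Suc n1) n2 (?c1 q1 d1 b1 acts1) (Hold l adv)"
        unfolding comp_inv_def
        using p tapes m nh run'[of "Hold l adv"] unfolding c' c2_def[symmetric] feed_inv_def
        by (auto simp: Let_def)
      then show ?thesis by blast
    qed
  next
    case Wait
    have i: "i = in_pos c2" and pos: "int (length (out c2)) \<le> in_pos c1"
      and pos': "\<not> halted M2 x c2 \<Longrightarrow> in_pos c1 = int (length (out c2))"
      and cnt: "n + length (out c2) = n2 + n1"
      using fi unfolding Wait feed_inv_def c2_def[symmetric] by (auto simp: Let_def)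
    have tr2: "transition M2 x c2 = delta M2 (state c2, in_symbol x i, ?ss2)"
      unfolding transition_def i ..
    show ?thesis
    proof (cases "delta M2 (state c2, in_symbol x i, ?ss2)")
      case None
      then have h2: "halted M2 x c2" unfolding halted_def tr2 .
      obtain q1 d1 b1 acts1 where r: "delta M1 (state c1, None, ?ss1) = Some (q1, d1, b1, acts1)"
        and e: "s = (q1, state c2, Wait)" "d = Stay" "b = b1" "acts = keep ?ss2 @ acts1"
        using t None unfolding Wait by (auto split: if_splits)
      have st: "streams M2 x n2 Wait = {out c2}" using h2 unfolding streams_def c2_def by simp
      have "stream_run M1 (streams M2 x n2 Wait) (Suc n1) (?c1 q1 d1 b1 acts1)"
        by (rule stream_runI_step[OF sr[unfolded Wait] order.refl _ r])
          (simp add: st in_symbol_past_end[OF pos])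
      moreover have "0 \<le> shift d1" using d1[OF r] by (cases d1) auto
      moreover have "map2 act (work c2 @ work c1) (keep ?ss2 @ acts1) = work c2 @ map2 act (work c1) acts1"
        using act_keep[of "work c2"] by simp
      ultimately have "comp_inv M1 M2 x (Suc n) c' (Suc n1) n2 (?c1 q1 d1 b1 acts1) Wait"
        unfolding comp_inv_def
        using i pos cnt nh h2 unfolding c' e c2_def[symmetric] feed_inv_def by (auto simp: Let_def)
      then show ?thesis by blast
    next
      case (Some k)
      then obtain q2 d2 b2 acts2 where k: "delta M2 (state c2, in_symbol x i, ?ss2) = Some (q2, d2, b2, acts2)"
        by (metis prod_cases4)
      have nh2: "\<not> halted M2 x c2" using k unfolding halted_def tr2 by simp
      note pos = pos'[OF nh2]
      define c2' where "c2' = run M2 x (Suc n2)"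
      have c2': "state c2' = q2" "in_pos c2' = i + shift d2" "work c2' = map2 act (work c2) acts2"
        "out c2' = out c2 @ (case b2 of None \<Rightarrow> [] | Some a \<Rightarrow> [a])"
        using step_Some[of M2 x c2, unfolded tr2, OF k] unfolding c2'_def run_Suc c2_def[symmetric] i by auto
      have nh': "\<And>k. k < Suc n2 \<Longrightarrow> \<not> halted M2 x (run M2 x k)"
        using nh nh2 unfolding c2_def by (metis less_SucE)
      have sub: "streams M2 x (Suc n2) h' \<subseteq> streams M2 x n2 Wait" for h'
        using streams_after_output c2'(4) nh2 unfolding c2'_def c2_def by blast
      have l2: "length acts2 = length (work c2)"
        using transition_Some_length[OF wf2, of x c2] k unfolding tr2 by auto
      have d2: "d2 \<noteq> Left" using nl2 k unfolding no_left_def by blast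
      have tapes: "map2 act (work c2 @ work c1) (acts2 @ as) = work c2' @ map2 act (work c1) as" for as
        using l2 unfolding c2' by (simp add: zip_append)
      have keep1: "map2 act (work c1) (keep ?ss1) = work c1" by (rule act_keep)
      show ?thesis
      proof (cases b2)
        case None
        then have e: "s = (state c1, q2, Wait)" "d = d2" "b = None" "acts = acts2 @ keep ?ss1"
          using t k unfolding Wait by auto
        have "comp_inv M1 M2 x (Suc n) c' n1 (Suc n2) c1 Wait"
          unfolding comp_inv_def
          using stream_run_subset[OF sr[unfolded Wait] sub] nh' cnt pos c2' None
          unfolding c' e tapes keep1 c2'_def[symmetric] feed_inv_def by (auto simp: Let_def)
        then show ?thesis by blast
      next
        case (Some l)
        have out': "out c2' = out c2 @ [l]" using c2'(4) Some by simp
        have sym: "in_symbol Y (in_pos c1) = Some l" if "Y \<in> streams M2 x (Suc n2) h'" for Y h'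
        proof -
          have "prefix (out c2') Y" using that unfolding streams_def c2'_def by (auto split: if_splits)
          then show ?thesis using in_symbol_prefix_snoc unfolding out' pos by blast
        qed
        show ?thesis
        proof (cases "delta M1 (state c1, Some l, ?ss1)")
          case None
          then have e: "s = (state c1, q2, Hold l (d2 = Right))" "d = Stay" "b = None" "acts = acts2 @ keep ?ss1"
            using t k Some unfolding Wait by auto
          have "feed_inv M1 M2 x (Suc n) i n1 (Suc n2) c1 (Hold l (d2 = Right))"
            unfolding feed_inv_def Let_def feed.case c2'_def[symmetric]
            using cnt pos c2'(2) out' None i forward_eq[OF d2]
            by (intro exI[of _ n2]) (simp add: c2_def[symmetric])
          moreover have "c' = ((state c1, state c2', Hold l (d2 = Right)), i, work c2' @ work c1, out c1)"
            unfolding c' e tapes keep1 using c2'(1) by simp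
          ultimately have "comp_inv M1 M2 x (Suc n) c' n1 (Suc n2) c1 (Hold l (d2 = Right))"
            unfolding comp_inv_def c2'_def[symmetric]
            using stream_run_subset[OF sr[unfolded Wait] sub] nh' by blast
          then show ?thesis by blast
        next
          case r: (Some r)
          obtain q1 d1 b1 acts1 where r': "r = (q1, d1, b1, acts1)" by (metis prod_cases4)
          note r1 = r[unfolded r']
          have p: "pass_on q2 l (d2 = Right) acts2 (q1, d1, b1, acts1) = (s, d, b, acts)"
            using t k Some r1 unfolding Wait by auto
          have run': "stream_run M1 (streams M2 x (Suc n2) h') (Suc n1) (?c1 q1 d1 b1 acts1)" for h'
            by (rule stream_runI_step[OF sr[unfolded Wait] sub sym r1])
          show ?thesis
          proof (cases "d1 = Right")
            case True
            have e: "s = (q1, q2, Wait)" "d = d2" "b = b1" "acts = acts2 @ acts1"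
              using p True forward_eq[OF d2] by auto
            have "feed_inv M1 M2 x (Suc n) (i + shift d2) (Suc n1) (Suc n2) (?c1 q1 d1 b1 acts1) Wait"
              unfolding feed_inv_def Let_def feed.case c2'_def[symmetric]
              using cnt pos c2'(2) out' True by simp
            moreover have "c' = ((q1, state c2', Wait), i + shift d2,
                work c2' @ map2 act (work c1) acts1, out c1 @ (case b1 of None \<Rightarrow> [] | Some a \<Rightarrow> [a]))"
              unfolding c' e tapes using c2'(1) by simp
            ultimately have "comp_inv M1 M2 x (Suc n) c' (Suc n1) (Suc n2) (?c1 q1 d1 b1 acts1) Wait"
              unfolding comp_inv_def c2'_def[symmetric] using run'[of Wait] nh' by simp
            then show ?thesis by blast
          next
            case False
            then have st: "d1 = Stay" using d1[OF r1] by (cases d1) auto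
            have e: "s = (q1, q2, Hold l (d2 = Right))" "d = Stay" "b = b1" "acts = acts2 @ acts1"
              using p False by auto
            have "feed_inv M1 M2 x (Suc n) i (Suc n1) (Suc n2) (?c1 q1 d1 b1 acts1) (Hold l (d2 = Right))"
              unfolding feed_inv_def Let_def feed.case c2'_def[symmetric]
              using cnt pos c2'(2) out' st i forward_eq[OF d2]
              by (intro exI[of _ n2]) (simp add: c2_def[symmetric])
            moreover have "c' = ((q1, state c2', Hold l (d2 = Right)), i,
                work c2' @ map2 act (work c1) acts1, out c1 @ (case b1 of None \<Rightarrow> [] | Some a \<Rightarrow> [a]))"
              unfolding c' e tapes using c2'(1) by simp
            ultimately have "comp_inv M1 M2 x (Suc n) c' (Suc n1) (Suc n2) (?c1 q1 d1 b1 acts1) (Hold l (d2 = Right))"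
              unfolding comp_inv_def c2'_def[symmetric] using run'[of "Hold l (d2 = Right)"] nh' by simp
            then show ?thesis by blast
          qed
        qed
      qed
    qed
  qed
qed

lemma comp_inv_reach:
  assumes "tm_wf M2" "no_left M1" "no_left M2"
    and "preach (comp_prog M1 M2) x n
      ((start M1, start M2, Wait), 0, replicate (num_tapes M2 + num_tapes M1) (\<lambda>_. 0, 0), []) c"
  shows "\<exists>n1 n2 c1 h. comp_inv M1 M2 x n c n1 n2 c1 h"
  using assms(4)
proof (induction n arbitrary: c)
  case 0
  then have c: "c = ((start M1, start M2, Wait), 0, replicate (num_tapes M2 + num_tapes M1) (\<lambda>_. 0, 0), [])"
    unfolding preach.simps .
  show ?case unfolding c by (intro exI) (rule comp_inv_init)
next
  case (Suc n)
  let ?c0 = "((start M1, start M2, Wait), 0, replicate (num_tapes M2 + num_tapes M1) (\<lambda>_. 0, 0), [])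
    :: comp_state pconf"
  have "preach (comp_prog M1 M2) x (n + Suc 0) ?c0 c" using Suc.prems by (simp only: add_Suc_right add_0_right)
  from preach_split[OF this] obtain c0 where "preach (comp_prog M1 M2) x n ?c0 c0"
    and s0: "preach (comp_prog M1 M2) x (Suc 0) c0 c" by blast
  moreover have s: "pnext (comp_prog M1 M2) x c0 = Some c"
    using s0 unfolding preach.simps by metis
  ultimately obtain n1 n2 c1 h where "comp_inv M1 M2 x n c0 n1 n2 c1 h" using Suc.IH by blast
  from comp_inv_step[OF assms(1-3) this s] show ?case .
qed

lemma RM_machine_simps:
  assumes "RM_machine M"
  shows "tm_wf M" "no_left M"
  using assms unfolding RM_machine_def no_left_def by blast+

lemma tm_fun_Some_out: "tm_fun M x = Some y \<Longrightarrow> y = out (run M x (run_time M x))"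
  unfolding tm_fun_def by (auto split: if_splits)

lemma comp_inv_bounds:
  assumes h2: "halts M2 x" and h1: "\<And>Y. halts M1 Y" and inv: "comp_inv M1 M2 x n c n1 n2 c1 h"
  defines "Y \<equiv> out (run M2 x (run_time M2 x))"
  shows "n2 \<le> run_time M2 x" "Y \<in> streams M2 x n2 h" "n1 \<le> run_time M1 Y"
    "n + length (out (run M2 x n2)) \<le> n2 + n1 + 1"
proof -
  obtain i where nh: "\<And>k. k < n2 \<Longrightarrow> \<not> halted M2 x (run M2 x k)"
    and sr: "stream_run M1 (streams M2 x n2 h) n1 c1" and fi: "feed_inv M1 M2 x n i n1 n2 c1 h"
    using inv unfolding comp_inv_def by blast
  show le: "n2 \<le> run_time M2 x" using nh halted_run_time[OF h2] by (meson not_le)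
  show Y: "Y \<in> streams M2 x n2 h"
  proof (cases "h = Wait \<and> halted M2 x (run M2 x n2)")
    case True
    then show ?thesis unfolding streams_def Y_def using run_eq_final[of M2 x n2] by simp
  next
    case False
    then show ?thesis unfolding streams_def Y_def using out_run_prefix[OF le] by auto
  qed
  have "\<not> halted M1 Y (run M1 Y k)" if "k < n1" for k using sr Y that unfolding stream_run_def by blast
  then show "n1 \<le> run_time M1 Y" using halted_run_time[OF h1] by (meson not_le)
  show "n + length (out (run M2 x n2)) \<le> n2 + n1 + 1"
    using fi unfolding feed_inv_def Let_def by (cases h) auto
qed

text \<open>
  If the machine halts while \<open>M1\<close> holds a letter, then \<open>M1\<close> has halted before the end of its input. By
  \<open>accepted_input_passed\<close> it does not accept this input, so the composite is undefined.
\<close>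

lemma comp_inv_halted:
  assumes RM1: "RM_machine M1" and RM2: "RM_machine M2"
    and rim1: "right_ideal_morphism (tm_fun M1)"
    and h1: "\<And>Y. halts M1 Y" and h2: "halts M2 x"
    and inv: "comp_inv M1 M2 x n (s, i, ws, y) n1 n2 c1 h"
    and stop: "pnext (comp_prog M1 M2) x (s, i, ws, y) = None"
  shows "(tm_fun M1 \<circ>\<^sub>m tm_fun M2) x = (if s = (accept M1, accept M2, Wait) then Some y else None) \<and>
    (\<forall>Y w. tm_fun M2 x = Some Y \<longrightarrow> tm_fun M1 Y = Some w \<longrightarrow>
       n + length Y \<le> run_time M2 x + run_time M1 Y)"
proof -
  note nl1 = RM_machine_simps(2)[OF RM1] and wf2 = RM_machine_simps(1)[OF RM2]
  define c2 where "c2 = run M2 x n2"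
  have c: "s = (state c1, state c2, h)" "ws = work c2 @ work c1" "y = out c1"
    and sr: "stream_run M1 (streams M2 x n2 h) n1 c1"
    and fi: "feed_inv M1 M2 x n i n1 n2 c1 h"
    using inv unfolding comp_inv_def c2_def by blast+
  note bd = comp_inv_bounds[OF h2 h1 inv]
  have lw2: "length (work c2) = num_tapes M2" unfolding c2_def by (rule length_work_run[OF wf2])
  have t: "comp_step M1 M2 (state c1, state c2, h) (in_symbol x i) (map scanned (work c2)) (map scanned (work c1)) = None"
    using stop lw2 unfolding c by (simp add: comp_prog_def)
  show ?thesis
  proof (cases h)
    case (Hold l adv)
    have d: "delta M1 (state c1, Some l, map scanned (work c1)) = None" using t unfolding Hold by auto
    have False if Y: "tm_fun M2 x = Some Y" and w: "tm_fun M1 Y = Some w" for Y w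
    proof -
      have YS: "Y \<in> streams M2 x n2 h" using bd(2) tm_fun_Some_out[OF Y] by simp
      then have run: "run M1 Y n1 = c1" using sr unfolding stream_run_def by blast
      obtain m where m: "out c2 = out (run M2 x m) @ [l]" "in_pos c1 = int (length (out (run M2 x m)))"
        using fi unfolding Hold feed_inv_def c2_def by (auto simp: Let_def)
      have pre: "prefix (out c2) Y" using YS unfolding Hold streams_def c2_def by simp
      then have "in_symbol Y (in_pos c1) = Some l" unfolding m by (rule in_symbol_prefix_snoc)
      then have "halted M1 Y (run M1 Y n1)" unfolding run halted_def transition_def using d by simp
      from accepted_input_passed[OF nl1 rim1 this w] have "int (length Y) \<le> in_pos c1" unfolding run .
      then show False using prefix_length_le[OF pre] unfolding m by simp
    qed
    moreover from this have "(tm_fun M1 \<circ>\<^sub>m tm_fun M2) x = None"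
      by (cases "(tm_fun M1 \<circ>\<^sub>m tm_fun M2) x") (auto simp: map_comp_Some_iff)
    ultimately show ?thesis unfolding c(1) Hold by auto
  next
    case Wait
    have i: "i = in_pos c2" and pos: "int (length (out c2)) \<le> in_pos c1"
      and cnt: "n + length (out c2) = n2 + n1"
      using fi unfolding Wait feed_inv_def c2_def[symmetric] by (auto simp: Let_def)
    have d2: "delta M2 (state c2, in_symbol x i, map scanned (work c2)) = None"
      using t unfolding Wait by (auto split: option.splits)
    then have hl2: "halted M2 x (run M2 x n2)" unfolding c2_def[symmetric] halted_def transition_def i .
    note f2 = tm_fun_halted[OF hl2, folded c2_def]
    show ?thesis
    proof (cases "state c2 = accept M2")
      case False
      then show ?thesis using f2 unfolding c(1) by (simp add: map_comp_def)
    next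
      case True
      then have d1: "delta M1 (state c1, None, map scanned (work c1)) = None"
        using t d2 unfolding Wait by auto
      have run: "run M1 (out c2) n1 = c1"
        using sr hl2 unfolding stream_run_def streams_def Wait c2_def by simp
      have "halted M1 (out c2) (run M1 (out c2) n1)"
        unfolding run halted_def transition_def in_symbol_past_end[OF pos] by (rule d1)
      note f1 = tm_fun_halted[OF this, unfolded run]
      have "n + length (out c2) \<le> run_time M2 x + run_time M1 (out c2)"
        using cnt bd(1,3) run_eq_final[OF hl2] unfolding c2_def by simp
      then show ?thesis using f1 f2 True unfolding c(1,3) Wait by (simp add: map_comp_def)
    qed
  qed
qed

text \<open>
  When the input head reads behind \<open>x\<close>, the condition on \<open>M2\<close> gives that the image \<open>Y\<close> of \<open>x\<close> has been written. In state \<open>Hold\<close> this refers to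
  the time before the last step of \<open>M2\<close>, so \<open>M1\<close> holds a letter behind \<open>Y\<close> and its own reading condition applies. In state \<open>Wait\<close> the
  letter that \<open>M1\<close> waits for is unknown.
\<close>

lemma comp_inv_reading:
  assumes RM1: "RM_machine M1" and RM2: "RM_machine M2"
    and rim1: "right_ideal_morphism (tm_fun M1)" and rim2: "right_ideal_morphism (tm_fun M2)"
    and Y: "tm_fun M2 x = Some Y" and w: "tm_fun M1 Y = Some w"
    and inv: "comp_inv M1 M2 (x @ z) n (s, i, ws, y) n1 n2 c1 h"
    and go: "pnext (comp_prog M1 M2) (x @ z) (s, i, ws, y) \<noteq> None"
    and ge: "int (length x) \<le> i" and lt: "i < int (length (x @ z))"
  shows "prefix w y"
proof -
  note wf2 = RM_machine_simps(1)[OF RM2] and nl2 = RM_machine_simps(2)[OF RM2]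
  have rd1: "prefix w (out (run M1 (Y @ r) k))"
    if "\<not> halted M1 (Y @ r) (run M1 (Y @ r) k)" "int (length Y) \<le> in_pos (run M1 (Y @ r) k)"
      "in_pos (run M1 (Y @ r) k) < int (length (Y @ r))" for r k
    using RM1 w that unfolding RM_machine_def by blast
  have rd2: "prefix Y (out (run M2 (x @ z) k))"
    if "\<not> halted M2 (x @ z) (run M2 (x @ z) k)" "int (length x) \<le> in_pos (run M2 (x @ z) k)"
      "in_pos (run M2 (x @ z) k) < int (length (x @ z))" for k
    using RM2 Y that unfolding RM_machine_def by blast
  define c2 where "c2 = run M2 (x @ z) n2"
  have c: "s = (state c1, state c2, h)" "ws = work c2 @ work c1" "y = out c1"
    and nh: "\<And>k. k < n2 \<Longrightarrow> \<not> halted M2 (x @ z) (run M2 (x @ z) k)"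
    and sr: "stream_run M1 (streams M2 (x @ z) n2 h) n1 c1"
    and fi: "feed_inv M1 M2 (x @ z) n i n1 n2 c1 h"
    using inv unfolding comp_inv_def c2_def by blast+
  have lw2: "length (work c2) = num_tapes M2" unfolding c2_def by (rule length_work_run[OF wf2])
  have t: "comp_step M1 M2 (state c1, state c2, h) (in_symbol (x @ z) i)
      (map scanned (work c2)) (map scanned (work c1)) \<noteq> None"
    using go lw2 unfolding c by (simp add: comp_prog_def)
  show ?thesis
  proof (cases h)
    case (Hold l adv)
    have d: "delta M1 (state c1, Some l, map scanned (work c1)) \<noteq> None" using t unfolding Hold by auto
    obtain m where m: "n2 = Suc m" "i = in_pos (run M2 (x @ z) m)" "out c2 = out (run M2 (x @ z) m) @ [l]"
        "in_pos c1 = int (length (out (run M2 (x @ z) m)))"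
      using fi unfolding Hold feed_inv_def c2_def[symmetric] by (auto simp: Let_def)
    have "prefix Y (out (run M2 (x @ z) m))" using rd2[of m] nh[of m] ge lt unfolding m(1,2) by simp
    then obtain r where r: "out (run M2 (x @ z) m) = Y @ r" unfolding prefix_def by blast
    have "out c2 \<in> streams M2 (x @ z) n2 h" unfolding Hold streams_def c2_def by simp
    then have run: "run M1 (Y @ r @ [l]) n1 = c1" using sr unfolding stream_run_def m(3) r by simp
    have "in_symbol (Y @ r @ [l]) (in_pos c1) = Some l"
      using in_symbol_prefix_snoc[of "Y @ r" l "Y @ r @ [l]"] unfolding m(4) r by simp
    then have "\<not> halted M1 (Y @ r @ [l]) c1" using d unfolding halted_def transition_def by simp
    then show ?thesis using rd1[of "r @ [l]" n1] m(4) unfolding run r c(3) by simp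
  next
    case Wait
    have i: "i = in_pos c2" and pos: "\<not> halted M2 (x @ z) c2 \<Longrightarrow> in_pos c1 = int (length (out c2))"
      using fi unfolding Wait feed_inv_def c2_def[symmetric] by (auto simp: Let_def)
    show ?thesis
    proof (cases "halted M2 (x @ z) c2")
      case False
      have "prefix Y (out c2)" using rd2[of n2] False ge lt unfolding c2_def[symmetric] i by simp
      then obtain r where r: "out c2 = Y @ r" unfolding prefix_def by blast
      \<comment> \<open>The run of \<open>M1\<close> so far is the same for every next letter, so an arbitrary one may be supplied.\<close>
      let ?Y = "Y @ r @ [True]"
      have "?Y \<in> streams M2 (x @ z) n2 h" using False r unfolding streams_def c2_def by simp
      then have run: "run M1 ?Y n1 = c1" using sr unfolding stream_run_def by blast
      show ?thesis
      proof (cases "halted M1 ?Y c1")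
        case True
        have "tm_fun M1 ?Y = Some (w @ r @ [True])" by (rule rim_append[OF rim1 w])
        then have "out c1 = w @ r @ [True]"
          using tm_fun_halted[of M1 ?Y n1] True unfolding run by (simp split: if_splits)
        then show ?thesis unfolding c(3) by simp
      next
        case False
        then show ?thesis using rd1[of "r @ [True]" n1] pos[OF \<open>\<not> halted M2 (x @ z) c2\<close>]
          unfolding run r c(3) by simp
      qed
    next
      case True
      then have "state c2 = accept M2"
        using t unfolding Wait halted_def transition_def i by (auto split: if_splits)
      then have "tm_fun M2 (x @ z) = Some (out c2)"
        using tm_fun_halted[of M2 "x @ z" n2] True unfolding c2_def[symmetric] by simp
      from accepted_input_passed[OF nl2 rim2 _ this, of n2] True
      have "int (length (x @ z)) \<le> in_pos c2" unfolding c2_def[symmetric] by simp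
      then show ?thesis using lt unfolding i by simp
    qed
  qed
qed

lemma tm_bound_mono:
  assumes B: "tm_bound M B" and le: "B \<le> B'"
  shows "tm_bound M B'"
proof -
  have "{..<B} \<subseteq> {..<B'}" using le by auto
  then show ?thesis
    using B unfolding tm_bound_def by (meson le order_trans less_le_trans)
qed

text \<open>
  The last conclusion is what makes composition of machines with running time \<open>n + o(n)\<close> harmless: of the steps of \<open>M1\<close>, only those in
  excess of the length of its input add to the running time of \<open>M2\<close>.
\<close>

lemma composition_machine:
  assumes RM1: "RM_machine M1" and RM2: "RM_machine M2"
    and rim1: "right_ideal_morphism (tm_fun M1)" and rim2: "right_ideal_morphism (tm_fun M2)"
    and h1: "\<And>Y. halts M1 Y" and h2: "\<And>x. halts M2 x"
  obtains C where "RM_machine C" "tm_fun C = tm_fun M1 \<circ>\<^sub>m tm_fun M2"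
    "\<And>x. halts C x" "\<And>x. run_time C x \<le> run_time M2 x + run_time M1 (out (run M2 x (run_time M2 x))) + 2"
    "\<And>x Y w. tm_fun M2 x = Some Y \<Longrightarrow> tm_fun M1 Y = Some w \<Longrightarrow>
       run_time C x + length Y \<le> run_time M2 x + run_time M1 Y"
proof -
  note wf1 = RM_machine_simps(1)[OF RM1] and nl1 = RM_machine_simps(2)[OF RM1]
  note wf2 = RM_machine_simps(1)[OF RM2] and nl2 = RM_machine_simps(2)[OF RM2]
  obtain B1 B2 where "tm_bound M1 B1" "tm_bound M2 B2" using tm_bound_exists wf1 wf2 by metis
  then obtain B where B: "tm_bound M1 B" "tm_bound M2 B" using tm_bound_mono by (meson max.cobounded1 max.cobounded2)
  interpret C: program "comp_prog M1 M2" "{..<B} \<times> {..<B} \<times> UNIV" B "num_tapes M2 + num_tapes M1"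
    "(start M1, start M2, Wait)" "(accept M1, accept M2, Wait)"
    by (rule comp_program[OF wf1 wf2 B])
  define C where "C = C.machine"
  let ?b = "\<lambda>x. run_time M2 x + run_time M1 (out (run M2 x (run_time M2 x))) + 1"
  note inv = comp_inv_reach[OF wf2 nl1 nl2]
  have bound: "n \<le> ?b x" if r: "preach (comp_prog M1 M2) x n C.pinit c" for x n c
  proof -
    obtain n1 n2 c1 h where "comp_inv M1 M2 x n c n1 n2 c1 h" using inv[OF r] by blast
    from comp_inv_bounds(1,3,4)[OF h2 h1 this] show ?thesis by simp
  qed
  have halted: "halted C x (run C x (Suc (?b x)))" for x
  proof (rule ccontr)
    assume "\<not> halted C x (run C x (Suc (?b x)))"
    from C.preach_of_not_halted[OF this[unfolded C_def]] bound show False by (metis Suc_n_not_le_n)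
  qed
  have halts: "halts C x" for x using halted by (rule haltsI)
  have final: "tm_fun C x = (tm_fun M1 \<circ>\<^sub>m tm_fun M2) x \<and>
    (\<forall>Y w. tm_fun M2 x = Some Y \<longrightarrow> tm_fun M1 Y = Some w \<longrightarrow>
       run_time C x + length Y \<le> run_time M2 x + run_time M1 Y)" for x
  proof -
    obtain c where c: "preach (comp_prog M1 M2) x (run_time C x) C.pinit c" "pnext (comp_prog M1 M2) x c = None"
      using C.halts_preach[OF halts[of x, unfolded C_def]] unfolding C_def by blast
    obtain s i ws y where s: "c = (s, i, ws, y)" by (metis prod_cases4)
    obtain n1 n2 c1 h where "comp_inv M1 M2 x (run_time C x) (s, i, ws, y) n1 n2 c1 h"
      using inv[OF c(1)] unfolding s by blast
    from comp_inv_halted[OF RM1 RM2 rim1 h1 h2 this c(2)[unfolded s]]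
      C.tm_fun_preach[OF c[unfolded s], folded C_def]
    show ?thesis by simp
  qed
  have "RM_machine C"
    unfolding RM_machine_def
  proof (intro conjI allI impI)
    show "tm_wf C" unfolding C_def by (rule C.tm_wf_machine)
    have "no_left C" unfolding C_def by (rule C.no_left_machine) (rule comp_no_left[OF nl2])
    then show "delta C k = Some (q, d, b, acts) \<Longrightarrow> d \<noteq> Left" for k q d b acts
      unfolding no_left_def by blast
    fix x w z n
    assume f: "tm_fun C x = Some w" and nh: "\<not> halted C (x @ z) (run C (x @ z) n)"
      and ge: "int (length x) \<le> in_pos (run C (x @ z) n)"
      and lt: "in_pos (run C (x @ z) n) < int (length (x @ z))"
    obtain Y where Y: "tm_fun M2 x = Some Y" "tm_fun M1 Y = Some w"
      using f final[of x] by (auto simp: map_comp_Some_iff)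
    obtain c c' where c: "preach (comp_prog M1 M2) (x @ z) n C.pinit c" "pnext (comp_prog M1 M2) (x @ z) c = Some c'"
      using C.preach_of_not_halted[OF nh[unfolded C_def]] by blast
    obtain s i ws y where s: "c = (s, i, ws, y)" by (metis prod_cases4)
    obtain n1 n2 c1 h where inv': "comp_inv M1 M2 (x @ z) n (s, i, ws, y) n1 n2 c1 h"
      using inv[OF c(1)] unfolding s by blast
    have run: "in_pos (run C (x @ z) n) = i" "out (run C (x @ z) n) = y"
      using C.run_preach[OF c(1)] unfolding s C_def by auto
    show "prefix w (out (run C (x @ z) n))"
      using comp_inv_reading[OF RM1 RM2 rim1 rim2 Y inv'] c(2) ge lt unfolding run s by (simp del: pnext.simps)
  qed
  moreover have "tm_fun C = tm_fun M1 \<circ>\<^sub>m tm_fun M2" using final by blast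
  moreover have "run_time C x \<le> run_time M2 x + run_time M1 (out (run M2 x (run_time M2 x))) + 2" for x
    using run_time_le[OF halted[of x]] by simp
  ultimately show ?thesis using that halts final by blast
qed

section \<open>Composites of fast machines\<close>

definition copy_prog :: "unit prog" where
  "copy_prog q a ss = (case a of None \<Rightarrow> None | Some x \<Rightarrow> Some ((), Right, Some x, []))"

lemma fast_identity_machine:
  obtains M where "fast_machine M" "tm_fun M = Some"
proof -
  interpret M: program copy_prog UNIV 1 0 "()" "()"
    by unfold_locales (auto simp: copy_prog_def split: option.splits)
  define M where "M = M.machine"
  have r: "preach copy_prog w j M.pinit ((), int j, [], take j w)" if "j \<le> length w" for w j
    using that
  proof (induction j)
    case (Suc j)
    then have "preach copy_prog w j M.pinit ((), int j, [], take j w)" by simp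
    moreover have "pnext copy_prog w ((), int j, [], take j w) = Some ((), int (Suc j), [], take (Suc j) w)"
      using Suc.prems by (simp add: copy_prog_def in_symbol_def take_Suc_conv_app_nth)
    ultimately show ?case by (rule preach_snoc)
  qed simp
  have e: "pnext copy_prog w ((), int (length w), [], w) = None" for w
    by (simp add: copy_prog_def in_symbol_def)
  have r': "preach copy_prog w (length w) M.pinit ((), int (length w), [], w)" for w
    using r[of "length w" w] by simp
  have f: "tm_fun M w = Some w" for w unfolding M_def using M.tm_fun_preach[OF r' e] by simp
  have h: "halted M w (run M w (length w))" for w unfolding M_def by (rule M.halted_preach[OF r' e])
  have "RM_machine M"
    unfolding RM_machine_def
  proof (intro conjI allI impI)
    show "tm_wf M" unfolding M_def by (rule M.tm_wf_machine)
    have "no_left M" unfolding M_def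
      by (rule M.no_left_machine) (auto simp: copy_prog_def split: option.splits)
    then show "delta M k = Some (q, d, b, acts) \<Longrightarrow> d \<noteq> Left" for k q d b acts
      unfolding no_left_def by blast
    fix x y z n
    assume "tm_fun M x = Some y" and nh: "\<not> halted M (x @ z) (run M (x @ z) n)"
      and ge: "int (length x) \<le> in_pos (run M (x @ z) n)"
    then have y: "y = x" unfolding f by simp
    have n: "n \<le> length (x @ z)" using nh h[of "x @ z"] by (metis linorder_linear run_halted_le)
    have "in_pos (run M (x @ z) n) = int n" "out (run M (x @ z) n) = take n (x @ z)"
      using M.run_preach[OF r[OF n]] unfolding M_def by auto
    then show "prefix y (out (run M (x @ z) n))" using ge unfolding y by simp
  qed
  moreover have "halts M x \<and> run_time M x \<le> poly [:0, 1:] (length x)" for x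
    using haltsI[OF h] run_time_le[OF h, of x] by simp
  ultimately have "fast_machine M" unfolding fast_machine_def f
    using run_time_le[OF h] by (auto intro!: exI[of _ "[:0, 1:]"] add_increasing2)
  then show ?thesis using that f by blast
qed

text \<open>
  The bound \<open>c + sqrt c\<close> is at most \<open>4 * c\<close>, whose square root is \<open>2 * sqrt c\<close>.
\<close>

lemma sqrt_bound_twice:
  fixes a b c :: nat
  assumes "a \<le> b + sqrt b" and "b \<le> c + sqrt c"
  shows "a \<le> c + 3 * sqrt c" "c + sqrt c + sqrt b \<le> c + 3 * sqrt c"
proof -
  have "sqrt c \<le> c"
    by (cases "c = 0") (auto intro: real_le_lsqrt simp: power2_eq_square)
  then have "b \<le> 4 * real c" using assms(2) by simp
  then have "sqrt b \<le> sqrt (4 * real c)" by simp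
  also have "\<dots> = 2 * sqrt c" by (simp add: real_sqrt_mult)
  finally have "sqrt b \<le> 2 * sqrt c" .
  then show "a \<le> c + 3 * sqrt c" "c + sqrt c + sqrt b \<le> c + 3 * sqrt c" using assms by auto
qed

definition sqrt_time :: "nat \<Rightarrow> nat" where
  "sqrt_time n = nat \<lfloor>n + 3 * sqrt n\<rfloor>"

lemma le_sqrt_time: "real k \<le> n + 3 * sqrt n \<Longrightarrow> k \<le> sqrt_time n"
  unfolding sqrt_time_def by (rule le_nat_floor)

lemma n_plus_o_sqrt_time: "n_plus_o sqrt_time"
  unfolding n_plus_o_def
proof (intro exI conjI allI)
  let ?e = "\<lambda>n. 3 / sqrt (real n)"
  show "0 \<le> ?e n" for n by simp
  have "filterlim (\<lambda>n. sqrt (real n)) at_top sequentially"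
    by (rule filterlim_compose[OF sqrt_at_top filterlim_real_sequentially])
  then have "filterlim (\<lambda>n. sqrt (real n)) at_infinity sequentially"
    by (rule filterlim_at_top_imp_at_infinity)
  then show "?e \<longlonglongrightarrow> 0" by (rule tendsto_divide_0[OF tendsto_const])
  fix n
  have "real (sqrt_time n) \<le> n + 3 * sqrt n" unfolding sqrt_time_def by simp
  also have "3 * sqrt n = ?e n * n"
    using real_div_sqrt[of "real n"] by (cases "n = 0") (auto simp: field_simps)
  finally show "real (sqrt_time n) \<le> real n + ?e n * real n" .
qed

text \<open>
  Sizes and times pass through the intermediate word \<open>Y\<close>, of length at most \<open>n + sqrt n\<close>. The excess of the time over \<open>n\<close> is at most \<open>sqrt n\<close> from
  \<open>M2\<close> and \<open>sqrt (length Y) \<le> 2 * sqrt n\<close> from \<open>M1\<close>.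
\<close>

lemma fast_comp_in_RM_no:
  assumes M1: "fast_machine M1" and M2: "fast_machine M2"
    and rim1: "right_ideal_morphism (tm_fun M1)" and rim2: "right_ideal_morphism (tm_fun M2)"
  shows "tm_fun M1 \<circ>\<^sub>m tm_fun M2 \<in> RM_no"
proof -
  let ?f = "tm_fun M1 \<circ>\<^sub>m tm_fun M2"
  obtain p1 p2 :: "nat poly" where p1: "\<And>x. halts M1 x \<and> run_time M1 x \<le> poly p1 (length x)"
    and p2: "\<And>x. halts M2 x \<and> run_time M2 x \<le> poly p2 (length x)"
    using M1 M2 unfolding fast_machine_def by blast
  have RM: "RM_machine M1" "RM_machine M2" using M1 M2 unfolding fast_machine_def by auto
  obtain C where C: "RM_machine C" "tm_fun C = ?f" "\<And>x. halts C x"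
    "\<And>x. run_time C x \<le> run_time M2 x + run_time M1 (out (run M2 x (run_time M2 x))) + 2"
    "\<And>x Y w. tm_fun M2 x = Some Y \<Longrightarrow> tm_fun M1 Y = Some w \<Longrightarrow>
       run_time C x + length Y \<le> run_time M2 x + run_time M1 Y"
    using composition_machine[OF RM rim1 rim2] p1 p2 by blast
  have bounds: "real (length w) \<le> length x + 3 * sqrt (length x) \<and>
      real (length x) \<le> length w + 3 * sqrt (length w) \<and>
      real (run_time C x) \<le> length x + 3 * sqrt (length x)" if f: "?f x = Some w" for x w
  proof -
    obtain Y where Y: "tm_fun M2 x = Some Y" "tm_fun M1 Y = Some w"
      using f by (auto simp: map_comp_Some_iff)
    have b1: "real (length w) \<le> length Y + sqrt (length Y)" "real (length Y) \<le> length w + sqrt (length w)"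
      "real (run_time M1 Y) \<le> length Y + sqrt (length Y)"
      using M1 Y(2) unfolding fast_machine_def by blast+
    have b2: "real (length Y) \<le> length x + sqrt (length x)" "real (length x) \<le> length Y + sqrt (length Y)"
      "real (run_time M2 x) \<le> length x + sqrt (length x)"
      using M2 Y(1) unfolding fast_machine_def by blast+
    have "real (run_time C x) + length Y \<le> real (run_time M2 x) + run_time M1 Y"
      using C(5)[OF Y] by (metis of_nat_add of_nat_le_iff)
    then have "real (run_time C x) \<le> length x + sqrt (length x) + sqrt (length Y)"
      using b1(3) b2(3) by linarith
    then show ?thesis
      using sqrt_bound_twice(1)[OF b1(1) b2(1)] sqrt_bound_twice(1)[OF b2(2) b1(2)]
        sqrt_bound_twice(2)[OF b1(1) b2(1)] by linarith
  qed
  have poly_time: "poly_time_computable ?f"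
    unfolding poly_time_computable_def
  proof (intro exI conjI allI)
    show "tm_wf C" using C(1) unfolding RM_machine_def by simp
    show "tm_fun C = ?f" by (rule C(2))
    fix x
    show "halts C x" by (rule C(3))
    let ?Y = "out (run M2 x (run_time M2 x))"
    have "length ?Y \<le> poly p2 (length x)"
      using out_run_length[of M2 x "run_time M2 x"] p2[of x] by simp
    then have "run_time M1 ?Y \<le> poly p1 (poly p2 (length x))"
      using p1[of ?Y] nat_poly_mono order_trans by blast
    then show "run_time C x \<le> poly (p2 + pcompose p1 p2 + [:2:]) (length x)"
      using C(4)[of x] p2[of x] by (simp add: poly_pcompose)
  qed
  have balanced: "poly_balanced ?f"
    unfolding poly_balanced_def
  proof (intro exI allI impI)
    fix x w assume f: "?f x = Some w"
    have s: "sqrt (real n) \<le> n" for n :: nat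
      by (cases "n = 0") (auto intro: real_le_lsqrt simp: power2_eq_square)
    have "real (length w) \<le> 4 * real (length x)" "real (length x) \<le> 4 * real (length w)"
      using bounds[OF f] s[of "length x"] s[of "length w"] by linarith+
    then show "length w \<le> poly [:0, 4:] (length x) \<and> length x \<le> poly [:0, 4:] (length w)" by simp
  qed
  have "?f \<in> RM_P" unfolding RM_P_def using rim_comp[OF rim1 rim2] poly_time balanced by blast
  moreover have "length w \<le> sqrt_time (length x) \<and> length x \<le> sqrt_time (length w) \<and>
      run_time C x \<le> sqrt_time (length x)" if "?f x = Some w" for x w
    using bounds[OF that] le_sqrt_time by blast
  ultimately show ?thesis unfolding RM_no_def using C(1,2) n_plus_o_sqrt_time by blast
qed

lemma Some_rim: "right_ideal_morphism Some"
  by (rule rimI) simp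

text \<open>
  A special case of composition: \<open>tm_fun M\<close> is its own composite with the identity.
\<close>

lemma fast_in_RM_no:
  assumes "fast_machine M" "right_ideal_morphism (tm_fun M)"
  shows "tm_fun M \<in> RM_no"
proof -
  obtain I where I: "fast_machine I" "tm_fun I = Some" using fast_identity_machine .
  have "tm_fun M \<circ>\<^sub>m tm_fun I \<in> RM_no"
    using fast_comp_in_RM_no[OF assms(1) I(1) assms(2)] Some_rim I(2) by simp
  then show ?thesis unfolding I(2) by (simp add: map_comp_def)
qed

lemma Some_in_RM_no: "Some \<in> RM_no"
  using fast_identity_machine fast_in_RM_no Some_rim by metis

section \<open>The isomorphism\<close>

lemma RM_no_subset: "RM_no \<subseteq> RM_P"
  unfolding RM_no_def by blast

lemma RM_P_rim: "f \<in> RM_P \<Longrightarrow> right_ideal_morphism f"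
  and RM_P_balanced: "f \<in> RM_P \<Longrightarrow> poly_balanced f"
  unfolding RM_P_def by auto

lemma equiv_poly_equiv_on:
  assumes "S \<subseteq> RM_P"
  shows "equiv S (poly_equiv_on S)"
proof (rule equivI)
  have r: "right_ideal_morphism f" if "f \<in> S" for f using assms that RM_P_rim by blast
  show "poly_equiv_on S \<subseteq> S \<times> S" unfolding poly_equiv_on_def by auto
  show "refl_on S (poly_equiv_on S)"
    by (auto simp: refl_on_def poly_equiv_on_def intro: poly_equiv_refl r)
  show "sym (poly_equiv_on S)"
    by (auto simp: sym_def poly_equiv_on_def intro: poly_equiv_sym r)
  show "trans (poly_equiv_on S)"
    unfolding trans_def poly_equiv_on_def using poly_equiv_trans[OF r r r] by blast
qed

text \<open>
  The union that defines the product ranges over all pairs of representatives. By the congruence property a pair whose composite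
  lies in \<open>S\<close> contributes the same class as \<open>f\<close> and \<open>g\<close>, and any other pair contributes nothing.
\<close>

lemma quotient_mult:
  assumes S: "S \<subseteq> RM_P" and f: "f \<in> S" and g: "g \<in> S" and fg: "f \<circ>\<^sub>m g \<in> S"
  shows "(poly_equiv_on S `` {f}) \<otimes>\<^bsub>quotient_monoid (fun_monoid S) (poly_equiv_on S)\<^esub>
      (poly_equiv_on S `` {g}) = poly_equiv_on S `` {f \<circ>\<^sub>m g}"
proof -
  let ?r = "poly_equiv_on S"
  note eq = equiv_poly_equiv_on[OF S]
  have sub: "?r `` {f' \<circ>\<^sub>m g'} \<subseteq> ?r `` {f \<circ>\<^sub>m g}" if f': "f' \<in> ?r `` {f}" and g': "g' \<in> ?r `` {g}" for f' g'
  proof (cases "f' \<circ>\<^sub>m g' \<in> S")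
    case True
    have P: "f \<in> RM_P" "f' \<in> RM_P" "g \<in> RM_P" "g' \<in> RM_P" "poly_equiv f f'" "poly_equiv g g'"
      using S f g f' g' unfolding poly_equiv_on_def by auto
    have "poly_equiv (f \<circ>\<^sub>m g) (f' \<circ>\<^sub>m g')"
      by (rule poly_equiv_comp[OF P(1-4)[THEN RM_P_rim] P(3,4)[THEN RM_P_balanced] P(5,6)])
    then have "(f \<circ>\<^sub>m g, f' \<circ>\<^sub>m g') \<in> ?r" using fg True unfolding poly_equiv_on_def by simp
    from equiv_class_eq[OF eq this] show ?thesis by simp
  next
    case False
    then show ?thesis unfolding poly_equiv_on_def by auto
  qed
  have "f \<in> ?r `` {f}" "g \<in> ?r `` {g}" using equiv_class_self[OF eq] f g by blast+
  then have "(\<Union>f'\<in>?r `` {f}. \<Union>g'\<in>?r `` {g}. ?r `` {f' \<circ>\<^sub>m g'}) = ?r `` {f \<circ>\<^sub>m g}"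
    using sub by blast
  then show ?thesis unfolding quotient_monoid_def fun_monoid_def by simp
qed

lemma quotient_simps:
  "carrier (quotient_monoid (fun_monoid S) r) = S // r"
  "\<one>\<^bsub>quotient_monoid (fun_monoid S) r\<^esub> = r `` {Some}"
  unfolding quotient_monoid_def fun_monoid_def by simp_all

theorem proposition6p3:
  "\<exists>\<phi> \<in> iso RM_no_mod_poly RM_P_mod_poly. \<phi> \<one>\<^bsub>RM_no_mod_poly\<^esub> = \<one>\<^bsub>RM_P_mod_poly\<^esub>"
proof -
  let ?n = "poly_equiv_on RM_no" and ?p = "poly_equiv_on RM_P"
  define \<phi> where "\<phi> X = ?p `` X" for X
  note en = equiv_poly_equiv_on[OF RM_no_subset] and ep = equiv_poly_equiv_on[OF order.refl]
  have \<phi>_class: "\<phi> (?n `` {f}) = ?p `` {f}" if f: "f \<in> RM_no" for f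
  proof
    have "?p `` {g} = ?p `` {f}" if "g \<in> ?n `` {f}" for g
    proof -
      have "(f, g) \<in> ?p" using that RM_no_subset unfolding poly_equiv_on_def by auto
      from equiv_class_eq[OF ep this] show ?thesis by simp
    qed
    then show "\<phi> (?n `` {f}) \<subseteq> ?p `` {f}" unfolding \<phi>_def by blast
    show "?p `` {f} \<subseteq> \<phi> (?n `` {f})"
      unfolding \<phi>_def using equiv_class_self[OF en f] by blast
  qed
  have padded: "\<exists>M. fast_machine M \<and> right_ideal_morphism (tm_fun M) \<and> tm_fun M \<in> RM_no \<and>
      poly_equiv F (tm_fun M)" if "F \<in> RM_P" for F
    using padded_equivalent[OF that] fast_in_RM_no by metis
  have \<phi>_closed: "\<phi> X \<in> RM_P // ?p" if "X \<in> RM_no // ?n" for X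
    using that \<phi>_class RM_no_subset by (auto elim!: quotientE intro!: quotientI)
  have "\<phi> \<in> hom RM_no_mod_poly RM_P_mod_poly"
    unfolding hom_def RM_no_mod_poly_def RM_P_mod_poly_def quotient_simps
  proof (intro CollectI conjI ballI)
    show "\<phi> \<in> RM_no // ?n \<rightarrow> RM_P // ?p" using \<phi>_closed by blast
    fix X Y assume "X \<in> RM_no // ?n" "Y \<in> RM_no // ?n"
    then obtain F G where F: "F \<in> RM_no" "X = ?n `` {F}" and G: "G \<in> RM_no" "Y = ?n `` {G}"
      by (meson quotientE)
    \<comment> \<open>Padded representatives are taken because their composite is known to lie in \<open>RM_no\<close>.\<close>
    obtain M where M: "fast_machine M" "right_ideal_morphism (tm_fun M)" "tm_fun M \<in> RM_no" "poly_equiv F (tm_fun M)"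
      using padded[of F] F RM_no_subset by blast
    obtain N where N: "fast_machine N" "right_ideal_morphism (tm_fun N)" "tm_fun N \<in> RM_no" "poly_equiv G (tm_fun N)"
      using padded[of G] G RM_no_subset by blast
    have "(F, tm_fun M) \<in> ?n" "(G, tm_fun N) \<in> ?n"
      using F(1) G(1) M(3,4) N(3,4) unfolding poly_equiv_on_def by auto
    then have X: "X = ?n `` {tm_fun M}" and Y: "Y = ?n `` {tm_fun N}"
      unfolding F(2) G(2) by (auto dest: equiv_class_eq[OF en])
    have MN: "tm_fun M \<circ>\<^sub>m tm_fun N \<in> RM_no" by (rule fast_comp_in_RM_no[OF M(1) N(1) M(2) N(2)])
    have P: "tm_fun M \<in> RM_P" "tm_fun N \<in> RM_P" "tm_fun M \<circ>\<^sub>m tm_fun N \<in> RM_P"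
      using M(3) N(3) MN RM_no_subset by auto
    show "\<phi> (X \<otimes>\<^bsub>quotient_monoid (fun_monoid RM_no) ?n\<^esub> Y) =
        \<phi> X \<otimes>\<^bsub>quotient_monoid (fun_monoid RM_P) ?p\<^esub> \<phi> Y"
      unfolding X Y quotient_mult[OF RM_no_subset M(3) N(3) MN] \<phi>_class[OF MN] \<phi>_class[OF M(3)] \<phi>_class[OF N(3)]
        quotient_mult[OF order.refl P] ..
  qed
  moreover have "bij_betw \<phi> (RM_no // ?n) (RM_P // ?p)"
  proof (rule bij_betw_imageI)
    show "inj_on \<phi> (RM_no // ?n)"
    proof (rule inj_onI)
      fix X Y assume "X \<in> RM_no // ?n" "Y \<in> RM_no // ?n" and e: "\<phi> X = \<phi> Y"
      then obtain F G where F: "F \<in> RM_no" "X = ?n `` {F}" and G: "G \<in> RM_no" "Y = ?n `` {G}"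
        by (meson quotientE)
      have "?p `` {F} = ?p `` {G}" using e unfolding F(2) G(2) \<phi>_class[OF F(1)] \<phi>_class[OF G(1)] .
      then have "(F, G) \<in> ?p" using eq_equiv_class[OF _ ep] G(1) RM_no_subset by blast
      then have "(F, G) \<in> ?n" using F(1) G(1) unfolding poly_equiv_on_def by simp
      then show "X = Y" unfolding F(2) G(2) by (rule equiv_class_eq[OF en])
    qed
    have "Z \<in> \<phi> ` (RM_no // ?n)" if "Z \<in> RM_P // ?p" for Z
    proof -
      obtain F where F: "F \<in> RM_P" "Z = ?p `` {F}" using \<open>Z \<in> RM_P // ?p\<close> by (rule quotientE)
      obtain M where M: "tm_fun M \<in> RM_no" "poly_equiv F (tm_fun M)" using padded[OF F(1)] by blast
      have "(F, tm_fun M) \<in> ?p" using F(1) M RM_no_subset unfolding poly_equiv_on_def by auto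
      then have "Z = \<phi> (?n `` {tm_fun M})"
        unfolding F(2) \<phi>_class[OF M(1)] by (rule equiv_class_eq[OF ep])
      then show ?thesis using M(1) by (auto intro: quotientI)
    qed
    then show "\<phi> ` (RM_no // ?n) = RM_P // ?p" using \<phi>_closed by blast
  qed
  ultimately have "\<phi> \<in> iso RM_no_mod_poly RM_P_mod_poly"
    unfolding iso_def RM_no_mod_poly_def RM_P_mod_poly_def quotient_simps by blast
  moreover have "\<phi> \<one>\<^bsub>RM_no_mod_poly\<^esub> = \<one>\<^bsub>RM_P_mod_poly\<^esub>"
    unfolding RM_no_mod_poly_def RM_P_mod_poly_def quotient_simps by (rule \<phi>_class[OF Some_in_RM_no])
  ultimately show ?thesis by blast
qed

end
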